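(* Let $\mathcal{C}$ be a braided (ribbon) tensor category over $k$ and let $A\in\mathcal{C}$ be an étale algebra. Let $H$ be a Hopf algebra over $k$ (in vector spaces) acting faithfully on $A$. Then $H$ is the group algebra $k[G]$ for some subgroup $G\subset \mathrm{Aut}_{\mathrm{alg}}(A)$ of the group of algebra automorphisms of $A$.
   Context: $k$ is an algebraically closed field of characteristic zero. A tensor category is a $k$-linear abelian monoidal category with $k$-linear tensor product whose unit object $I$ is simple, in particular $\mathcal{C}(I,I)\cong k$; $\mathcal{C}(X,Y)$ denotes the hom-space. In a spherical tensor category write $\mathrm{ev}_X\colon X^*\otimes X\to I$, $\mathrm{coev}_X\colon I\to X\otimes X^*$ for evaluation and coevaluation and $s_X\colon X\to X^{**}$ for the spherical structure (associativity and unit isomorphisms are suppressed). A ribbon tensor category is in particular braided and spherical. Algebras $A=(A,m,\iota)$ in $\mathcal{C}$ are associative and unital. The canonical trace of $A$ is $\varepsilon=\mathrm{ev}_{A^*}\circ(s_A\otimes 1)\circ(m\otimes 1)\circ(1\otimes\mathrm{coev}_A)\colon A\to I$, and the canonical pairing is $b=\varepsilon\circ m\colon A\otimes A\to I$. $A$ is separable if $b$ is non-degenerate, i.e. there is $\kappa\colon I\to A\otimes A$ with $(b\otimes 1)\circ(1\otimes\kappa)=1_A$ (then also $(1\otimes b)\circ(\kappa\otimes 1)=1_A$). An étale algebra is a commutative separable algebra $A$ with $\mathcal{C}(I,A)=k$ (spanned by $\iota$). An action of a bialgebra $H$ (over $k$, with coproduct $\delta(h)=\sum_{(h)}h_{(0)}\otimes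 h_{(1)}$ and counit $\varepsilon_H$) on $A$ is a morphism $H\otimes A\to A$, equivalently a linear map $\rho\colon H\to\mathcal{C}(A,A)$, such that: $\rho$ is a unital algebra homomorphism with respect to composition on $\mathcal{C}(A,A)$; $\rho(h)\circ m=\sum_{(h)}m\circ(\rho(h_{(0)})\otimes\rho(h_{(1)}))$; and $\rho(h)\circ\iota=\varepsilon_H(h)\,\iota$ for all $h\in H$. The action is faithful if $\rho$ is injective. A group $G\subset\mathrm{Aut}_{\mathrm{alg}}(A)$ acts on $A$ and, by linear extension, so does the Hopf algebra $k[G]$. *)

theory Defs
  imports
    "HOL-Algebra.Group"
    "HOL-Library.Poly_Mapping"
    "HOL-Computational_Algebra.Polynomial"
begin

section \<open>Linear abelian categories\<close>

text \<open>
  All elements of the type \<open>'o\<close> are objects. The hom-spaces are subspaces of one ambient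
  vector space \<open>'m\<close>, which is no restriction: a linear category with hom-spaces \<open>C(X,Y)\<close> is
  recovered from the ambient space given by the direct sum of all \<open>C(X,Y)\<close>, with composition
  and tensor product extended bilinearly. Hom-spaces are not assumed to be disjoint, and the
  operations are only constrained on composable or well-typed arguments.
  Composition is written in the order of function composition.
\<close>

record ('k, 'o, 'm) linear_cat =
  scale :: "'k \<Rightarrow> 'm \<Rightarrow> 'm"  (infixr "*\<^sub>s\<index>" 75)
  hom :: "'o \<Rightarrow> 'o \<Rightarrow> 'm set"
  idt :: "'o \<Rightarrow> 'm"
  comp :: "'m \<Rightarrow> 'm \<Rightarrow> 'm"  (infixl "\<cdot>\<index>" 68)

hide_const (open) Group.hom

locale linear_category =
  fixes C :: "('k::field, 'o, 'm::ab_group_add, 'z) linear_cat_scheme" (structure)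
  assumes vector_space_scale: "vector_space (scale C)"
    and hom_subspace: "module.subspace (scale C) (hom C X Y)"
    and idt_hom: "idt C X \<in> hom C X X"
    and comp_hom: "\<lbrakk>g \<in> hom C Y Z; f \<in> hom C X Y\<rbrakk> \<Longrightarrow> g \<cdot> f \<in> hom C X Z"
    and comp_assoc:
      "\<lbrakk>h \<in> hom C Y Z; g \<in> hom C X Y; f \<in> hom C W X\<rbrakk> \<Longrightarrow> (h \<cdot> g) \<cdot> f = h \<cdot> (g \<cdot> f)"
    and comp_idt_left: "f \<in> hom C X Y \<Longrightarrow> idt C Y \<cdot> f = f"
    and comp_idt_right: "f \<in> hom C X Y \<Longrightarrow> f \<cdot> idt C X = f"
    and comp_add_left:
      "\<lbrakk>g \<in> hom C Y Z; g' \<in> hom C Y Z; f \<in> hom C X Y\<rbrakk> \<Longrightarrow> (g + g') \<cdot> f = g \<cdot> f + g' \<cdot> f"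
    and comp_add_right:
      "\<lbrakk>g \<in> hom C Y Z; f \<in> hom C X Y; f' \<in> hom C X Y\<rbrakk> \<Longrightarrow> g \<cdot> (f + f') = g \<cdot> f + g \<cdot> f'"
    and comp_scale_left:
      "\<lbrakk>g \<in> hom C Y Z; f \<in> hom C X Y\<rbrakk> \<Longrightarrow> (a *\<^sub>s g) \<cdot> f = a *\<^sub>s (g \<cdot> f)"
    and comp_scale_right:
      "\<lbrakk>g \<in> hom C Y Z; f \<in> hom C X Y\<rbrakk> \<Longrightarrow> g \<cdot> (a *\<^sub>s f) = a *\<^sub>s (g \<cdot> f)"

definition is_inverse ::
    "('k, 'o, 'm, 'z) linear_cat_scheme \<Rightarrow> 'o \<Rightarrow> 'o \<Rightarrow> 'm \<Rightarrow> 'm \<Rightarrow> bool" where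
  "is_inverse C X Y f g \<longleftrightarrow>
     f \<in> hom C X Y \<and> g \<in> hom C Y X \<and> g \<cdot>\<^bsub>C\<^esub> f = idt C X \<and> f \<cdot>\<^bsub>C\<^esub> g = idt C Y"

definition is_iso :: "('k, 'o, 'm, 'z) linear_cat_scheme \<Rightarrow> 'o \<Rightarrow> 'o \<Rightarrow> 'm \<Rightarrow> bool" where
  "is_iso C X Y f \<longleftrightarrow> (\<exists>g. is_inverse C X Y f g)"

definition inv_arrow :: "('k, 'o, 'm, 'z) linear_cat_scheme \<Rightarrow> 'o \<Rightarrow> 'o \<Rightarrow> 'm \<Rightarrow> 'm" where
  "inv_arrow C X Y f = (THE g. is_inverse C X Y f g)"

definition is_zero_object ::
    "('k, 'o, 'm, 'z) linear_cat_scheme \<Rightarrow> 'o \<Rightarrow> bool" where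
  "is_zero_object C Z \<longleftrightarrow> (\<forall>X. (\<exists>!f. f \<in> hom C X Z) \<and> (\<exists>!f. f \<in> hom C Z X))"

definition is_mono :: "('k, 'o, 'm, 'z) linear_cat_scheme \<Rightarrow> 'o \<Rightarrow> 'o \<Rightarrow> 'm \<Rightarrow> bool" where
  "is_mono C X Y f \<longleftrightarrow> f \<in> hom C X Y \<and>
     (\<forall>W. \<forall>g\<in>hom C W X. \<forall>h\<in>hom C W X. f \<cdot>\<^bsub>C\<^esub> g = f \<cdot>\<^bsub>C\<^esub> h \<longrightarrow> g = h)"

definition is_epi :: "('k, 'o, 'm, 'z) linear_cat_scheme \<Rightarrow> 'o \<Rightarrow> 'o \<Rightarrow> 'm \<Rightarrow> bool" where
  "is_epi C X Y f \<longleftrightarrow> f \<in> hom C X Y \<and>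
     (\<forall>Z. \<forall>g\<in>hom C Y Z. \<forall>h\<in>hom C Y Z. g \<cdot>\<^bsub>C\<^esub> f = h \<cdot>\<^bsub>C\<^esub> f \<longrightarrow> g = h)"

definition is_kernel ::
    "('k, 'o, 'm::zero, 'z) linear_cat_scheme \<Rightarrow> 'o \<Rightarrow> 'o \<Rightarrow> 'm \<Rightarrow> 'o \<Rightarrow> 'm \<Rightarrow> bool" where
  "is_kernel C X Y f K i \<longleftrightarrow> f \<in> hom C X Y \<and> i \<in> hom C K X \<and> f \<cdot>\<^bsub>C\<^esub> i = 0 \<and>
     (\<forall>W. \<forall>g\<in>hom C W X. f \<cdot>\<^bsub>C\<^esub> g = 0 \<longrightarrow> (\<exists>!u. u \<in> hom C W K \<and> i \<cdot>\<^bsub>C\<^esub> u = g))"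

definition is_cokernel ::
    "('k, 'o, 'm::zero, 'z) linear_cat_scheme \<Rightarrow> 'o \<Rightarrow> 'o \<Rightarrow> 'm \<Rightarrow> 'o \<Rightarrow> 'm \<Rightarrow> bool" where
  "is_cokernel C X Y f Q p \<longleftrightarrow> f \<in> hom C X Y \<and> p \<in> hom C Y Q \<and> p \<cdot>\<^bsub>C\<^esub> f = 0 \<and>
     (\<forall>Z. \<forall>g\<in>hom C Y Z. g \<cdot>\<^bsub>C\<^esub> f = 0 \<longrightarrow> (\<exists>!u. u \<in> hom C Q Z \<and> u \<cdot>\<^bsub>C\<^esub> p = g))"

definition is_biproduct ::
    "('k, 'o, 'm::{zero,plus}, 'z) linear_cat_scheme \<Rightarrow>
       'o \<Rightarrow> 'o \<Rightarrow> 'o \<Rightarrow> 'm \<Rightarrow> 'm \<Rightarrow> 'm \<Rightarrow> 'm \<Rightarrow> bool" where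
  "is_biproduct C X Y P i j p q \<longleftrightarrow>
     i \<in> hom C X P \<and> j \<in> hom C Y P \<and> p \<in> hom C P X \<and> q \<in> hom C P Y \<and>
     p \<cdot>\<^bsub>C\<^esub> i = idt C X \<and> q \<cdot>\<^bsub>C\<^esub> j = idt C Y \<and> p \<cdot>\<^bsub>C\<^esub> j = 0 \<and> q \<cdot>\<^bsub>C\<^esub> i = 0 \<and>
     i \<cdot>\<^bsub>C\<^esub> p + j \<cdot>\<^bsub>C\<^esub> q = idt C P"

locale abelian_category = linear_category +
  assumes zero_object_exists: "\<exists>Z. is_zero_object C Z"
    and biproduct_exists: "\<exists>P i j p q. is_biproduct C X Y P i j p q"
    and kernel_exists: "f \<in> hom C X Y \<Longrightarrow> \<exists>K i. is_kernel C X Y f K i"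
    and cokernel_exists: "f \<in> hom C X Y \<Longrightarrow> \<exists>Q p. is_cokernel C X Y f Q p"
    and mono_is_kernel: "is_mono C K X i \<Longrightarrow> \<exists>Y f. is_kernel C X Y f K i"
    and epi_is_cokernel: "is_epi C Y Q p \<Longrightarrow> \<exists>X f. is_cokernel C X Y f Q p"

definition is_simple_object ::
    "('k, 'o, 'm, 'z) linear_cat_scheme \<Rightarrow> 'o \<Rightarrow> bool" where
  "is_simple_object C S \<longleftrightarrow> \<not> is_zero_object C S \<and>
     (\<forall>U i. is_mono C U S i \<longrightarrow> is_zero_object C U \<or> is_iso C U S i)"


section \<open>Tensor categories\<close>

record ('k, 'o, 'm) tensor_cat = "('k, 'o, 'm) linear_cat" +
  tensor_obj :: "'o \<Rightarrow> 'o \<Rightarrow> 'o"  (infixr "\<otimes>\<^sub>o\<index>" 70)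
  tensor_arr :: "'m \<Rightarrow> 'm \<Rightarrow> 'm"  (infixr "\<otimes>\<^sub>a\<index>" 70)
  unit_obj :: "'o"  ("\<I>\<index>")
  assoc :: "'o \<Rightarrow> 'o \<Rightarrow> 'o \<Rightarrow> 'm"
  lunit :: "'o \<Rightarrow> 'm"
  runit :: "'o \<Rightarrow> 'm"

definition assoc_inv :: "('k, 'o, 'm, 'z) tensor_cat_scheme \<Rightarrow> 'o \<Rightarrow> 'o \<Rightarrow> 'o \<Rightarrow> 'm" where
  "assoc_inv C X Y Z =
     inv_arrow C ((X \<otimes>\<^sub>o\<^bsub>C\<^esub> Y) \<otimes>\<^sub>o\<^bsub>C\<^esub> Z) (X \<otimes>\<^sub>o\<^bsub>C\<^esub> (Y \<otimes>\<^sub>o\<^bsub>C\<^esub> Z)) (assoc C X Y Z)"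

definition lunit_inv :: "('k, 'o, 'm, 'z) tensor_cat_scheme \<Rightarrow> 'o \<Rightarrow> 'm" where
  "lunit_inv C X = inv_arrow C (\<I>\<^bsub>C\<^esub> \<otimes>\<^sub>o\<^bsub>C\<^esub> X) X (lunit C X)"

definition runit_inv :: "('k, 'o, 'm, 'z) tensor_cat_scheme \<Rightarrow> 'o \<Rightarrow> 'm" where
  "runit_inv C X = inv_arrow C (X \<otimes>\<^sub>o\<^bsub>C\<^esub> \<I>\<^bsub>C\<^esub>) X (runit C X)"

text \<open>
  By Schur's lemma, simplicity of the unit only makes \<open>C(I,I)\<close> a division algebra over \<open>k\<close>;
  since hom-spaces are not assumed to be finite-dimensional, \<open>C(I,I) = k\<close> is the separate
  last axiom.
\<close>

locale tensor_category = abelian_category C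
  for C :: "('k::field, 'o, 'm::ab_group_add, 'z) tensor_cat_scheme" (structure) +
  assumes tensor_hom:
      "\<lbrakk>f \<in> hom C X X'; g \<in> hom C Y Y'\<rbrakk> \<Longrightarrow> f \<otimes>\<^sub>a g \<in> hom C (X \<otimes>\<^sub>o Y) (X' \<otimes>\<^sub>o Y')"
    and tensor_idt: "idt C X \<otimes>\<^sub>a idt C Y = idt C (X \<otimes>\<^sub>o Y)"
    and tensor_comp:
      "\<lbrakk>f \<in> hom C X X'; f' \<in> hom C X' X''; g \<in> hom C Y Y'; g' \<in> hom C Y' Y''\<rbrakk>
        \<Longrightarrow> (f' \<cdot> f) \<otimes>\<^sub>a (g' \<cdot> g) = (f' \<otimes>\<^sub>a g') \<cdot> (f \<otimes>\<^sub>a g)"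
    and tensor_add_left:
      "\<lbrakk>f \<in> hom C X X'; f' \<in> hom C X X'; g \<in> hom C Y Y'\<rbrakk>
        \<Longrightarrow> (f + f') \<otimes>\<^sub>a g = f \<otimes>\<^sub>a g + f' \<otimes>\<^sub>a g"
    and tensor_add_right:
      "\<lbrakk>f \<in> hom C X X'; g \<in> hom C Y Y'; g' \<in> hom C Y Y'\<rbrakk>
        \<Longrightarrow> f \<otimes>\<^sub>a (g + g') = f \<otimes>\<^sub>a g + f \<otimes>\<^sub>a g'"
    and tensor_scale_left:
      "\<lbrakk>f \<in> hom C X X'; g \<in> hom C Y Y'\<rbrakk> \<Longrightarrow> (a *\<^sub>s f) \<otimes>\<^sub>a g = a *\<^sub>s (f \<otimes>\<^sub>a g)"
    and tensor_scale_right: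
      "\<lbrakk>f \<in> hom C X X'; g \<in> hom C Y Y'\<rbrakk> \<Longrightarrow> f \<otimes>\<^sub>a (a *\<^sub>s g) = a *\<^sub>s (f \<otimes>\<^sub>a g)"
    and assoc_iso: "is_iso C ((X \<otimes>\<^sub>o Y) \<otimes>\<^sub>o Z) (X \<otimes>\<^sub>o (Y \<otimes>\<^sub>o Z)) (assoc C X Y Z)"
    and assoc_natural:
      "\<lbrakk>f \<in> hom C X X'; g \<in> hom C Y Y'; h \<in> hom C Z Z'\<rbrakk>
        \<Longrightarrow> assoc C X' Y' Z' \<cdot> ((f \<otimes>\<^sub>a g) \<otimes>\<^sub>a h) = (f \<otimes>\<^sub>a (g \<otimes>\<^sub>a h)) \<cdot> assoc C X Y Z"
    and lunit_iso: "is_iso C (\<I> \<otimes>\<^sub>o X) X (lunit C X)"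
    and lunit_natural:
      "f \<in> hom C X Y \<Longrightarrow> lunit C Y \<cdot> (idt C \<I> \<otimes>\<^sub>a f) = f \<cdot> lunit C X"
    and runit_iso: "is_iso C (X \<otimes>\<^sub>o \<I>) X (runit C X)"
    and runit_natural:
      "f \<in> hom C X Y \<Longrightarrow> runit C Y \<cdot> (f \<otimes>\<^sub>a idt C \<I>) = f \<cdot> runit C X"
    and pentagon:
      "assoc C W X (Y \<otimes>\<^sub>o Z) \<cdot> assoc C (W \<otimes>\<^sub>o X) Y Z =
       (idt C W \<otimes>\<^sub>a assoc C X Y Z) \<cdot> assoc C W (X \<otimes>\<^sub>o Y) Z \<cdot> (assoc C W X Y \<otimes>\<^sub>a idt C Z)"
    and triangle:
      "(idt C X \<otimes>\<^sub>a lunit C Y) \<cdot> assoc C X \<I> Y = runit C X \<otimes>\<^sub>a idt C Y"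
    and unit_simple: "is_simple_object C \<I>"
    and unit_endomorphisms: "bij_betw (\<lambda>a. a *\<^sub>s idt C \<I>) UNIV (hom C \<I> \<I>)"


section \<open>Ribbon tensor categories\<close>

record ('k, 'o, 'm) ribbon_cat = "('k, 'o, 'm) tensor_cat" +
  braid :: "'o \<Rightarrow> 'o \<Rightarrow> 'm"
  dual :: "'o \<Rightarrow> 'o"
  ev :: "'o \<Rightarrow> 'm"
  coev :: "'o \<Rightarrow> 'm"
  twist :: "'o \<Rightarrow> 'm"

locale braided_tensor_category = tensor_category C
  for C :: "('k::field, 'o, 'm::ab_group_add, 'z) ribbon_cat_scheme" (structure) +
  assumes braid_iso: "is_iso C (X \<otimes>\<^sub>o Y) (Y \<otimes>\<^sub>o X) (braid C X Y)"
    and braid_natural: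
      "\<lbrakk>f \<in> hom C X X'; g \<in> hom C Y Y'\<rbrakk>
        \<Longrightarrow> braid C X' Y' \<cdot> (f \<otimes>\<^sub>a g) = (g \<otimes>\<^sub>a f) \<cdot> braid C X Y"
    and hexagon_forward:
      "assoc C Y Z X \<cdot> braid C X (Y \<otimes>\<^sub>o Z) \<cdot> assoc C X Y Z =
       (idt C Y \<otimes>\<^sub>a braid C X Z) \<cdot> assoc C Y X Z \<cdot> (braid C X Y \<otimes>\<^sub>a idt C Z)"
    and hexagon_backward:
      "assoc_inv C Z X Y \<cdot> braid C (X \<otimes>\<^sub>o Y) Z \<cdot> assoc_inv C X Y Z =
       (braid C X Z \<otimes>\<^sub>a idt C Y) \<cdot> assoc_inv C X Z Y \<cdot> (idt C X \<otimes>\<^sub>a braid C Y Z)"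

text \<open>The transpose \<open>Y\<^sup>* \<rightarrow> X\<^sup>*\<close> of an arrow \<open>f: X \<rightarrow> Y\<close>.\<close>

definition transpose_arr ::
    "('k, 'o, 'm, 'z) ribbon_cat_scheme \<Rightarrow> 'o \<Rightarrow> 'o \<Rightarrow> 'm \<Rightarrow> 'm" where
  "transpose_arr C X Y f =
     lunit C (dual C X) \<cdot>\<^bsub>C\<^esub>
     (ev C Y \<otimes>\<^sub>a\<^bsub>C\<^esub> idt C (dual C X)) \<cdot>\<^bsub>C\<^esub>
     assoc_inv C (dual C Y) Y (dual C X) \<cdot>\<^bsub>C\<^esub>
     (idt C (dual C Y) \<otimes>\<^sub>a\<^bsub>C\<^esub> (f \<otimes>\<^sub>a\<^bsub>C\<^esub> idt C (dual C X))) \<cdot>\<^bsub>C\<^esub>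
     (idt C (dual C Y) \<otimes>\<^sub>a\<^bsub>C\<^esub> coev C X) \<cdot>\<^bsub>C\<^esub>
     runit_inv C (dual C Y)"

locale ribbon_tensor_category = braided_tensor_category C
  for C :: "('k::field, 'o, 'm::ab_group_add, 'z) ribbon_cat_scheme" (structure) +
  assumes ev_hom: "ev C X \<in> hom C (dual C X \<otimes>\<^sub>o X) \<I>"
    and coev_hom: "coev C X \<in> hom C \<I> (X \<otimes>\<^sub>o dual C X)"
    and zigzag_obj:
      "runit C X \<cdot> (idt C X \<otimes>\<^sub>a ev C X) \<cdot> assoc C X (dual C X) X \<cdot>
         (coev C X \<otimes>\<^sub>a idt C X) \<cdot> lunit_inv C X = idt C X"
    and zigzag_dual:
      "lunit C (dual C X) \<cdot> (ev C X \<otimes>\<^sub>a idt C (dual C X)) \<cdot>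
         assoc_inv C (dual C X) X (dual C X) \<cdot>
         (idt C (dual C X) \<otimes>\<^sub>a coev C X) \<cdot> runit_inv C (dual C X) = idt C (dual C X)"
    and twist_iso: "is_iso C X X (twist C X)"
    and twist_natural: "f \<in> hom C X Y \<Longrightarrow> twist C Y \<cdot> f = f \<cdot> twist C X"
    and twist_tensor:
      "twist C (X \<otimes>\<^sub>o Y) = braid C Y X \<cdot> braid C X Y \<cdot> (twist C X \<otimes>\<^sub>a twist C Y)"
    and twist_dual: "twist C (dual C X) = transpose_arr C X X (twist C X)"

text \<open>
  The Drinfeld morphism \<open>X \<rightarrow> X\<^sup>*\<^sup>*\<close> and the spherical structure of a ribbon category, obtained
  from it by precomposing with the twist. It is monoidal by \<open>twist_tensor\<close>, and left and right
  traces agree by \<open>twist_dual\<close>.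
\<close>

definition drinfeld_arr :: "('k, 'o, 'm, 'z) ribbon_cat_scheme \<Rightarrow> 'o \<Rightarrow> 'm" where
  "drinfeld_arr C X =
     (let D = dual C X; E = dual C D in
      lunit C E \<cdot>\<^bsub>C\<^esub>
      (ev C X \<otimes>\<^sub>a\<^bsub>C\<^esub> idt C E) \<cdot>\<^bsub>C\<^esub>
      (braid C X D \<otimes>\<^sub>a\<^bsub>C\<^esub> idt C E) \<cdot>\<^bsub>C\<^esub>
      assoc_inv C X D E \<cdot>\<^bsub>C\<^esub>
      (idt C X \<otimes>\<^sub>a\<^bsub>C\<^esub> coev C D) \<cdot>\<^bsub>C\<^esub>
      runit_inv C X)"

definition spherical_str :: "('k, 'o, 'm, 'z) ribbon_cat_scheme \<Rightarrow> 'o \<Rightarrow> 'm" where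
  "spherical_str C X = drinfeld_arr C X \<cdot>\<^bsub>C\<^esub> twist C X"


section \<open>Algebras in a tensor category\<close>

locale algebra_in = tensor_category C
  for C :: "('k::field, 'o, 'm::ab_group_add, 'z) tensor_cat_scheme" (structure) +
  fixes A :: 'o and m \<iota> :: 'm
  assumes m_hom: "m \<in> hom C (A \<otimes>\<^sub>o A) A"
    and \<iota>_hom: "\<iota> \<in> hom C \<I> A"
    and m_assoc: "m \<cdot> (m \<otimes>\<^sub>a idt C A) = m \<cdot> (idt C A \<otimes>\<^sub>a m) \<cdot> assoc C A A A"
    and m_unit_left: "m \<cdot> (\<iota> \<otimes>\<^sub>a idt C A) = lunit C A"
    and m_unit_right: "m \<cdot> (idt C A \<otimes>\<^sub>a \<iota>) = runit C A"

definition canonical_trace :: "('k, 'o, 'm, 'z) ribbon_cat_scheme \<Rightarrow> 'o \<Rightarrow> 'm \<Rightarrow> 'm" where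
  "canonical_trace C A m =
     ev C (dual C A) \<cdot>\<^bsub>C\<^esub>
     (spherical_str C A \<otimes>\<^sub>a\<^bsub>C\<^esub> idt C (dual C A)) \<cdot>\<^bsub>C\<^esub>
     (m \<otimes>\<^sub>a\<^bsub>C\<^esub> idt C (dual C A)) \<cdot>\<^bsub>C\<^esub>
     assoc_inv C A A (dual C A) \<cdot>\<^bsub>C\<^esub>
     (idt C A \<otimes>\<^sub>a\<^bsub>C\<^esub> coev C A) \<cdot>\<^bsub>C\<^esub>
     runit_inv C A"

definition canonical_pairing :: "('k, 'o, 'm, 'z) ribbon_cat_scheme \<Rightarrow> 'o \<Rightarrow> 'm \<Rightarrow> 'm" where
  "canonical_pairing C A m = canonical_trace C A m \<cdot>\<^bsub>C\<^esub> m"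

definition nondegenerate_pairing ::
    "('k, 'o, 'm, 'z) tensor_cat_scheme \<Rightarrow> 'o \<Rightarrow> 'm \<Rightarrow> bool" where
  "nondegenerate_pairing C A b \<longleftrightarrow>
     (\<exists>\<kappa>\<in>hom C \<I>\<^bsub>C\<^esub> (A \<otimes>\<^sub>o\<^bsub>C\<^esub> A).
        lunit C A \<cdot>\<^bsub>C\<^esub> (b \<otimes>\<^sub>a\<^bsub>C\<^esub> idt C A) \<cdot>\<^bsub>C\<^esub> assoc_inv C A A A \<cdot>\<^bsub>C\<^esub>
          (idt C A \<otimes>\<^sub>a\<^bsub>C\<^esub> \<kappa>) \<cdot>\<^bsub>C\<^esub> runit_inv C A = idt C A)"

locale etale_algebra = ribbon_tensor_category C + algebra_in C A m \<iota>
  for C :: "('k::field, 'o, 'm::ab_group_add, 'z) ribbon_cat_scheme" (structure)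
    and A :: 'o and m \<iota> :: 'm +
  assumes commutative: "m \<cdot> braid C A A = m"
    and separable: "nondegenerate_pairing C A (canonical_pairing C A m)"
    and connected: "bij_betw (\<lambda>a. a *\<^sub>s \<iota>) UNIV (hom C \<I> A)"

definition alg_aut_group ::
    "('k, 'o, 'm, 'z) tensor_cat_scheme \<Rightarrow> 'o \<Rightarrow> 'm \<Rightarrow> 'm \<Rightarrow> 'm monoid" where
  "alg_aut_group C A m \<iota> =
     \<lparr>carrier = {f. is_iso C A A f \<and> f \<cdot>\<^bsub>C\<^esub> m = m \<cdot>\<^bsub>C\<^esub> (f \<otimes>\<^sub>a\<^bsub>C\<^esub> f) \<and> f \<cdot>\<^bsub>C\<^esub> \<iota> = \<iota>},
      monoid.mult = comp C, one = idt C A\<rparr>"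


section \<open>Tensor products of vector spaces\<close>

text \<open>
  The free vector space on a set \<open>S\<close> consists of the finitely supported functions
  \<open>'x \<Rightarrow>\<^sub>0 'k\<close> with support in \<open>S\<close>. The tensor powers \<open>V \<otimes> V\<close> and \<open>V \<otimes> V \<otimes> V\<close> are the
  quotients of the free vector spaces on \<open>V \<times> V\<close> and \<open>V \<times> V \<times> V\<close> by the span of the
  multilinearity relations; tensors are handled through representatives and the predicates
  \<open>tensor2_eq\<close> and \<open>tensor3_eq\<close> below.
\<close>

definition free_scale :: "'k \<Rightarrow> ('x \<Rightarrow>\<^sub>0 'k::field) \<Rightarrow> ('x \<Rightarrow>\<^sub>0 'k)" where
  "free_scale a t = Poly_Mapping.map ((*) a) t"

definition free_extend ::
    "('k \<Rightarrow> 'v \<Rightarrow> 'v) \<Rightarrow> ('x \<Rightarrow> 'v) \<Rightarrow> ('x \<Rightarrow>\<^sub>0 'k::zero) \<Rightarrow> 'v::comm_monoid_add" where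
  "free_extend s F t = (\<Sum>x\<in>Poly_Mapping.keys t. s (Poly_Mapping.lookup t x) (F x))"

abbreviation basis_elt :: "'x \<Rightarrow> ('x \<Rightarrow>\<^sub>0 'k::field)" where
  "basis_elt x \<equiv> Poly_Mapping.single x 1"

definition tensor2_relations ::
    "('k::field \<Rightarrow> 'v \<Rightarrow> 'v) \<Rightarrow> 'v::ab_group_add set \<Rightarrow> ('v \<times> 'v \<Rightarrow>\<^sub>0 'k) set" where
  "tensor2_relations s V =
     {basis_elt (x + x', y) - basis_elt (x, y) - basis_elt (x', y) | x x' y.
        x \<in> V \<and> x' \<in> V \<and> y \<in> V} \<union>
     {basis_elt (x, y + y') - basis_elt (x, y) - basis_elt (x, y') | x y y'.
        x \<in> V \<and> y \<in> V \<and> y' \<in> V} \<union>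
     {basis_elt (s a x, y) - free_scale a (basis_elt (x, y)) | a x y. x \<in> V \<and> y \<in> V} \<union>
     {basis_elt (x, s a y) - free_scale a (basis_elt (x, y)) | a x y. x \<in> V \<and> y \<in> V}"

definition tensor3_relations ::
    "('k::field \<Rightarrow> 'v \<Rightarrow> 'v) \<Rightarrow> 'v::ab_group_add set \<Rightarrow> ('v \<times> 'v \<times> 'v \<Rightarrow>\<^sub>0 'k) set" where
  "tensor3_relations s V =
     {basis_elt (x + x', y, z) - basis_elt (x, y, z) - basis_elt (x', y, z) | x x' y z.
        x \<in> V \<and> x' \<in> V \<and> y \<in> V \<and> z \<in> V} \<union>
     {basis_elt (x, y + y', z) - basis_elt (x, y, z) - basis_elt (x, y', z) | x y y' z.
        x \<in> V \<and> y \<in> V \<and> y' \<in> V \<and> z \<in> V} \<union>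
     {basis_elt (x, y, z + z') - basis_elt (x, y, z) - basis_elt (x, y, z') | x y z z'.
        x \<in> V \<and> y \<in> V \<and> z \<in> V \<and> z' \<in> V} \<union>
     {basis_elt (s a x, y, z) - free_scale a (basis_elt (x, y, z)) | a x y z.
        x \<in> V \<and> y \<in> V \<and> z \<in> V} \<union>
     {basis_elt (x, s a y, z) - free_scale a (basis_elt (x, y, z)) | a x y z.
        x \<in> V \<and> y \<in> V \<and> z \<in> V} \<union>
     {basis_elt (x, y, s a z) - free_scale a (basis_elt (x, y, z)) | a x y z.
        x \<in> V \<and> y \<in> V \<and> z \<in> V}"

definition tensor2_eq ::
    "('k::field \<Rightarrow> 'v \<Rightarrow> 'v) \<Rightarrow> 'v::ab_group_add set \<Rightarrow>
       ('v \<times> 'v \<Rightarrow>\<^sub>0 'k) \<Rightarrow> ('v \<times> 'v \<Rightarrow>\<^sub>0 'k) \<Rightarrow> bool" where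
  "tensor2_eq s V t u \<longleftrightarrow> t - u \<in> module.span free_scale (tensor2_relations s V)"

definition tensor3_eq ::
    "('k::field \<Rightarrow> 'v \<Rightarrow> 'v) \<Rightarrow> 'v::ab_group_add set \<Rightarrow>
       ('v \<times> 'v \<times> 'v \<Rightarrow>\<^sub>0 'k) \<Rightarrow> ('v \<times> 'v \<times> 'v \<Rightarrow>\<^sub>0 'k) \<Rightarrow> bool" where
  "tensor3_eq s V t u \<longleftrightarrow> t - u \<in> module.span free_scale (tensor3_relations s V)"


section \<open>Hopf algebras\<close>

text \<open>
  The underlying space \<open>hcarrier\<close> is a subspace of an ambient vector space \<open>'h\<close>.
  The field \<open>hcomult\<close> yields a representative of the coproduct in the free vector space on
  pairs, as in Sweedler notation.
\<close>

record (overloaded) ('k::zero, 'h) hopf =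
  hcarrier :: "'h set"
  hscale :: "'k \<Rightarrow> 'h \<Rightarrow> 'h"
  hmult :: "'h \<Rightarrow> 'h \<Rightarrow> 'h"
  hone :: "'h"
  hcomult :: "'h \<Rightarrow> ('h \<times> 'h \<Rightarrow>\<^sub>0 'k)"
  hcounit :: "'h \<Rightarrow> 'k"
  hantipode :: "'h \<Rightarrow> 'h"

definition linear_on ::
    "('k \<Rightarrow> 'v \<Rightarrow> 'v) \<Rightarrow> ('k \<Rightarrow> 'w \<Rightarrow> 'w) \<Rightarrow> 'v::plus set \<Rightarrow> ('v \<Rightarrow> 'w::plus) \<Rightarrow> bool" where
  "linear_on s s' V f \<longleftrightarrow>
     (\<forall>x\<in>V. \<forall>y\<in>V. f (x + y) = f x + f y) \<and> (\<forall>a. \<forall>x\<in>V. f (s a x) = s' a (f x))"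

locale hopf_algebra =
  fixes H :: "('k::field, 'h::ab_group_add, 'z) hopf_scheme"
  assumes vector_space_H: "vector_space (hscale H)"
    and carrier_subspace: "module.subspace (hscale H) (hcarrier H)"
    and mult_closed: "\<lbrakk>x \<in> hcarrier H; y \<in> hcarrier H\<rbrakk> \<Longrightarrow> hmult H x y \<in> hcarrier H"
    and one_closed: "hone H \<in> hcarrier H"
    and mult_assoc: "\<lbrakk>x \<in> hcarrier H; y \<in> hcarrier H; z \<in> hcarrier H\<rbrakk>
        \<Longrightarrow> hmult H (hmult H x y) z = hmult H x (hmult H y z)"
    and mult_one_left: "x \<in> hcarrier H \<Longrightarrow> hmult H (hone H) x = x"
    and mult_one_right: "x \<in> hcarrier H \<Longrightarrow> hmult H x (hone H) = x"
    and mult_linear_left: "y \<in> hcarrier H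
        \<Longrightarrow> linear_on (hscale H) (hscale H) (hcarrier H) (\<lambda>x. hmult H x y)"
    and mult_linear_right: "x \<in> hcarrier H
        \<Longrightarrow> linear_on (hscale H) (hscale H) (hcarrier H) (\<lambda>y. hmult H x y)"
    and comult_closed:
      "x \<in> hcarrier H \<Longrightarrow> Poly_Mapping.keys (hcomult H x) \<subseteq> hcarrier H \<times> hcarrier H"
    and comult_add: "\<lbrakk>x \<in> hcarrier H; y \<in> hcarrier H\<rbrakk>
        \<Longrightarrow> tensor2_eq (hscale H) (hcarrier H) (hcomult H (x + y)) (hcomult H x + hcomult H y)"
    and comult_scale: "x \<in> hcarrier H
        \<Longrightarrow> tensor2_eq (hscale H) (hcarrier H)
              (hcomult H (hscale H a x)) (free_scale a (hcomult H x))"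
    and counit_linear: "linear_on (hscale H) (*) (hcarrier H) (hcounit H)"
    and coassoc: "x \<in> hcarrier H
        \<Longrightarrow> tensor3_eq (hscale H) (hcarrier H)
              (free_extend free_scale (\<lambda>(p, q).
                 free_extend free_scale (\<lambda>(p', p''). basis_elt (p', p'', q)) (hcomult H p))
                 (hcomult H x))
              (free_extend free_scale (\<lambda>(p, q).
                 free_extend free_scale (\<lambda>(q', q''). basis_elt (p, q', q'')) (hcomult H q))
                 (hcomult H x))"
    and counit_left: "x \<in> hcarrier H
        \<Longrightarrow> free_extend (hscale H) (\<lambda>(p, q). hscale H (hcounit H p) q) (hcomult H x) = x"
    and counit_right: "x \<in> hcarrier H
        \<Longrightarrow> free_extend (hscale H) (\<lambda>(p, q). hscale H (hcounit H q) p) (hcomult H x) = x"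
    and comult_mult: "\<lbrakk>x \<in> hcarrier H; y \<in> hcarrier H\<rbrakk>
        \<Longrightarrow> tensor2_eq (hscale H) (hcarrier H) (hcomult H (hmult H x y))
              (free_extend free_scale (\<lambda>(p, q).
                 free_extend free_scale (\<lambda>(p', q'). basis_elt (hmult H p p', hmult H q q'))
                   (hcomult H y))
                 (hcomult H x))"
    and comult_one:
      "tensor2_eq (hscale H) (hcarrier H) (hcomult H (hone H)) (basis_elt (hone H, hone H))"
    and counit_mult: "\<lbrakk>x \<in> hcarrier H; y \<in> hcarrier H\<rbrakk>
        \<Longrightarrow> hcounit H (hmult H x y) = hcounit H x * hcounit H y"
    and counit_one: "hcounit H (hone H) = 1"
    and antipode_closed: "x \<in> hcarrier H \<Longrightarrow> hantipode H x \<in> hcarrier H"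
    and antipode_linear: "linear_on (hscale H) (hscale H) (hcarrier H) (hantipode H)"
    and antipode_left: "x \<in> hcarrier H
        \<Longrightarrow> free_extend (hscale H) (\<lambda>(p, q). hmult H (hantipode H p) q) (hcomult H x) =
            hscale H (hcounit H x) (hone H)"
    and antipode_right: "x \<in> hcarrier H
        \<Longrightarrow> free_extend (hscale H) (\<lambda>(p, q). hmult H p (hantipode H q)) (hcomult H x) =
            hscale H (hcounit H x) (hone H)"

definition hopf_iso ::
    "('k::field, 'h::ab_group_add, 'z) hopf_scheme \<Rightarrow>
       ('k, 'l::ab_group_add, 'y) hopf_scheme \<Rightarrow> ('h \<Rightarrow> 'l) \<Rightarrow> bool" where
  "hopf_iso H L \<phi> \<longleftrightarrow>
     bij_betw \<phi> (hcarrier H) (hcarrier L) \<and>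
     linear_on (hscale H) (hscale L) (hcarrier H) \<phi> \<and>
     (\<forall>x\<in>hcarrier H. \<forall>y\<in>hcarrier H. \<phi> (hmult H x y) = hmult L (\<phi> x) (\<phi> y)) \<and>
     \<phi> (hone H) = hone L \<and>
     (\<forall>x\<in>hcarrier H. tensor2_eq (hscale L) (hcarrier L) (hcomult L (\<phi> x))
        (free_extend free_scale (\<lambda>(p, q). basis_elt (\<phi> p, \<phi> q)) (hcomult H x))) \<and>
     (\<forall>x\<in>hcarrier H. hcounit L (\<phi> x) = hcounit H x) \<and>
     (\<forall>x\<in>hcarrier H. \<phi> (hantipode H x) = hantipode L (\<phi> x))"

definition group_algebra ::
    "('g, 'z) monoid_scheme \<Rightarrow> ('k::field, 'g \<Rightarrow>\<^sub>0 'k) hopf" where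
  "group_algebra G =
     \<lparr>hcarrier = {x. Poly_Mapping.keys x \<subseteq> carrier G},
      hscale = free_scale,
      hmult = (\<lambda>x y. free_extend free_scale (\<lambda>g.
                 free_extend free_scale (\<lambda>h. basis_elt (g \<otimes>\<^bsub>G\<^esub> h)) y) x),
      hone = basis_elt \<one>\<^bsub>G\<^esub>,
      hcomult = free_extend free_scale (\<lambda>g. basis_elt (basis_elt g, basis_elt g)),
      hcounit = free_extend (*) (\<lambda>g. 1),
      hantipode = free_extend free_scale (\<lambda>g. basis_elt (inv\<^bsub>G\<^esub> g))\<rparr>"


section \<open>Actions of Hopf algebras on algebras\<close>

locale hopf_action = algebra_in C A m \<iota> + hopf_algebra H
  for C :: "('k::field, 'o, 'm::ab_group_add, 'z) tensor_cat_scheme" (structure)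
    and A :: 'o and m \<iota> :: 'm
    and H :: "('k, 'h::ab_group_add, 'y) hopf_scheme" +
  fixes \<rho> :: "'h \<Rightarrow> 'm"
  assumes action_hom: "h \<in> hcarrier H \<Longrightarrow> \<rho> h \<in> hom C A A"
    and action_linear: "linear_on (hscale H) (scale C) (hcarrier H) \<rho>"
    and action_one: "\<rho> (hone H) = idt C A"
    and action_mult: "\<lbrakk>g \<in> hcarrier H; h \<in> hcarrier H\<rbrakk> \<Longrightarrow> \<rho> (hmult H g h) = \<rho> g \<cdot> \<rho> h"
    and action_m: "h \<in> hcarrier H
        \<Longrightarrow> \<rho> h \<cdot> m = free_extend (scale C) (\<lambda>(p, q). m \<cdot> (\<rho> p \<otimes>\<^sub>a \<rho> q)) (hcomult H h)"
    and action_\<iota>: "h \<in> hcarrier H \<Longrightarrow> \<rho> h \<cdot> \<iota> = hcounit H h *\<^sub>s \<iota>"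

locale faithful_hopf_action = hopf_action +
  assumes faithful: "inj_on \<rho> (hcarrier H)"

end

theory Submission
  imports Defs
begin

text \<open>
  A separable algebra \<open>A\<close> carries a Casimir element \<open>\<kappa>: I \<rightarrow> A \<otimes> A\<close>, which can be normalised by
  \<open>m \<kappa> = \<iota>\<close>; here one needs that the twist of \<open>A\<close> is trivial. As \<open>C(I,A) = k\<close>, the arrow
  \<open>m (\<rho> x \<otimes> \<rho> y) \<kappa>\<close> is a multiple \<open>B(x,y)\<close> of the unit. Evaluating the two sides of the Frobenius
  relation with \<open>\<rho> x\<close> and \<open>\<rho> y\<close>, faithfulness gives
  \<open>\<Sum> x\<^sub>0 B(x\<^sub>1, y) = \<Sum> B(x, y\<^sub>0) y\<^sub>1\<close>, and \<open>m \<kappa> = \<iota>\<close> gives \<open>\<Sum> B(x\<^sub>0, x\<^sub>1) = \<epsilon>(x)\<close>: the coalgebra \<open>H\<close> is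
  coseparable. The first expression defines a product on \<open>H\<close>, associative by coassociativity and
  commutative because \<open>A\<close> is, and \<open>B\<close> is a nondegenerate invariant form for it. Each principal
  ideal has finite dimension, and every common eigenvector of the multiplications is a multiple
  of a grouplike element. Grouplike elements are orthonormal for \<open>B\<close>, and the orthogonal complement
  of their span is an ideal without common eigenvectors, hence zero. So \<open>H\<close> is the group algebra
  of its grouplike elements, which act by algebra automorphisms.
\<close>

section \<open>Strictification\<close>

text \<open>Neither the hom-spaces nor \<open>H\<close> are assumed finite-dimensional and
  \<open>C\<close> need not be semisimple, so structure theory of finite-dimensional Hopf algebras
  does not apply. The finiteness comes from a coproduct being a finite sum of pure tensors: a
  product \<open>y x\<close> lies in the span of the second legs of \<open>\<Delta> x\<close>. The
  twist \<theta> of \<open>A\<close> enters through the spherical structure inside the canonical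
  trace. For the copairing \<kappa> dual to the canonical pairing one finds
  \<open>trace = d (trace \<theta>)\<close>, where
  \<open>m (\<theta> \<otimes> 1) \<kappa> = d \<iota>\<close>. Nondegeneracy forces
  \<open>d \<noteq> 0\<close>, and this is possible only for \<open>\<theta> = 1\<close>; then
  \<open>m \<kappa> = d \<iota>\<close>, and dividing by \<open>d\<close> normalises \<kappa>.
  Coproducts are representatives modulo relations. Bilinear maps carry an identity of tensors to one
  of vectors, whereas the way back opens only once every element is expanded in grouplikes.
  Cocommutativity of \<open>H\<close> is therefore used in a contracted form, tested against
  \<open>B\<close>.\<close>

context linear_category begin

text \<open>The same operation, read to the right: the tail of a chain of arrows is then a subterm,
  so that calculations can rewrite it in place.\<close>

abbreviation comp_right  (infixr "\<bullet>" 68) where "g \<bullet> f \<equiv> g \<cdot> f"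

text \<open>Associativity is available only for typed arrows, and the intermediate objects do not
  occur in the equation. This rule does the two reassociations around a local rewrite at the head of
  a chain and leaves typing goals; nearly every diagram chase below is a sequence of its
  instances.\<close>

lemma comp_cong_right:
  assumes "g \<bullet> f = k \<bullet> l" "g \<in> hom C Y Z" "f \<in> hom C X Y" "k \<in> hom C Y' Z" "l \<in> hom C X Y'"
    "u \<in> hom C W X"
  shows "g \<bullet> f \<bullet> u = k \<bullet> l \<bullet> u"
  using assms comp_assoc[of g Y Z f X u W] comp_assoc[of k Y' Z l X u W] by simp

lemma comp_collapse_right:
  assumes "g \<bullet> f = k" "g \<in> hom C Y Z" "f \<in> hom C X Y" "u \<in> hom C W X"
  shows "g \<bullet> f \<bullet> u = k \<bullet> u"
  using assms comp_assoc[of g Y Z f X u W] by simp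

lemma hom_zero: "0 \<in> hom C X Y"
  and hom_scale: "f \<in> hom C X Y \<Longrightarrow> a *\<^sub>s f \<in> hom C X Y"
  using hom_subspace[of X Y] vector_space_scale
  by (auto simp: module.subspace_def module_iff_vector_space)

lemma is_inverse_unique:
  assumes "is_inverse C X Y f g" "is_inverse C X Y f h"
  shows "g = h"
proof -
  have "g = g \<cdot> (f \<cdot> h)" using assms comp_idt_right[of g Y X] by (simp add: is_inverse_def)
  also have "\<dots> = (g \<cdot> f) \<cdot> h"
    using assms comp_assoc[of g Y X f X h Y] by (simp add: is_inverse_def)
  also have "\<dots> = h" using assms comp_idt_left[of h Y X] by (simp add: is_inverse_def)
  finally show ?thesis .
qed

lemma inv_arrow_eqI: "is_inverse C X Y f g \<Longrightarrow> inv_arrow C X Y f = g"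
  unfolding inv_arrow_def by (rule the_equality) (auto intro: is_inverse_unique)

lemma inv_arrow_is_inverse: "is_iso C X Y f \<Longrightarrow> is_inverse C X Y f (inv_arrow C X Y f)"
  unfolding is_iso_def using inv_arrow_eqI by fastforce

lemma is_inverse_comp:
  assumes "is_inverse C X Y f f'" "is_inverse C Y Z g g'"
  shows "is_inverse C X Z (g \<cdot> f) (f' \<cdot> g')"
proof -
  have t: "f \<in> hom C X Y" "f' \<in> hom C Y X" "g \<in> hom C Y Z" "g' \<in> hom C Z Y"
    and e: "f' \<cdot> f = idt C X" "f \<cdot> f' = idt C Y" "g' \<cdot> g = idt C Y" "g \<cdot> g' = idt C Z"
    using assms by (auto simp: is_inverse_def)
  have "(f' \<cdot> g') \<cdot> (g \<cdot> f) = f' \<cdot> ((g' \<cdot> g) \<cdot> f)"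
    using t by (simp add: comp_assoc[of f' Y X g' Z "g \<cdot> f" X] comp_assoc[of g' Z Y g Y f X] comp_hom[of g Y Z f X])
  moreover have "(g \<cdot> f) \<cdot> (f' \<cdot> g') = g \<cdot> ((f \<cdot> f') \<cdot> g')"
    using t by (simp add: comp_assoc[of g Y Z f X "f' \<cdot> g'" Z] comp_assoc[of f X Y f' Y g' Z] comp_hom[of f' Y X g' Z])
  ultimately show ?thesis
    unfolding is_inverse_def using t e
    by (simp add: comp_idt_left[of f X Y] comp_idt_left[of g' Z Y] comp_hom[of g Y Z f X] comp_hom[of f' Y X g' Z])
qed

lemma iso_cancel_left:
  assumes "is_iso C Y Z f" "g \<in> hom C X Y" "h \<in> hom C X Y" "f \<cdot> g = f \<cdot> h"
  shows "g = h"
proof -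
  obtain f' where f': "is_inverse C Y Z f f'" using assms(1) by (auto simp: is_iso_def)
  have "f' \<cdot> (f \<cdot> k) = k" if "k \<in> hom C X Y" for k
    using f' that comp_assoc[of f' Z Y f Y k X] by (simp add: is_inverse_def comp_idt_left)
  then show ?thesis using assms(2-4) by metis
qed

lemma iso_cancel_right:
  assumes "is_iso C X Y f" "g \<in> hom C Y Z" "h \<in> hom C Y Z" "g \<cdot> f = h \<cdot> f"
  shows "g = h"
proof -
  obtain f' where f': "is_inverse C X Y f f'" using assms(1) by (auto simp: is_iso_def)
  have "(k \<cdot> f) \<cdot> f' = k" if "k \<in> hom C Y Z" for k
    using f' that comp_assoc[of k Y Z f X f' Y] by (simp add: is_inverse_def comp_idt_right)
  then show ?thesis using assms(2-4) by metis
qed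

lemma is_iso_comp: "is_iso C X Y f \<Longrightarrow> is_iso C Y Z g \<Longrightarrow> is_iso C X Z (g \<cdot> f)"
  using is_inverse_comp unfolding is_iso_def by blast

lemma is_iso_idt: "is_iso C X X (idt C X)"
  unfolding is_iso_def is_inverse_def using idt_hom comp_idt_left by blast

lemma is_iso_hom: "is_iso C X Y f \<Longrightarrow> f \<in> hom C X Y"
  by (auto simp: is_iso_def is_inverse_def)

lemma comp_cancel_right:
  assumes "g \<bullet> f = idt C X" "g \<in> hom C Y X" "f \<in> hom C X Y" "u \<in> hom C W X"
  shows "g \<bullet> f \<bullet> u = u"
  using comp_collapse_right[OF assms] comp_idt_left[OF assms(4)] by simp

sublocale scl: vector_space "scale C" by (rule vector_space_scale)

lemma comp_zero_left: "f \<in> hom C X Y \<Longrightarrow> 0 \<cdot> f = 0"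
  using comp_scale_left[OF hom_zero, of f X Y 0] by simp

end

text \<open>
  A word denotes an iterated tensor product \<open>wobj w\<close>, and \<open>flat w Z\<close> is its product with \<open>Z\<close>,
  bracketed to the right and with all units removed. For \<open>f: v \<rightarrow> w\<close> the arrow \<open>hat v w f Z\<close> is
  \<open>f \<otimes> 1\<^sub>Z\<close> conjugated by the canonical isomorphisms. All coherence isomorphisms become
  identities under \<open>hat\<close>, and \<open>hat\<close> is faithful (take \<open>Z\<close> to be the unit), so diagrams can be
  chased with a free tail \<open>Z\<close> and without associators.
\<close>

datatype 'o word = Obj 'o | Unit | Tens "'o word" "'o word"

context tensor_category begin

abbreviation tensor_object  (infixr "\<odot>" 70) where "X \<odot> Y \<equiv> X \<otimes>\<^sub>o Y"
abbreviation whisker_left  (infixr "\<lhd>" 75) where "X \<lhd> f \<equiv> idt C X \<otimes>\<^sub>a f"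
abbreviation whisker_right  (infixr "\<rhd>" 70) where "f \<rhd> Z \<equiv> f \<otimes>\<^sub>a idt C Z"

lemma is_iso_tensor:
  assumes "is_iso C X X' f" "is_iso C Y Y' g"
  shows "is_iso C (X \<odot> Y) (X' \<odot> Y') (f \<otimes>\<^sub>a g)"
proof -
  obtain f' g' where "is_inverse C X X' f f'" "is_inverse C Y Y' g g'"
    using assms by (auto simp: is_iso_def)
  then have "is_inverse C (X \<odot> Y) (X' \<odot> Y') (f \<otimes>\<^sub>a g) (f' \<otimes>\<^sub>a g')"
    using tensor_comp[of f X X' f' X g Y Y' g' Y] tensor_comp[of f' X' X f X' g' Y' Y g Y']
    by (simp add: is_inverse_def tensor_hom tensor_idt)
  then show ?thesis by (auto simp: is_iso_def)
qed

primrec wobj :: "'o word \<Rightarrow> 'o" where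
  "wobj (Obj X) = X"
| "wobj Unit = \<I>"
| "wobj (Tens v w) = wobj v \<odot> wobj w"

primrec flat :: "'o word \<Rightarrow> 'o \<Rightarrow> 'o" where
  "flat (Obj X) Z = X \<odot> Z"
| "flat Unit Z = Z"
| "flat (Tens v w) Z = flat v (flat w Z)"

primrec flat_arr :: "'o word \<Rightarrow> 'm \<Rightarrow> 'm" where
  "flat_arr (Obj X) h = X \<lhd> h"
| "flat_arr Unit h = h"
| "flat_arr (Tens v w) h = flat_arr v (flat_arr w h)"

primrec can :: "'o word \<Rightarrow> 'o \<Rightarrow> 'm" where
  "can (Obj X) Z = idt C (X \<odot> Z)"
| "can Unit Z = lunit C Z"
| "can (Tens v w) Z =
     can v (flat w Z) \<bullet> (wobj v \<lhd> can w Z) \<bullet> assoc C (wobj v) (wobj w) Z"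

definition can_inv :: "'o word \<Rightarrow> 'o \<Rightarrow> 'm" where
  "can_inv w Z = inv_arrow C (wobj w \<odot> Z) (flat w Z) (can w Z)"

definition hat :: "'o word \<Rightarrow> 'o word \<Rightarrow> 'm \<Rightarrow> 'o \<Rightarrow> 'm" where
  "hat v w f Z = can w Z \<bullet> (f \<rhd> Z) \<bullet> can_inv v Z"

section \<open>The canonical isomorphisms and the calculus of \<open>hat\<close>\<close>

lemma can_iso: "is_iso C (wobj w \<odot> Z) (flat w Z) (can w Z)"
proof (induction w arbitrary: Z)
  case (Tens v w)
  then show ?case
    by (auto intro!: is_iso_comp is_iso_tensor is_iso_idt assoc_iso)
qed (auto simp: is_iso_idt lunit_iso)

lemmas can_hom = is_iso_hom[OF can_iso]
lemmas assoc_hom = is_iso_hom[OF assoc_iso]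
lemmas lunit_hom = is_iso_hom[OF lunit_iso]
lemmas runit_hom = is_iso_hom[OF runit_iso]

lemma can_inverse: "is_inverse C (wobj w \<odot> Z) (flat w Z) (can w Z) (can_inv w Z)"
  unfolding can_inv_def by (rule inv_arrow_is_inverse[OF can_iso])

lemma can_inv_hom: "can_inv w Z \<in> hom C (flat w Z) (wobj w \<odot> Z)"
  and can_inv_can: "can_inv w Z \<cdot> can w Z = idt C (wobj w \<odot> Z)"
  using can_inverse[of w Z] by (auto simp: is_inverse_def)

lemma flat_arr_hom: "h \<in> hom C Z Z' \<Longrightarrow> flat_arr w h \<in> hom C (flat w Z) (flat w Z')"
  by (induction w arbitrary: h Z Z') (auto intro: tensor_hom idt_hom)

lemma flat_arr_idt: "flat_arr w (idt C Z) = idt C (flat w Z)"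
  by (induction w arbitrary: Z) (auto simp: tensor_idt)

lemma tensor_comp_right:
  "\<lbrakk>g \<in> hom C Y Y'; g' \<in> hom C Y' Y''\<rbrakk>
    \<Longrightarrow> X \<lhd> (g' \<cdot> g) = (X \<lhd> g') \<cdot> (X \<lhd> g)"
  using tensor_comp[of "idt C X" X X "idt C X" X g Y Y' g' Y''] by (simp add: idt_hom comp_idt_left[OF idt_hom])

lemma tensor_comp_left:
  "\<lbrakk>g \<in> hom C Y Y'; g' \<in> hom C Y' Y''\<rbrakk>
    \<Longrightarrow> (g' \<cdot> g) \<rhd> X = (g' \<rhd> X) \<cdot> (g \<rhd> X)"
  using tensor_comp[of g Y Y' g' Y'' "idt C X" X X "idt C X" X] by (simp add: idt_hom comp_idt_left[OF idt_hom])

lemma interchange: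
  assumes "f \<in> hom C X X'" "h \<in> hom C Z Z'"
  shows "(f \<rhd> Z') \<cdot> (X \<lhd> h) = f \<otimes>\<^sub>a h"
    and "(X' \<lhd> h) \<cdot> (f \<rhd> Z) = f \<otimes>\<^sub>a h"
  using tensor_comp[of "idt C X" X X f X' h Z Z' "idt C Z'" Z']
    tensor_comp[of f X X' "idt C X'" X' "idt C Z" Z Z h Z'] assms
  by (simp_all add: idt_hom comp_idt_left comp_idt_right)

lemma can_natural:
  assumes "h \<in> hom C Z Z'"
  shows "can w Z' \<cdot> (wobj w \<lhd> h) = flat_arr w h \<cdot> can w Z"
  using assms
proof (induction w arbitrary: h Z Z')
  case (Obj X)
  then show ?case
    by (simp add: comp_idt_left[of _ "X \<odot> Z"] comp_idt_right[of _ "X \<odot> Z" "X \<odot> Z'"] comp_idt_left[of _ "X \<odot> Z"  "X \<odot> Z'"] tensor_hom idt_hom)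
next
  case Unit
  then show ?case by (simp add: lunit_natural)
next
  case (Tens v w)
  let ?V = "wobj v" and ?W = "wobj w"
  have t [intro]: "idt C X \<in> hom C X X" for X by (rule idt_hom)
  have h [intro]: "h \<in> hom C Z Z'" by fact
  note [intro] = tensor_hom can_hom assoc_hom flat_arr_hom comp_hom
  have "can (Tens v w) Z' \<cdot> (wobj (Tens v w) \<lhd> h) =
    can v (flat w Z') \<bullet> (?V \<lhd> can w Z') \<bullet> assoc C ?V ?W Z' \<bullet> ((idt C ?V \<rhd> ?W) \<otimes>\<^sub>a h)"
    apply (simp add: tensor_idt)
    apply (subst comp_assoc, (rule t h tensor_hom can_hom assoc_hom comp_hom)+)
    apply (subst comp_assoc, (rule t h tensor_hom can_hom assoc_hom comp_hom)+)
    apply simp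
    done
  also have "assoc C ?V ?W Z' \<bullet> ((idt C ?V \<rhd> ?W) \<otimes>\<^sub>a h) = (?V \<lhd> (?W \<lhd> h)) \<bullet> assoc C ?V ?W Z"
    by (rule assoc_natural) (rule t h)+
  also have "(?V \<lhd> can w Z') \<bullet> \<dots> = (?V \<lhd> flat_arr w h) \<bullet> (?V \<lhd> can w Z) \<bullet> assoc C ?V ?W Z"
    by (rule comp_cong_right, subst (1 2) tensor_comp_right[symmetric],
       (rule h t can_hom tensor_hom flat_arr_hom)+, simp add: Tens.IH(2)[OF h],
       (rule h t can_hom tensor_hom flat_arr_hom assoc_hom)+)
  also have "can v (flat w Z') \<bullet> \<dots> = flat_arr v (flat_arr w h) \<bullet> can v (flat w Z) \<bullet> (?V \<lhd> can w Z) \<bullet> assoc C ?V ?W Z"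
    by (rule comp_cong_right[OF Tens.IH(1)[OF flat_arr_hom[OF h]]],
       (rule h t can_hom tensor_hom flat_arr_hom assoc_hom comp_hom)+)
  finally show ?case by simp
qed

lemma hat_hom:
  "f \<in> hom C (wobj v) (wobj w) \<Longrightarrow> hat v w f Z \<in> hom C (flat v Z) (flat w Z)"
  unfolding hat_def by (rule comp_hom can_hom can_inv_hom tensor_hom idt_hom | assumption)+

lemmas typing = comp_hom tensor_hom idt_hom can_hom can_inv_hom assoc_hom lunit_hom runit_hom
  flat_arr_hom hat_hom

lemma hat_can:
  assumes f: "f \<in> hom C (wobj v) (wobj w)"
  shows "hat v w f Z \<bullet> can v Z = can w Z \<bullet> (f \<rhd> Z)"
proof -
  have "hat v w f Z \<bullet> can v Z = can w Z \<bullet> ((f \<rhd> Z) \<bullet> can_inv v Z) \<bullet> can v Z"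
    unfolding hat_def by (rule comp_assoc) (rule typing f)+
  also have "((f \<rhd> Z) \<bullet> can_inv v Z) \<bullet> can v Z = (f \<rhd> Z) \<bullet> can_inv v Z \<bullet> can v Z"
    by (rule comp_assoc) (rule typing f)+
  also have "\<dots> = f \<rhd> Z"
    unfolding can_inv_can by (rule comp_idt_right) (rule typing f)+
  finally show ?thesis .
qed

text \<open>As \<open>can\<close> is invertible, \<open>hat\<close> is the only arrow intertwining
  the canonical isomorphisms. Computations of \<open>hat\<close> go through this characterisation
  and so avoid \<open>can_inv\<close>.\<close>

lemma hat_eqI:
  assumes f: "f \<in> hom C (wobj v) (wobj w)" and h: "h \<in> hom C (flat v Z) (flat w Z)"
    and eq: "h \<bullet> can v Z = can w Z \<bullet> (f \<rhd> Z)"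
  shows "hat v w f Z = h"
  by (rule iso_cancel_right[OF can_iso]) (rule hat_hom f h | simp add: hat_can[OF f] eq)+

lemma hat_comp:
  assumes f: "f \<in> hom C (wobj u) (wobj v)" and g: "g \<in> hom C (wobj v) (wobj w)"
  shows "hat u w (g \<bullet> f) Z = hat v w g Z \<bullet> hat u v f Z"
proof (rule hat_eqI)
  have "(hat v w g Z \<bullet> hat u v f Z) \<bullet> can u Z = hat v w g Z \<bullet> hat u v f Z \<bullet> can u Z"
    by (rule comp_assoc) (rule typing f g)+
  also have "\<dots> = hat v w g Z \<bullet> can v Z \<bullet> (f \<rhd> Z)" by (simp add: hat_can[OF f])
  also have "\<dots> = can w Z \<bullet> (g \<rhd> Z) \<bullet> (f \<rhd> Z)"
    by (rule comp_cong_right[OF hat_can[OF g]]) (rule typing f g)+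
  also have "\<dots> = can w Z \<bullet> ((g \<bullet> f) \<rhd> Z)"
    by (simp add: tensor_comp_left[OF f g])
  finally show "(hat v w g Z \<bullet> hat u v f Z) \<bullet> can u Z = can w Z \<bullet> ((g \<bullet> f) \<rhd> Z)" .
qed (rule typing f g)+

lemma hat_idt: "hat v v (idt C (wobj v)) Z = idt C (flat v Z)"
  by (rule hat_eqI) (rule typing | simp add: tensor_idt comp_idt_left[OF can_hom] comp_idt_right[OF can_hom])+

text \<open>The tail is a spectator: by the interchange law an arrow acting in the tail slides past
  \<open>f\<close>.\<close>

lemma hat_natural:
  assumes f: "f \<in> hom C (wobj v) (wobj w)" and h: "h \<in> hom C Z Z'"
  shows "hat v w f Z' \<bullet> flat_arr v h = flat_arr w h \<bullet> hat v w f Z"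
proof (rule iso_cancel_right[OF can_iso])
  let ?v = "wobj v" and ?w = "wobj w"
  have "(hat v w f Z' \<bullet> flat_arr v h) \<bullet> can v Z = hat v w f Z' \<bullet> flat_arr v h \<bullet> can v Z"
    by (rule comp_assoc) (rule typing f h)+
  also have "\<dots> = hat v w f Z' \<bullet> can v Z' \<bullet> (?v \<lhd> h)"
    by (simp add: can_natural[OF h])
  also have "\<dots> = can w Z' \<bullet> (f \<rhd> Z') \<bullet> (?v \<lhd> h)"
    by (rule comp_cong_right[OF hat_can[OF f]]) (rule typing f h)+
  also have "\<dots> = can w Z' \<bullet> (?w \<lhd> h) \<bullet> (f \<rhd> Z)"
    by (simp add: interchange[OF f h])
  also have "\<dots> = flat_arr w h \<bullet> can w Z \<bullet> (f \<rhd> Z)"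
    by (rule comp_cong_right[OF can_natural[OF h]]) (rule typing f h)+
  also have "\<dots> = flat_arr w h \<bullet> hat v w f Z \<bullet> can v Z" by (simp add: hat_can[OF f])
  also have "\<dots> = (flat_arr w h \<bullet> hat v w f Z) \<bullet> can v Z"
    by (rule comp_assoc[symmetric]) (rule typing f h)+
  finally show "(hat v w f Z' \<bullet> flat_arr v h) \<bullet> can v Z = (flat_arr w h \<bullet> hat v w f Z) \<bullet> can v Z" .
qed (rule typing f h)+

text \<open>A tensor product of arrows becomes a composition: \<open>g\<close> acts first, in the
  tail behind the word \<open>v\<close>, and then \<open>f\<close> acts in front of it.\<close>

lemma hat_tensor:
  assumes f: "f \<in> hom C (wobj v) (wobj w)" and g: "g \<in> hom C (wobj v') (wobj w')"
  shows "hat (Tens v v') (Tens w w') (f \<otimes>\<^sub>a g) Z = hat v w f (flat w' Z) \<bullet> flat_arr v (hat v' w' g Z)"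
proof (rule hat_eqI)
  let ?v = "wobj v" and ?w = "wobj w" and ?v' = "wobj v'" and ?w' = "wobj w'"
  let ?F = "hat v w f (flat w' Z)" and ?G = "hat v' w' g Z"
  have G: "?G \<in> hom C (flat v' Z) (flat w' Z)" by (rule hat_hom[OF g])
  have "(?F \<bullet> flat_arr v ?G) \<bullet> can (Tens v v') Z =
     ?F \<bullet> flat_arr v ?G \<bullet> can v (flat v' Z) \<bullet> (?v \<lhd> can v' Z) \<bullet> assoc C ?v ?v' Z"
    unfolding can.simps by (rule comp_assoc) (rule typing f g)+
  also have "flat_arr v ?G \<bullet> can v (flat v' Z) \<bullet> (?v \<lhd> can v' Z) \<bullet> assoc C ?v ?v' Z =
    can v (flat w' Z) \<bullet> (?v \<lhd> ?G) \<bullet> (?v \<lhd> can v' Z) \<bullet> assoc C ?v ?v' Z"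
    by (rule comp_cong_right[OF can_natural[OF G, symmetric]]) (rule typing f g)+
  also have "(?v \<lhd> ?G) \<bullet> (?v \<lhd> can v' Z) \<bullet> assoc C ?v ?v' Z =
     (?v \<lhd> can w' Z) \<bullet> (?v \<lhd> (g \<rhd> Z)) \<bullet> assoc C ?v ?v' Z"
    by (rule comp_cong_right, subst (1 2) tensor_comp_right[symmetric])
       (rule typing g | simp add: hat_can[OF g])+
  also have "?F \<bullet> can v (flat w' Z) \<bullet> \<dots> =
     can w (flat w' Z) \<bullet> (f \<rhd> (flat w' Z)) \<bullet>
       (?v \<lhd> can w' Z) \<bullet> (?v \<lhd> (g \<rhd> Z)) \<bullet> assoc C ?v ?v' Z"
    by (rule comp_cong_right[OF hat_can[OF f]]) (rule typing f g)+
  also have "(f \<rhd> (flat w' Z)) \<bullet>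
       (?v \<lhd> can w' Z) \<bullet> (?v \<lhd> (g \<rhd> Z)) \<bullet> assoc C ?v ?v' Z =
      (?w \<lhd> can w' Z) \<bullet> (f \<rhd> (?w' \<odot> Z)) \<bullet> (?v \<lhd> (g \<rhd> Z)) \<bullet> assoc C ?v ?v' Z"
    by (rule comp_cong_right) (rule typing f g | simp add: interchange[OF f can_hom])+
  also have "(f \<rhd> (?w' \<odot> Z)) \<bullet> (?v \<lhd> (g \<rhd> Z)) \<bullet> assoc C ?v ?v' Z =
      (f \<otimes>\<^sub>a (g \<rhd> Z)) \<bullet> assoc C ?v ?v' Z"
    by (rule comp_collapse_right, rule interchange) (rule typing f g)+
  also have "\<dots> = assoc C ?w ?w' Z \<bullet> ((f \<otimes>\<^sub>a g) \<rhd> Z)"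
    by (rule assoc_natural[symmetric]) (rule typing f g)+
  also have "(?w \<lhd> can w' Z) \<bullet> \<dots> =
      ((?w \<lhd> can w' Z) \<bullet> assoc C ?w ?w' Z) \<bullet> ((f \<otimes>\<^sub>a g) \<rhd> Z)"
    by (rule comp_assoc[symmetric]) (rule typing f g)+
  also have "can w (flat w' Z) \<bullet> \<dots> = can (Tens w w') Z \<bullet> ((f \<otimes>\<^sub>a g) \<rhd> Z)"
    unfolding can.simps by (rule comp_assoc[symmetric]) (rule typing f g)+
  finally show "(?F \<bullet> flat_arr v ?G) \<bullet> can (Tens v v') Z = can (Tens w w') Z \<bullet> ((f \<otimes>\<^sub>a g) \<rhd> Z)" .
qed (simp, (rule typing f g)+)+

lemma hat_Obj:
  assumes f: "f \<in> hom C X Y" shows "hat (Obj X) (Obj Y) f Z = f \<rhd> Z"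
  by (rule hat_eqI) (use tensor_hom[OF f idt_hom[of Z]] f in \<open>simp_all add: comp_idt_left comp_idt_right\<close>)

lemma hat_inverse:
  assumes "is_inverse C (wobj v) (wobj w) f g"
  shows "is_inverse C (flat v Z) (flat w Z) (hat v w f Z) (hat w v g Z)"
proof -
  have t: "f \<in> hom C (wobj v) (wobj w)" "g \<in> hom C (wobj w) (wobj v)"
    and e: "g \<cdot> f = idt C (wobj v)" "f \<cdot> g = idt C (wobj w)"
    using assms by (auto simp: is_inverse_def)
  show ?thesis
    unfolding is_inverse_def hat_comp[OF t, symmetric] hat_comp[OF t(2,1), symmetric] e hat_idt
    using t hat_hom by simp
qed

lemma hat_cancel:
  assumes f: "f \<in> hom C (wobj v) (wobj w)" and g: "g \<in> hom C (wobj v) (wobj w)"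
    and eq: "hat v w f \<I> = hat v w g \<I>"
  shows "f = g"
proof (rule iso_cancel_right[OF runit_iso f g])
  have "can w \<I> \<bullet> (f \<rhd> \<I>) = can w \<I> \<bullet> (g \<rhd> \<I>)"
    using hat_can[OF f, of \<I>] hat_can[OF g, of \<I>] eq by simp
  then have "f \<rhd> \<I> = g \<rhd> \<I>"
    by (rule iso_cancel_left[OF can_iso, rotated 2]) (rule typing f g)+
  then show "f \<bullet> runit C (wobj v) = g \<bullet> runit C (wobj v)"
    using runit_natural[OF f] runit_natural[OF g] by simp
qed

text \<open>Kelly's coherence law, a consequence of the pentagon and the triangle. After tensoring
  with the unit on the left, both sides agree by the pentagon for two unit objects, once the
  invertible \<open>?p\<close> is cancelled; naturality of \<open>lunit\<close>, itself invertible,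
  then strips the additional unit.\<close>

lemma kelly_lunit:
  "lunit C (X \<odot> Y) \<bullet> assoc C \<I> X Y = lunit C X \<rhd> Y"
proof -
  let ?a = "assoc C" and ?l = "lunit C" and ?i = "idt C"
  let ?p = "?a \<I> (\<I> \<odot> X) Y \<bullet> (?a \<I> \<I> X \<rhd> Y)"
  have p: "is_iso C (((\<I> \<odot> \<I>) \<odot> X) \<odot> Y) (\<I> \<odot> ((\<I> \<odot> X) \<odot> Y)) ?p"
    by (rule is_iso_comp is_iso_tensor assoc_iso is_iso_idt)+
  have pent: "?a \<I> \<I> (X \<odot> Y) \<bullet> ?a (\<I> \<odot> \<I>) X Y = (\<I> \<lhd> ?a \<I> X Y) \<bullet> ?p"
    unfolding pentagon by (rule comp_assoc) (rule typing)+
  have "(\<I> \<lhd> (?l (X \<odot> Y) \<bullet> ?a \<I> X Y)) \<bullet> ?p =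
      (\<I> \<lhd> ?l (X \<odot> Y)) \<bullet> (\<I> \<lhd> ?a \<I> X Y) \<bullet> ?p"
    by (rule comp_collapse_right[symmetric], rule tensor_comp_right[symmetric]) (rule typing)+
  also have "\<dots> = (\<I> \<lhd> ?l (X \<odot> Y)) \<bullet> ?a \<I> \<I> (X \<odot> Y) \<bullet> ?a (\<I> \<odot> \<I>) X Y"
    by (simp add: pent)
  also have "\<dots> = (runit C \<I> \<rhd> (X \<odot> Y)) \<bullet> ?a (\<I> \<odot> \<I>) X Y"
    by (rule comp_collapse_right[OF triangle]) (rule typing)+
  also have "\<dots> = ?a \<I> X Y \<bullet> ((runit C \<I> \<rhd> X) \<rhd> Y)"
    unfolding tensor_idt[symmetric] by (rule assoc_natural[symmetric]) (rule typing)+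
  also have "(runit C \<I> \<rhd> X) \<rhd> Y = ((\<I> \<lhd> ?l X) \<rhd> Y) \<bullet> (?a \<I> \<I> X \<rhd> Y)"
    unfolding triangle[symmetric] by (rule tensor_comp_left) (rule typing)+
  also have "?a \<I> X Y \<bullet> \<dots> = (\<I> \<lhd> (?l X \<rhd> Y)) \<bullet> ?p"
    by (rule comp_cong_right[OF assoc_natural]) (rule typing)+
  finally have "\<I> \<lhd> (?l (X \<odot> Y) \<bullet> ?a \<I> X Y) = \<I> \<lhd> (?l X \<rhd> Y)"
    by (rule iso_cancel_right[OF p, rotated 2]) (rule typing)+
  moreover have "?l (X \<odot> Y) \<bullet> (\<I> \<lhd> (?l (X \<odot> Y) \<bullet> ?a \<I> X Y))
      = (?l (X \<odot> Y) \<bullet> ?a \<I> X Y) \<bullet> ?l ((\<I> \<odot> X) \<odot> Y)"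
    by (rule lunit_natural) (rule typing)+
  moreover have "?l (X \<odot> Y) \<bullet> (\<I> \<lhd> (?l X \<rhd> Y)) = (?l X \<rhd> Y) \<bullet> ?l ((\<I> \<odot> X) \<odot> Y)"
    by (rule lunit_natural) (rule typing)+
  ultimately have "(?l (X \<odot> Y) \<bullet> ?a \<I> X Y) \<bullet> ?l ((\<I> \<odot> X) \<odot> Y)
      = (?l X \<rhd> Y) \<bullet> ?l ((\<I> \<odot> X) \<odot> Y)" by metis
  then show ?thesis by (rule iso_cancel_right[OF lunit_iso, rotated 2]) (rule typing)+
qed

lemma hat_lunit: "hat (Tens Unit w) w (lunit C (wobj w)) Z = idt C (flat w Z)"
proof (rule hat_eqI)
  let ?w = "wobj w"
  have "can (Tens Unit w) Z = can w Z \<bullet> lunit C (?w \<odot> Z) \<bullet> assoc C \<I> ?w Z"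
    unfolding can.simps wobj.simps by (rule comp_cong_right[OF lunit_natural]) (rule typing)+
  also have "\<dots> = can w Z \<bullet> (lunit C ?w \<rhd> Z)" by (simp add: kelly_lunit)
  finally have e: "can (Tens Unit w) Z = can w Z \<bullet> (lunit C ?w \<rhd> Z)" .
  show "idt C (flat w Z) \<bullet> can (Tens Unit w) Z = can w Z \<bullet> (lunit C ?w \<rhd> Z)"
    unfolding e by (rule comp_idt_left) (rule typing)+
qed (simp, (rule typing)+)+

lemma hat_runit: "hat (Tens w Unit) w (runit C (wobj w)) Z = idt C (flat w Z)"
proof (rule hat_eqI)
  let ?w = "wobj w"
  have e: "can (Tens w Unit) Z = can w Z \<bullet> (runit C ?w \<rhd> Z)" by (simp add: triangle)
  show "idt C (flat w Z) \<bullet> can (Tens w Unit) Z = can w Z \<bullet> (runit C ?w \<rhd> Z)"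
    unfolding e by (rule comp_idt_left) (rule typing)+
qed (simp, (rule typing)+)+

text \<open>This is the pentagon: the recursion of \<open>can\<close> reassociates once for each
  \<open>Tens\<close>, and the two bracketings of \<open>u\<close>, \<open>v\<close>,
  \<open>w\<close> in front of \<open>Z\<close> traverse its two sides.\<close>

lemma hat_assoc:
  "hat (Tens (Tens u v) w) (Tens u (Tens v w)) (assoc C (wobj u) (wobj v) (wobj w)) Z =
    idt C (flat u (flat v (flat w Z)))"
proof (rule hat_eqI)
  let ?u = "wobj u" and ?v = "wobj v" and ?w = "wobj w" and ?a = "assoc C" and ?i = "idt C"
  let ?cu = "can u (flat v (flat w Z))" and ?cv = "?u \<lhd> can v (flat w Z)"
  let ?cw = "?u \<lhd> (?v \<lhd> can w Z)"
  have "can (Tens (Tens u v) w) Z =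
      (?cu \<bullet> ?cv \<bullet> ?a ?u ?v (flat w Z)) \<bullet> ((?u \<odot> ?v) \<lhd> can w Z) \<bullet> ?a (?u \<odot> ?v) ?w Z"
    by simp
  also have "\<dots> = ?cu \<bullet> (?cv \<bullet> ?a ?u ?v (flat w Z)) \<bullet> ((?u \<odot> ?v) \<lhd> can w Z) \<bullet> ?a (?u \<odot> ?v) ?w Z"
    by (rule comp_assoc) (rule typing)+
  also have "(?cv \<bullet> ?a ?u ?v (flat w Z)) \<bullet> ((?u \<odot> ?v) \<lhd> can w Z) \<bullet> ?a (?u \<odot> ?v) ?w Z
      = ?cv \<bullet> ?a ?u ?v (flat w Z) \<bullet> ((?u \<odot> ?v) \<lhd> can w Z) \<bullet> ?a (?u \<odot> ?v) ?w Z"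
    by (rule comp_assoc) (rule typing)+
  also have "?a ?u ?v (flat w Z) \<bullet> ((?u \<odot> ?v) \<lhd> can w Z) \<bullet> ?a (?u \<odot> ?v) ?w Z
      = ?cw \<bullet> ?a ?u ?v (?w \<odot> Z) \<bullet> ?a (?u \<odot> ?v) ?w Z"
    unfolding tensor_idt[symmetric] by (rule comp_cong_right[OF assoc_natural]) (rule typing)+
  also have "?a ?u ?v (?w \<odot> Z) \<bullet> ?a (?u \<odot> ?v) ?w Z =
      (?u \<lhd> ?a ?v ?w Z) \<bullet> ?a ?u (?v \<odot> ?w) Z \<bullet> (?a ?u ?v ?w \<rhd> Z)"
    unfolding pentagon by (rule comp_assoc) (rule typing)+
  finally have l: "can (Tens (Tens u v) w) Z =
     ?cu \<bullet> ?cv \<bullet> ?cw \<bullet> (?u \<lhd> ?a ?v ?w Z) \<bullet> ?a ?u (?v \<odot> ?w) Z \<bullet> (?a ?u ?v ?w \<rhd> Z)" .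
  let ?t = "?a ?u (?v \<odot> ?w) Z \<bullet> (?a ?u ?v ?w \<rhd> Z)"
  define k where "k = can (Tens v w) Z"
  have k: "k \<in> hom C ((?v \<odot> ?w) \<odot> Z) (flat v (flat w Z))"
    unfolding k_def using can_hom[of "Tens v w" Z] by simp
  have "can (Tens u (Tens v w)) Z \<bullet> (?a ?u ?v ?w \<rhd> Z) =
     (?cu \<bullet> (?u \<lhd> k) \<bullet> ?a ?u (?v \<odot> ?w) Z) \<bullet> (?a ?u ?v ?w \<rhd> Z)"
    by (simp add: k_def)
  also have "\<dots> = ?cu \<bullet> ((?u \<lhd> k) \<bullet> ?a ?u (?v \<odot> ?w) Z) \<bullet> (?a ?u ?v ?w \<rhd> Z)"
    by (rule comp_assoc) (rule typing k)+
  also have "((?u \<lhd> k) \<bullet> ?a ?u (?v \<odot> ?w) Z) \<bullet> (?a ?u ?v ?w \<rhd> Z) =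
     (?u \<lhd> k) \<bullet> ?t"
    by (rule comp_assoc) (rule typing k)+
  also have "?u \<lhd> k = ?cv \<bullet> (?u \<lhd> ((?v \<lhd> can w Z) \<bullet> ?a ?v ?w Z))"
    unfolding k_def can.simps by (rule tensor_comp_right) (rule typing)+
  also have "?u \<lhd> ((?v \<lhd> can w Z) \<bullet> ?a ?v ?w Z) = ?cw \<bullet> (?u \<lhd> ?a ?v ?w Z)"
    by (rule tensor_comp_right) (rule typing)+
  also have "(?cv \<bullet> ?cw \<bullet> (?u \<lhd> ?a ?v ?w Z)) \<bullet> ?t = ?cv \<bullet> (?cw \<bullet> (?u \<lhd> ?a ?v ?w Z)) \<bullet> ?t"
    by (rule comp_assoc) (rule typing)+
  also have "(?cw \<bullet> (?u \<lhd> ?a ?v ?w Z)) \<bullet> ?t = ?cw \<bullet> (?u \<lhd> ?a ?v ?w Z) \<bullet> ?t"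
    by (rule comp_assoc) (rule typing)+
  finally have "can (Tens (Tens u v) w) Z = can (Tens u (Tens v w)) Z \<bullet> (?a ?u ?v ?w \<rhd> Z)"
    using l by simp
  then show "?i (flat u (flat v (flat w Z))) \<bullet> can (Tens (Tens u v) w) Z =
     can (Tens u (Tens v w)) Z \<bullet> (?a ?u ?v ?w \<rhd> Z)"
    using comp_idt_left[OF can_hom[of "Tens (Tens u v) w" Z]] by simp
qed (simp, (rule typing)+)+

lemma hat_inv_idt:
  assumes "is_iso C (wobj v) (wobj w) f" "flat v Z = flat w Z" "hat v w f Z = idt C (flat v Z)"
  shows "hat w v (inv_arrow C (wobj v) (wobj w) f) Z = idt C (flat v Z)"
  using hat_inverse[OF inv_arrow_is_inverse[OF assms(1)], of Z] assms(2,3)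
    comp_idt_right[of "hat w v (inv_arrow C (wobj v) (wobj w) f) Z" "flat w Z" "flat w Z"]
  by (simp add: is_inverse_def)

lemma hat_assoc_inv:
  "hat (Tens u (Tens v w)) (Tens (Tens u v) w) (assoc_inv C (wobj u) (wobj v) (wobj w)) Z =
    idt C (flat u (flat v (flat w Z)))"
  using hat_inv_idt[of "Tens (Tens u v) w" "Tens u (Tens v w)"] assoc_iso hat_assoc
  by (simp add: assoc_inv_def)

lemma hat_lunit_inv: "hat w (Tens Unit w) (lunit_inv C (wobj w)) Z = idt C (flat w Z)"
  using hat_inv_idt[of "Tens Unit w" w] lunit_iso hat_lunit by (simp add: lunit_inv_def)

lemma hat_runit_inv: "hat w (Tens w Unit) (runit_inv C (wobj w)) Z = idt C (flat w Z)"
  using hat_inv_idt[of "Tens w Unit" w] runit_iso hat_runit by (simp add: runit_inv_def)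

lemma assoc_inv_hom: "assoc_inv C X Y Z \<in> hom C (X \<odot> Y \<odot> Z) ((X \<odot> Y) \<odot> Z)"
  and lunit_inv_hom: "lunit_inv C X \<in> hom C X (\<I> \<odot> X)"
  and runit_inv_hom: "runit_inv C X \<in> hom C X (X \<odot> \<I>)"
  using inv_arrow_is_inverse[OF assoc_iso] inv_arrow_is_inverse[OF lunit_iso]
    inv_arrow_is_inverse[OF runit_iso]
  by (simp_all add: assoc_inv_def lunit_inv_def runit_inv_def is_inverse_def)

lemma hat_scale:
  assumes f: "f \<in> hom C (wobj v) (wobj w)"
  shows "hat v w (a *\<^sub>s f) Z = a *\<^sub>s hat v w f Z"
  unfolding hat_def
  by (simp add: tensor_scale_left[OF f idt_hom] comp_scale_left[OF tensor_hom[OF f idt_hom] can_inv_hom]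
    comp_scale_right[OF can_hom comp_hom[OF tensor_hom[OF f idt_hom] can_inv_hom]])

lemma hat_whisker_left:
  assumes f: "f \<in> hom C (wobj v) (wobj w)"
  shows "hat (Tens u v) (Tens u w) ((wobj u) \<lhd> f) Z = flat_arr u (hat v w f Z)"
  unfolding hat_tensor[OF idt_hom f] hat_idt
  by (rule comp_idt_left[OF flat_arr_hom[OF hat_hom[OF f]]])

lemma hat_whisker_right:
  assumes f: "f \<in> hom C (wobj v) (wobj w)"
  shows "hat (Tens v u) (Tens w u) (f \<rhd> (wobj u)) Z = hat v w f (flat u Z)"
  unfolding hat_tensor[OF f idt_hom] hat_idt flat_arr_idt
  by (rule comp_idt_right[OF hat_hom[OF f]])

text \<open>The composite has the shape shared by the nondegeneracy condition, the Drinfeld morphism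
  and the comparison of two duals of \<open>A\<close>. Under \<open>hat\<close> it reduces to
  creating two strands with \<open>k\<close> behind \<open>X\<close> and closing the first two
  strands with \<open>e\<close>.\<close>

lemma hat_snake_left:
  assumes e: "e \<in> hom C (X \<odot> Y) \<I>" and k: "k \<in> hom C \<I> (Y \<odot> V)"
  shows "hat (Obj X) (Obj V)
      (lunit C V \<cdot> (e \<rhd> V) \<cdot> assoc_inv C X Y V \<cdot> (X \<lhd> k) \<cdot> runit_inv C X) Z =
    hat (Tens (Obj X) (Obj Y)) Unit e (V \<odot> Z) \<bullet>
      (X \<lhd> hat Unit (Tens (Obj Y) (Obj V)) k Z)" (is "?l = ?r")
proof -
  let ?x = "Obj X" and ?y = "Obj Y" and ?v = "Obj V"
  let ?e = "hat (Tens ?x ?y) Unit e (V \<odot> Z)" and ?k = "hat Unit (Tens ?y ?v) k Z"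
  note ty = comp_hom tensor_hom idt_hom e k lunit_hom assoc_inv_hom runit_inv_hom
  have he: "hat (Tens (Tens ?x ?y) ?v) (Tens Unit ?v) (e \<rhd> V) Z = ?e"
    using hat_whisker_right[of e "Tens ?x ?y" Unit ?v Z] e by simp
  have hk: "hat (Tens ?x Unit) (Tens ?x (Tens ?y ?v)) (X \<lhd> k) Z = X \<lhd> ?k"
    using hat_whisker_left[of k Unit "Tens ?y ?v" ?x Z] k by simp
  have et: "?e \<in> hom C (X \<odot> Y \<odot> V \<odot> Z) (V \<odot> Z)"
    using hat_hom[of e "Tens ?x ?y" Unit "V \<odot> Z"] e by simp
  have kt: "X \<lhd> ?k \<in> hom C (X \<odot> Z) (X \<odot> Y \<odot> V \<odot> Z)"
    using tensor_hom[OF idt_hom hat_hom[of k Unit "Tens ?y ?v" Z]] k by simp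
  have "?l = (((hat (Tens Unit ?v) ?v (lunit C V) Z \<cdot> hat (Tens (Tens ?x ?y) ?v) (Tens Unit ?v) (e \<rhd> V) Z) \<cdot>
      hat (Tens ?x (Tens ?y ?v)) (Tens (Tens ?x ?y) ?v) (assoc_inv C X Y V) Z) \<cdot>
      hat (Tens ?x Unit) (Tens ?x (Tens ?y ?v)) (X \<lhd> k) Z) \<cdot>
      hat ?x (Tens ?x Unit) (runit_inv C X) Z"
    \<comment> \<open>The intermediate words are given explicitly, since an object does not
      determine a word that denotes it.\<close>
    apply (subst hat_comp[of _ _ "Tens ?x Unit"], (simp only: wobj.simps, (rule ty)+)+)
    apply (subst hat_comp[of _ _ "Tens ?x (Tens ?y ?v)"], (simp only: wobj.simps, (rule ty)+)+)
    apply (subst hat_comp[of _ _ "Tens (Tens ?x ?y) ?v"], (simp only: wobj.simps, (rule ty)+)+)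
    apply (subst hat_comp[of _ _ "Tens Unit ?v"], (simp only: wobj.simps, (rule ty)+)+)
    apply (rule refl)
    done
  also have "\<dots> = ?r"
    unfolding he hk
    using hat_lunit[of ?v Z] hat_assoc_inv[of ?x ?y ?v Z] hat_runit_inv[of ?x Z]
    by (simp add: comp_idt_left[OF et] comp_idt_right[OF et] comp_idt_right[OF comp_hom[OF et kt]])
  finally show ?thesis .
qed

text \<open>The mirror image, with the shape of the axiom \<open>zigzag_obj\<close>.\<close>

lemma hat_snake_right:
  assumes e: "e \<in> hom C (Y \<odot> V) \<I>" and k: "k \<in> hom C \<I> (X \<odot> Y)"
  shows "hat (Obj V) (Obj X)
      (runit C X \<cdot> (X \<lhd> e) \<cdot> assoc C X Y V \<cdot> (k \<rhd> V) \<cdot> lunit_inv C V) Z =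
    (X \<lhd> hat (Tens (Obj Y) (Obj V)) Unit e Z) \<bullet>
      hat Unit (Tens (Obj X) (Obj Y)) k (V \<odot> Z)" (is "?l = ?r")
proof -
  let ?x = "Obj X" and ?y = "Obj Y" and ?v = "Obj V"
  let ?e = "hat (Tens ?y ?v) Unit e Z" and ?k = "hat Unit (Tens ?x ?y) k (V \<odot> Z)"
  note ty = comp_hom tensor_hom idt_hom e k runit_hom assoc_hom lunit_inv_hom
  have he: "hat (Tens ?x (Tens ?y ?v)) (Tens ?x Unit) (X \<lhd> e) Z = X \<lhd> ?e"
    using hat_whisker_left[of e "Tens ?y ?v" Unit ?x Z] e by simp
  have hk: "hat (Tens Unit ?v) (Tens (Tens ?x ?y) ?v) (k \<rhd> V) Z = ?k"
    using hat_whisker_right[of k Unit "Tens ?x ?y" ?v Z] k by simp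
  have et: "X \<lhd> ?e \<in> hom C (X \<odot> Y \<odot> V \<odot> Z) (X \<odot> Z)"
    using tensor_hom[OF idt_hom hat_hom[of e "Tens ?y ?v" Unit Z]] e by simp
  have kt: "?k \<in> hom C (V \<odot> Z) (X \<odot> Y \<odot> V \<odot> Z)"
    using hat_hom[of k Unit "Tens ?x ?y" "V \<odot> Z"] k by simp
  have "?l = (((hat (Tens ?x Unit) ?x (runit C X) Z \<cdot> hat (Tens ?x (Tens ?y ?v)) (Tens ?x Unit) (X \<lhd> e) Z) \<cdot>
      hat (Tens (Tens ?x ?y) ?v) (Tens ?x (Tens ?y ?v)) (assoc C X Y V) Z) \<cdot>
      hat (Tens Unit ?v) (Tens (Tens ?x ?y) ?v) (k \<rhd> V) Z) \<cdot>
      hat ?v (Tens Unit ?v) (lunit_inv C V) Z"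
    apply (subst hat_comp[of _ _ "Tens Unit ?v"], (simp only: wobj.simps, (rule ty)+)+)
    apply (subst hat_comp[of _ _ "Tens (Tens ?x ?y) ?v"], (simp only: wobj.simps, (rule ty)+)+)
    apply (subst hat_comp[of _ _ "Tens ?x (Tens ?y ?v)"], (simp only: wobj.simps, (rule ty)+)+)
    apply (subst hat_comp[of _ _ "Tens ?x Unit"], (simp only: wobj.simps, (rule ty)+)+)
    apply (rule refl)
    done
  also have "\<dots> = ?r"
    unfolding he hk
    using hat_runit[of ?x Z] hat_assoc[of ?x ?y ?v Z] hat_lunit_inv[of ?v Z]
    by (simp add: comp_idt_left[OF et] comp_idt_right[OF et] comp_idt_right[OF comp_hom[OF et kt]])
  finally show ?thesis .
qed

lemma hat_add:
  assumes f: "f \<in> hom C (wobj v) (wobj w)" and g: "g \<in> hom C (wobj v) (wobj w)"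
  shows "hat v w (f + g) Z = hat v w f Z + hat v w g Z"
proof -
  note tf = tensor_hom[OF f idt_hom[of Z]] and tg = tensor_hom[OF g idt_hom[of Z]]
  show ?thesis
    unfolding hat_def tensor_add_left[OF f g idt_hom] comp_add_left[OF tf tg can_inv_hom]
    by (rule comp_add_right[OF can_hom comp_hom[OF tf can_inv_hom] comp_hom[OF tg can_inv_hom]])
qed

lemma tensor_id_cancel:
  assumes "f \<in> hom C X Y" "g \<in> hom C X Y" "f \<rhd> \<I> = g \<rhd> \<I>"
  shows "f = g"
  using hat_cancel[of f "Obj X" "Obj Y" g] assms by (simp add: hat_Obj)

section \<open>Pairings and copairings applied in front of a tail\<close>

definition pair :: "'o \<Rightarrow> 'o \<Rightarrow> 'm \<Rightarrow> 'o \<Rightarrow> 'm" where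
  "pair X Y e Z = hat (Tens (Obj X) (Obj Y)) Unit e Z"

definition copair :: "'o \<Rightarrow> 'o \<Rightarrow> 'm \<Rightarrow> 'o \<Rightarrow> 'm" where
  "copair X Y k Z = hat Unit (Tens (Obj X) (Obj Y)) k Z"

lemma pair_hom: "e \<in> hom C (X \<odot> Y) \<I> \<Longrightarrow> pair X Y e Z \<in> hom C (X \<odot> Y \<odot> Z) Z"
  unfolding pair_def using hat_hom[of e "Tens (Obj X) (Obj Y)" Unit Z] by simp

lemma copair_hom: "k \<in> hom C \<I> (X \<odot> Y) \<Longrightarrow> copair X Y k Z \<in> hom C Z (X \<odot> Y \<odot> Z)"
  unfolding copair_def using hat_hom[of k Unit "Tens (Obj X) (Obj Y)" Z] by simp

lemma pair_natural:
  "\<lbrakk>e \<in> hom C (X \<odot> Y) \<I>; h \<in> hom C Z Z'\<rbrakk>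
    \<Longrightarrow> pair X Y e Z' \<bullet> (X \<lhd> Y \<lhd> h) = h \<bullet> pair X Y e Z"
  unfolding pair_def using hat_natural[of e "Tens (Obj X) (Obj Y)" Unit h Z Z'] by simp

lemma copair_natural:
  "\<lbrakk>k \<in> hom C \<I> (X \<odot> Y); h \<in> hom C Z Z'\<rbrakk>
    \<Longrightarrow> copair X Y k Z' \<bullet> h = (X \<lhd> Y \<lhd> h) \<bullet> copair X Y k Z"
  unfolding copair_def using hat_natural[of k Unit "Tens (Obj X) (Obj Y)" h Z Z'] by simp

lemma whisker_cong:
  assumes "g \<bullet> f = k \<bullet> l" "g \<in> hom C Y Z" "f \<in> hom C X Y" "k \<in> hom C Y' Z" "l \<in> hom C X Y'"
  shows "(V \<lhd> g) \<bullet> (V \<lhd> f) = (V \<lhd> k) \<bullet> (V \<lhd> l)"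
  using assms tensor_comp_right[of f X Y g Z V] tensor_comp_right[of l X Y' k Z V] by simp

lemma whisker_collapse:
  assumes "g \<bullet> f = k" "g \<in> hom C Y Z" "f \<in> hom C X Y"
  shows "(V \<lhd> g) \<bullet> (V \<lhd> f) = V \<lhd> k"
  using assms tensor_comp_right[of f X Y g Z V] by simp

lemma whisker_cancel:
  assumes "g \<bullet> f = idt C X" "g \<in> hom C Y X" "f \<in> hom C X Y"
  shows "(V \<lhd> g) \<bullet> (V \<lhd> f) = idt C (V \<odot> X)"
  using whisker_collapse[OF assms] by (simp add: tensor_idt)

end

section \<open>Braidings and duals\<close>

context braided_tensor_category begin

lemmas braid_hom = is_iso_hom[OF braid_iso]

definition hat_braid :: "'o word \<Rightarrow> 'o word \<Rightarrow> 'o \<Rightarrow> 'm" where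
  "hat_braid v w Z = hat (Tens v w) (Tens w v) (braid C (wobj v) (wobj w)) Z"

lemma hat_braid_hom: "hat_braid v w Z \<in> hom C (flat v (flat w Z)) (flat w (flat v Z))"
  unfolding hat_braid_def using hat_hom[of _ "Tens v w" "Tens w v" Z] braid_hom by simp

lemma hat_braid_natural:
  assumes f: "f \<in> hom C (wobj v) (wobj v')" and g: "g \<in> hom C (wobj w) (wobj w')"
  shows "hat_braid v' w' Z \<bullet> hat v v' f (flat w' Z) \<bullet> flat_arr v (hat w w' g Z) =
    hat w w' g (flat v' Z) \<bullet> flat_arr w (hat v v' f Z) \<bullet> hat_braid v w Z"
proof -
  have b: "braid C (wobj v) (wobj w) \<in> hom C (wobj (Tens v w)) (wobj (Tens w v))" for v w
    using braid_hom by simp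
  have fg: "f \<otimes>\<^sub>a g \<in> hom C (wobj (Tens v w)) (wobj (Tens v' w'))"
    and gf: "g \<otimes>\<^sub>a f \<in> hom C (wobj (Tens w v)) (wobj (Tens w' v'))"
    using tensor_hom[OF f g] tensor_hom[OF g f] by simp_all
  have "hat (Tens v w) (Tens w' v') (braid C (wobj v') (wobj w') \<bullet> (f \<otimes>\<^sub>a g)) Z =
    hat (Tens v w) (Tens w' v') ((g \<otimes>\<^sub>a f) \<bullet> braid C (wobj v) (wobj w)) Z"
    by (simp add: braid_natural[OF f g])
  then have "hat_braid v' w' Z \<bullet> hat v v' f (flat w' Z) \<bullet> flat_arr v (hat w w' g Z) =
     (hat w w' g (flat v' Z) \<bullet> flat_arr w (hat v v' f Z)) \<bullet> hat_braid v w Z"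
    unfolding hat_comp[OF fg b] hat_comp[OF b gf] hat_tensor[OF f g] hat_tensor[OF g f] hat_braid_def .
  also have "\<dots> = hat w w' g (flat v' Z) \<bullet> flat_arr w (hat v v' f Z) \<bullet> hat_braid v w Z"
    by (rule comp_assoc) (rule typing hat_braid_hom f g)+
  finally show ?thesis .
qed

text \<open>The forward hexagon, all three of whose associators are identities under
  \<open>hat\<close>. The next lemma is the backward one.\<close>

lemma hat_braid_Tens_right:
  "hat_braid v (Tens w x) Z = flat_arr w (hat_braid v x Z) \<bullet> hat_braid v w (flat x Z)"
proof -
  let ?v = "wobj v" and ?w = "wobj w" and ?x = "wobj x"
  note ty = comp_hom tensor_hom idt_hom assoc_hom braid_hom
  let ?p = "Tens (Tens v w) x" and ?q = "Tens w (Tens x v)"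
  have l: "hat ?p ?q (assoc C ?w ?x ?v \<cdot> braid C ?v (?w \<odot> ?x) \<cdot> assoc C ?v ?w ?x) Z =
     hat_braid v (Tens w x) Z"
    apply (subst hat_comp[of _ _ "Tens v (Tens w x)"], (simp only: wobj.simps, (rule ty)+)+)
    apply (subst hat_comp[of _ _ "Tens (Tens w x) v"], (simp only: wobj.simps, (rule ty)+)+)
    unfolding hat_assoc hat_braid_def wobj.simps[symmetric]
    using hat_braid_hom[of v "Tens w x" Z] unfolding hat_braid_def
    by (simp add: comp_idt_left comp_idt_right)
  have r: "hat ?p ?q ((?w \<lhd> braid C ?v ?x) \<cdot> assoc C ?w ?v ?x \<cdot> (braid C ?v ?w \<rhd> ?x)) Z =
     flat_arr w (hat_braid v x Z) \<bullet> hat_braid v w (flat x Z)"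
    apply (subst hat_comp[of _ _ "Tens (Tens w v) x"], (simp only: wobj.simps, (rule ty)+)+)
    apply (subst hat_comp[of _ _ "Tens w (Tens v x)"], (simp only: wobj.simps, (rule ty)+)+)
    apply (subst hat_whisker_left, (simp only: wobj.simps, (rule ty)+))
    apply (subst hat_whisker_right, (simp only: wobj.simps, (rule ty)+))
    unfolding hat_assoc using flat_arr_hom[OF hat_braid_hom[of v x Z], of w] unfolding hat_braid_def
    by (simp add: comp_idt_right)
  show ?thesis using l r hexagon_forward[of ?w ?x ?v] by simp
qed

lemma hat_braid_Tens_left:
  "hat_braid (Tens v w) x Z = hat_braid v x (flat w Z) \<bullet> flat_arr v (hat_braid w x Z)"
proof -
  let ?v = "wobj v" and ?w = "wobj w" and ?x = "wobj x"
  note ty = comp_hom tensor_hom idt_hom assoc_inv_hom braid_hom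
  let ?p = "Tens v (Tens w x)" and ?q = "Tens (Tens x v) w"
  have l: "hat ?p ?q (assoc_inv C ?x ?v ?w \<cdot> braid C (?v \<odot> ?w) ?x \<cdot> assoc_inv C ?v ?w ?x) Z =
     hat_braid (Tens v w) x Z"
    apply (subst hat_comp[of _ _ "Tens (Tens v w) x"], (simp only: wobj.simps, (rule ty)+)+)
    apply (subst hat_comp[of _ _ "Tens x (Tens v w)"], (simp only: wobj.simps, (rule ty)+)+)
    unfolding hat_assoc_inv hat_braid_def wobj.simps[symmetric]
    using hat_braid_hom[of "Tens v w" x Z] unfolding hat_braid_def
    by (simp add: comp_idt_left comp_idt_right)
  have r: "hat ?p ?q ((braid C ?v ?x \<rhd> ?w) \<cdot> assoc_inv C ?v ?x ?w \<cdot> (?v \<lhd> braid C ?w ?x)) Z =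
     hat_braid v x (flat w Z) \<bullet> flat_arr v (hat_braid w x Z)"
    apply (subst hat_comp[of _ _ "Tens v (Tens x w)"], (simp only: wobj.simps, (rule ty)+)+)
    apply (subst hat_comp[of _ _ "Tens (Tens v x) w"], (simp only: wobj.simps, (rule ty)+)+)
    apply (subst hat_whisker_left, (simp only: wobj.simps, (rule ty)+))
    apply (subst hat_whisker_right, (simp only: wobj.simps, (rule ty)+))
    unfolding hat_assoc_inv using hat_braid_hom[of v x "flat w Z"] unfolding hat_braid_def
    by (simp add: comp_idt_right)
  show ?thesis using l r hexagon_backward[of ?x ?v ?w] by simp
qed

lemma hat_braid_iso: "is_iso C (flat v (flat w Z)) (flat w (flat v Z)) (hat_braid v w Z)"
  using hat_inverse[of "Tens v w" "Tens w v"] braid_iso[of "wobj v" "wobj w"]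
  unfolding hat_braid_def is_iso_def by fastforce

text \<open>Naturality against \<open>lunit\<close> of the unit object, which is an identity under
  \<open>hat\<close>, compares the crossing with \<I> to the crossing with \<I> \<otimes> \<I>; the
  hexagon splits the latter into two. So \<open>?p\<close> is idempotent, and being invertible it is
  the identity.\<close>

lemma hat_braid_Unit_right: "hat_braid v Unit Z = idt C (flat v Z)"
proof -
  let ?p = "hat_braid v Unit Z"
  have p: "?p \<in> hom C (flat v Z) (flat v Z)" using hat_braid_hom[of v Unit Z] by simp
  have u: "hat (Tens Unit Unit) Unit (lunit C \<I>) Z = idt C Z" for Z
    using hat_lunit[of Unit Z] by simp
  have "hat_braid v Unit Z \<bullet> hat v v (idt C (wobj v)) (flat Unit Z) \<bullet> flat_arr v (hat (Tens Unit Unit) Unit (lunit C \<I>) Z) =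
    hat (Tens Unit Unit) Unit (lunit C \<I>) (flat v Z) \<bullet> flat_arr (Tens Unit Unit) (hat v v (idt C (wobj v)) Z) \<bullet> hat_braid v (Tens Unit Unit) Z"
    by (rule hat_braid_natural) (simp_all add: idt_hom lunit_hom)
  then have "?p = ?p \<bullet> ?p"
    unfolding u hat_idt flat_arr_idt hat_braid_Tens_right
    using comp_idt_right[OF p] comp_idt_left[OF p] comp_idt_left[OF comp_hom[OF p p]] comp_idt_left[OF idt_hom[of "flat v Z"]]
    by simp
  then have "?p \<bullet> ?p = ?p \<bullet> idt C (flat v Z)" using comp_idt_right[OF p] by simp
  then show ?thesis using iso_cancel_left[of "flat v Z" "flat v Z" ?p] hat_braid_iso[of v Unit Z] p idt_hom by simp
qed

lemma hat_braid_Unit_left: "hat_braid Unit v Z = idt C (flat v Z)"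
proof -
  let ?p = "hat_braid Unit v Z"
  have p: "?p \<in> hom C (flat v Z) (flat v Z)" using hat_braid_hom[of Unit v Z] by simp
  have u: "hat (Tens Unit Unit) Unit (lunit C \<I>) Z = idt C Z" for Z
    using hat_lunit[of Unit Z] by simp
  have "hat_braid Unit v Z \<bullet> hat (Tens Unit Unit) Unit (lunit C \<I>) (flat v Z) \<bullet> flat_arr (Tens Unit Unit) (hat v v (idt C (wobj v)) Z) =
    hat v v (idt C (wobj v)) (flat Unit Z) \<bullet> flat_arr v (hat (Tens Unit Unit) Unit (lunit C \<I>) Z) \<bullet> hat_braid (Tens Unit Unit) v Z"
    by (rule hat_braid_natural) (simp_all add: idt_hom lunit_hom)
  then have "?p = ?p \<bullet> ?p"
    unfolding u hat_idt flat_arr_idt hat_braid_Tens_left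
    using comp_idt_right[OF p] comp_idt_left[OF p] comp_idt_left[OF comp_hom[OF p p]] comp_idt_left[OF idt_hom[of "flat v Z"]]
    by simp
  then have "?p \<bullet> ?p = ?p \<bullet> idt C (flat v Z)" using comp_idt_right[OF p] by simp
  then show ?thesis using iso_cancel_left[of "flat v Z" "flat v Z" ?p] hat_braid_iso[of Unit v Z] p idt_hom by simp
qed

definition braid_tail :: "'o \<Rightarrow> 'o \<Rightarrow> 'o \<Rightarrow> 'm" where
  "braid_tail X Y Z = hat_braid (Obj X) (Obj Y) Z"

lemma braid_tail_hom: "braid_tail X Y Z \<in> hom C (X \<odot> Y \<odot> Z) (Y \<odot> X \<odot> Z)"
  unfolding braid_tail_def using hat_braid_hom[of "Obj X" "Obj Y" Z] by simp

lemma braid_tail_natural: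
  "h \<in> hom C Z Z' \<Longrightarrow> braid_tail X Y Z' \<bullet> (X \<lhd> Y \<lhd> h) = (Y \<lhd> X \<lhd> h) \<bullet> braid_tail X Y Z"
  unfolding braid_tail_def hat_braid_def
  using hat_natural[of _ "Tens (Obj X) (Obj Y)" "Tens (Obj Y) (Obj X)" h Z Z'] braid_hom by simp

text \<open>Naturality of the braiding in the arrow \<open>e\<close>, whose target is the unit and
  crosses \<open>V\<close> trivially. A pairing can be closed behind the strand \<open>V\<close>
  instead of in front of it, at the price of two crossings; \<open>copair_slide\<close> is the dual
  statement.\<close>

lemma pair_slide:
  assumes e: "e \<in> hom C (X \<odot> Y) \<I>"
  shows "pair X Y e (V \<odot> Z) = (V \<lhd> pair X Y e Z) \<bullet> braid_tail X V (Y \<odot> Z) \<bullet> (X \<lhd> braid_tail Y V Z)"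
proof -
  let ?xy = "Tens (Obj X) (Obj Y)" and ?v = "Obj V"
  have et: "pair X Y e (V \<odot> Z) \<in> hom C (X \<odot> Y \<odot> V \<odot> Z) (V \<odot> Z)" by (rule pair_hom[OF e])
  have "hat_braid Unit ?v Z \<bullet> hat ?xy Unit e (flat ?v Z) \<bullet> flat_arr ?xy (hat ?v ?v (idt C (wobj ?v)) Z) =
    hat ?v ?v (idt C (wobj ?v)) (flat Unit Z) \<bullet> flat_arr ?v (hat ?xy Unit e Z) \<bullet> hat_braid ?xy ?v Z"
    by (rule hat_braid_natural) (simp_all add: idt_hom e)
  then have "idt C (V \<odot> Z) \<bullet> pair X Y e (V \<odot> Z) \<bullet> idt C (X \<odot> Y \<odot> V \<odot> Z) =
    idt C (V \<odot> Z) \<bullet> (V \<lhd> pair X Y e Z) \<bullet> braid_tail X V (Y \<odot> Z) \<bullet> (X \<lhd> braid_tail Y V Z)"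
    unfolding hat_braid_Unit_left hat_idt flat_arr_idt hat_braid_Tens_left pair_def braid_tail_def by simp
  then show ?thesis unfolding comp_idt_right[OF et] comp_idt_left[OF et]
    by (subst (asm) comp_idt_left) (rule typing pair_hom[OF e] braid_tail_hom | assumption)+
qed

lemma copair_slide:
  assumes k: "k \<in> hom C \<I> (X \<odot> Y)"
  shows "(X \<lhd> braid_tail V Y Z) \<bullet> braid_tail V X (Y \<odot> Z) \<bullet> (V \<lhd> copair X Y k Z) = copair X Y k (V \<odot> Z)"
proof -
  let ?xy = "Tens (Obj X) (Obj Y)" and ?v = "Obj V"
  have kt: "copair X Y k (V \<odot> Z) \<in> hom C (V \<odot> Z) (X \<odot> Y \<odot> V \<odot> Z)" by (rule copair_hom[OF k])
  have kv: "V \<lhd> copair X Y k Z \<in> hom C (V \<odot> Z) (V \<odot> X \<odot> Y \<odot> Z)"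
    by (rule tensor_hom idt_hom copair_hom[OF k])+
  have "hat_braid ?v ?xy Z \<bullet> hat ?v ?v (idt C (wobj ?v)) (flat ?xy Z) \<bullet> flat_arr ?v (hat Unit ?xy k Z) =
    hat Unit ?xy k (flat ?v Z) \<bullet> flat_arr Unit (hat ?v ?v (idt C (wobj ?v)) Z) \<bullet> hat_braid ?v Unit Z"
    by (rule hat_braid_natural) (simp_all add: idt_hom k)
  then have "((X \<lhd> braid_tail V Y Z) \<bullet> braid_tail V X (Y \<odot> Z)) \<bullet> (V \<lhd> copair X Y k Z) = copair X Y k (V \<odot> Z)"
    unfolding hat_braid_Unit_right hat_idt flat_arr_idt hat_braid_Tens_right copair_def braid_tail_def
    using comp_idt_left[OF kv] comp_idt_right[OF kt] comp_idt_left[OF idt_hom[of "V \<odot> Z"]]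
    by (simp add: copair_def)
  then show ?thesis by (subst (asm) comp_assoc) (rule typing copair_hom[OF k] braid_tail_hom | assumption)+
qed

lemma braid_tail_natural_second:
  assumes g: "g \<in> hom C Y Y'"
  shows "braid_tail X Y' Z \<bullet> (X \<lhd> (g \<rhd> Z)) = (g \<rhd> (X \<odot> Z)) \<bullet> braid_tail X Y Z"
proof -
  let ?x = "Obj X" and ?y = "Obj Y" and ?y' = "Obj Y'"
  have gx: "X \<lhd> (g \<rhd> Z) \<in> hom C (X \<odot> Y \<odot> Z) (X \<odot> Y' \<odot> Z)"
    by (rule typing g)+
  have "hat_braid ?x ?y' Z \<bullet> hat ?x ?x (idt C (wobj ?x)) (flat ?y' Z) \<bullet> flat_arr ?x (hat ?y ?y' g Z) =
    hat ?y ?y' g (flat ?x Z) \<bullet> flat_arr ?y (hat ?x ?x (idt C (wobj ?x)) Z) \<bullet> hat_braid ?x ?y Z"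
    by (rule hat_braid_natural) (simp_all add: idt_hom g)
  then show ?thesis
    unfolding hat_idt flat_arr_idt hat_Obj[OF g] braid_tail_def
    using comp_idt_left[OF gx] comp_idt_left[OF hat_braid_hom[of ?x ?y Z]] by simp
qed

end

section \<open>Evaluation, coevaluation and the Drinfeld morphism\<close>

context ribbon_tensor_category begin

abbreviation "evt X \<equiv> pair (dual C X) X (ev C X)"
abbreviation "coevt X \<equiv> copair X (dual C X) (coev C X)"

lemmas tail_homs = pair_hom[OF ev_hom] copair_hom[OF coev_hom] braid_tail_hom

lemma ev_coev_obj: "(X \<lhd> evt X Z) \<bullet> coevt X (X \<odot> Z) = idt C (X \<odot> Z)"
  using hat_snake_right[OF ev_hom coev_hom, of X Z] hat_idt[of "Obj X" Z]
  unfolding pair_def copair_def zigzag_obj by simp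

lemma drinfeld_tail:
  fixes X :: 'o
  defines "D \<equiv> dual C X" defines "E \<equiv> dual C D"
  shows "drinfeld_arr C X \<rhd> Z = evt X (E \<odot> Z) \<bullet> braid_tail X D (E \<odot> Z) \<bullet> (X \<lhd> coevt D Z)"
    and "drinfeld_arr C X \<in> hom C X E"
proof -
  have e: "ev C X \<cdot> braid C X D \<in> hom C (X \<odot> D) \<I>"
    unfolding D_def by (rule comp_hom ev_hom braid_hom)+
  have k: "coev C D \<in> hom C \<I> (D \<odot> E)" unfolding E_def by (rule coev_hom)
  \<comment> \<open>Evaluation and braiding are fused into a single pairing of \<open>X\<close> with
    \<open>D\<close>, which brings the definition into the shape of
    \<open>hat_snake_left\<close>.\<close>
  have "(ev C X \<cdot> braid C X D) \<rhd> E = (ev C X \<rhd> E) \<cdot> (braid C X D \<rhd> E)"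
    unfolding D_def by (rule tensor_comp_left) (rule braid_hom ev_hom)+
  moreover have "lunit C E \<bullet> (ev C X \<rhd> E) \<bullet> (braid C X D \<rhd> E) =
     (lunit C E \<cdot> (ev C X \<rhd> E)) \<cdot> (braid C X D \<rhd> E)"
    unfolding D_def by (rule comp_assoc[symmetric]) (rule typing ev_hom braid_hom)+
  ultimately have "drinfeld_arr C X =
     lunit C E \<cdot> ((ev C X \<cdot> braid C X D) \<rhd> E) \<cdot> assoc_inv C X D E \<cdot> (X \<lhd> coev C D) \<cdot> runit_inv C X"
    unfolding drinfeld_arr_def Let_def D_def[symmetric] E_def[symmetric] by simp
  note d = this
  show dh: "drinfeld_arr C X \<in> hom C X E"
    unfolding d by (rule typing e k assoc_inv_hom runit_inv_hom)+
  have "drinfeld_arr C X \<rhd> Z = hat (Obj X) (Obj E) (drinfeld_arr C X) Z"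
    by (rule hat_Obj[OF dh, symmetric])
  also have "\<dots> = hat (Tens (Obj X) (Obj D)) Unit (ev C X \<cdot> braid C X D) (E \<odot> Z) \<bullet> (X \<lhd> coevt D Z)"
    unfolding d using hat_snake_left[OF e k] by (simp add: copair_def E_def)
  also have "hat (Tens (Obj X) (Obj D)) Unit (ev C X \<cdot> braid C X D) (E \<odot> Z) =
      evt X (E \<odot> Z) \<bullet> braid_tail X D (E \<odot> Z)"
    using hat_comp[of "braid C X D" "Tens (Obj X) (Obj D)" "Tens (Obj D) (Obj X)" "ev C X" Unit "E \<odot> Z"]
      braid_hom ev_hom
    by (simp add: pair_def braid_tail_def hat_braid_def D_def)
  also have "(evt X (E \<odot> Z) \<bullet> braid_tail X D (E \<odot> Z)) \<bullet> (X \<lhd> coevt D Z) =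
     evt X (E \<odot> Z) \<bullet> braid_tail X D (E \<odot> Z) \<bullet> (X \<lhd> coevt D Z)"
    unfolding D_def E_def by (rule comp_assoc) (rule typing tail_homs)+
  finally show "drinfeld_arr C X \<rhd> Z = evt X (E \<odot> Z) \<bullet> braid_tail X D (E \<odot> Z) \<bullet> (X \<lhd> coevt D Z)" .
qed

text \<open>The strand through the double dual is straightened by the zigzag identity for
  \<open>D\<close>. This eliminates the double dual from the canonical trace.\<close>

lemma ev_drinfeld:
  fixes X :: 'o
  defines "D \<equiv> dual C X"
  shows "evt D Z \<bullet> (drinfeld_arr C X \<rhd> (D \<odot> Z)) = evt X Z \<bullet> braid_tail X D Z"
proof -
  let ?E = "dual C D"
  note ty = typing tail_homs tail_homs[of X, folded D_def]
  have "evt D Z \<bullet> (drinfeld_arr C X \<rhd> (D \<odot> Z)) =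
     evt D Z \<bullet> evt X (?E \<odot> D \<odot> Z) \<bullet> braid_tail X D (?E \<odot> D \<odot> Z) \<bullet> (X \<lhd> coevt D (D \<odot> Z))"
    unfolding drinfeld_tail D_def ..
  also have "\<dots> = evt X Z \<bullet> (D \<lhd> X \<lhd> evt D Z) \<bullet> braid_tail X D (?E \<odot> D \<odot> Z) \<bullet> (X \<lhd> coevt D (D \<odot> Z))"
    unfolding D_def by (rule comp_cong_right[OF pair_natural[OF ev_hom, symmetric]]) (rule typing tail_homs)+
  also have "(D \<lhd> X \<lhd> evt D Z) \<bullet> braid_tail X D (?E \<odot> D \<odot> Z) \<bullet> (X \<lhd> coevt D (D \<odot> Z)) =
      braid_tail X D Z \<bullet> (X \<lhd> D \<lhd> evt D Z) \<bullet> (X \<lhd> coevt D (D \<odot> Z))"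
    by (rule comp_cong_right[OF braid_tail_natural[symmetric]]) (rule typing tail_homs)+
  also have "(X \<lhd> D \<lhd> evt D Z) \<bullet> (X \<lhd> coevt D (D \<odot> Z)) = idt C (X \<odot> D \<odot> Z)"
    by (rule whisker_cancel[OF ev_coev_obj]) (rule typing tail_homs)+
  also have "braid_tail X D Z \<bullet> idt C (X \<odot> D \<odot> Z) = braid_tail X D Z"
    by (rule comp_idt_right) (rule tail_homs)
  finally show ?thesis .
qed

end

section \<open>The Casimir element of an etale algebra\<close>

context algebra_in begin

definition mul :: "'o \<Rightarrow> 'm" where
  "mul Z = hat (Tens (Obj A) (Obj A)) (Obj A) m Z"

definition unt :: "'o \<Rightarrow> 'm" where
  "unt Z = hat Unit (Obj A) \<iota> Z"

lemma mul_hom: "mul Z \<in> hom C (A \<odot> A \<odot> Z) (A \<odot> Z)"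
  unfolding mul_def using hat_hom[of m "Tens (Obj A) (Obj A)" "Obj A" Z] m_hom by simp

lemma unt_hom: "unt Z \<in> hom C Z (A \<odot> Z)"
  unfolding unt_def using hat_hom[of \<iota> Unit "Obj A" Z] \<iota>_hom by simp

lemma mul_natural:
  "h \<in> hom C Z Z' \<Longrightarrow> mul Z' \<bullet> (A \<lhd> A \<lhd> h) = (A \<lhd> h) \<bullet> mul Z"
  unfolding mul_def using hat_natural[of m "Tens (Obj A) (Obj A)" "Obj A" h Z Z'] m_hom by simp

lemma mul_assoc: "mul Z \<bullet> mul (A \<odot> Z) = mul Z \<bullet> (A \<lhd> mul Z)"
proof -
  let ?a = "Obj A"
  let ?p = "Tens (Tens ?a ?a) ?a"
  note ty = comp_hom tensor_hom idt_hom assoc_hom m_hom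
  have l: "hat ?p ?a (m \<cdot> (m \<rhd> A)) Z = mul Z \<bullet> mul (A \<odot> Z)"
    using hat_comp[of "m \<rhd> A" ?p "Tens ?a ?a" m ?a Z]
      hat_whisker_right[of m "Tens ?a ?a" ?a ?a Z] m_hom tensor_hom[OF m_hom idt_hom]
    by (simp add: mul_def)
  have h: "hat (Tens ?a (Tens ?a ?a)) ?a (m \<cdot> (A \<lhd> m)) Z = mul Z \<bullet> (A \<lhd> mul Z)"
    using hat_comp[of "A \<lhd> m" "Tens ?a (Tens ?a ?a)" "Tens ?a ?a" m ?a Z]
      hat_whisker_left[of m "Tens ?a ?a" ?a ?a Z] m_hom tensor_hom[OF idt_hom m_hom]
    by (simp add: mul_def)
  have "hat ?p ?a (m \<cdot> (A \<lhd> m) \<cdot> assoc C A A A) Z =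
     hat (Tens ?a (Tens ?a ?a)) ?a (m \<cdot> (A \<lhd> m)) Z \<cdot> hat ?p (Tens ?a (Tens ?a ?a)) (assoc C A A A) Z"
    by (rule hat_comp) (simp only: wobj.simps, (rule ty)+)+
  also have "\<dots> = mul Z \<bullet> (A \<lhd> mul Z)"
    unfolding h using hat_assoc[of ?a ?a ?a Z]
    by (simp add: comp_idt_right[OF comp_hom[OF mul_hom tensor_hom[OF idt_hom mul_hom]]])
  finally show ?thesis using l m_assoc by simp
qed

lemma mult_unit_left_tail: "mul Z \<bullet> unt (A \<odot> Z) = idt C (A \<odot> Z)"
proof -
  let ?a = "Obj A"
  have "hat (Tens Unit ?a) ?a (m \<cdot> (\<iota> \<rhd> A)) Z = mul Z \<bullet> unt (A \<odot> Z)"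
    using hat_comp[of "\<iota> \<rhd> A" "Tens Unit ?a" "Tens ?a ?a" m ?a Z]
      hat_whisker_right[of \<iota> Unit ?a ?a Z] m_hom \<iota>_hom tensor_hom[OF \<iota>_hom idt_hom]
    by (simp add: mul_def unt_def)
  then show ?thesis using m_unit_left hat_lunit[of ?a Z] by simp
qed

lemma mult_unit_right_tail: "mul Z \<bullet> (A \<lhd> unt Z) = idt C (A \<odot> Z)"
proof -
  let ?a = "Obj A"
  have "hat (Tens ?a Unit) ?a (m \<cdot> (A \<lhd> \<iota>)) Z = mul Z \<bullet> (A \<lhd> unt Z)"
    using hat_comp[of "A \<lhd> \<iota>" "Tens ?a Unit" "Tens ?a ?a" m ?a Z]
      hat_whisker_left[of \<iota> Unit ?a ?a Z] m_hom \<iota>_hom tensor_hom[OF idt_hom \<iota>_hom]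
    by (simp add: mul_def unt_def)
  then show ?thesis using m_unit_right hat_runit[of ?a Z] by simp
qed

end

context etale_algebra begin

definition trace_tail :: "'o \<Rightarrow> 'm" where
  "trace_tail Z = hat (Obj A) Unit (canonical_trace C A m) Z"

abbreviation "pairing \<equiv> canonical_pairing C A m"
abbreviation "pt \<equiv> pair A A pairing"
abbreviation "twt Z \<equiv> twist C A \<rhd> Z"
abbreviation "brt \<equiv> braid_tail A A"

lemma twist_hom: "twist C X \<in> hom C X X"
  by (rule is_iso_hom[OF twist_iso])

lemma spherical_str_hom: "spherical_str C X \<in> hom C X (dual C (dual C X))"
  unfolding spherical_str_def by (rule comp_hom drinfeld_tail twist_hom)+

lemma canonical_trace_hom: "canonical_trace C A m \<in> hom C A \<I>"
  unfolding canonical_trace_def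
  by (rule comp_hom tensor_hom idt_hom ev_hom spherical_str_hom m_hom assoc_inv_hom coev_hom runit_inv_hom)+

lemma pairing_hom: "pairing \<in> hom C (A \<odot> A) \<I>"
  unfolding canonical_pairing_def by (rule comp_hom canonical_trace_hom m_hom)+

lemma trace_tail_hom: "trace_tail Z \<in> hom C (A \<odot> Z) Z"
  unfolding trace_tail_def using hat_hom[of "canonical_trace C A m" "Obj A" Unit Z] canonical_trace_hom by simp

lemma pt_eq: "pt Z = trace_tail Z \<bullet> mul Z"
  using hat_comp[of m "Tens (Obj A) (Obj A)" "Obj A" "canonical_trace C A m" Unit Z] m_hom canonical_trace_hom
  by (simp add: pair_def canonical_pairing_def trace_tail_def mul_def)

lemmas tail_typing = comp_hom tensor_hom idt_hom pair_hom[OF pairing_hom] mul_hom unt_hom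
  trace_tail_hom tail_homs twist_hom

lemma mult_braid_tail: "mul Z \<bullet> brt Z = mul Z"
  using hat_comp[of "braid C A A" "Tens (Obj A) (Obj A)" "Tens (Obj A) (Obj A)" m "Obj A" Z] m_hom braid_hom
    commutative
  by (simp add: mul_def braid_tail_def hat_braid_def)

lemma pt_braid: "pt Z \<bullet> brt Z = pt Z"
proof -
  have "pt Z \<bullet> brt Z = trace_tail Z \<bullet> mul Z \<bullet> brt Z"
    unfolding pt_eq by (rule comp_assoc) (rule tail_typing)+
  then show ?thesis by (simp add: mult_braid_tail pt_eq)
qed

lemma pt_assoc: "pt Z \<bullet> (A \<lhd> mul Z) = pt Z \<bullet> mul (A \<odot> Z)"
proof -
  have "pt Z \<bullet> (A \<lhd> mul Z) = trace_tail Z \<bullet> mul Z \<bullet> (A \<lhd> mul Z)"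
    unfolding pt_eq by (rule comp_assoc) (rule tail_typing)+
  also have "\<dots> = trace_tail Z \<bullet> mul Z \<bullet> mul (A \<odot> Z)" by (simp add: mul_assoc)
  also have "\<dots> = pt Z \<bullet> mul (A \<odot> Z)"
    unfolding pt_eq by (rule comp_assoc[symmetric]) (rule tail_typing)+
  finally show ?thesis .
qed

text \<open>The twist of \<open>A \<otimes> A\<close> is the tensor product of the twists followed
  by a double braiding, and commutativity of \<open>A\<close> absorbs both crossings into the
  product.\<close>

lemma twist_mult: "twt Z \<bullet> mul Z = mul Z \<bullet> twt (A \<odot> Z) \<bullet> (A \<lhd> twt Z)"
proof -
  let ?a = "Obj A" and ?t = "twist C A"
  have t: "?t \<in> hom C A A" by (rule twist_hom)
  note ty = comp_hom tensor_hom idt_hom twist_hom m_hom braid_hom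
  have "?t \<bullet> m = m \<bullet> (braid C A A \<cdot> braid C A A \<cdot> (?t \<otimes>\<^sub>a ?t))"
    using twist_natural[OF m_hom] by (simp add: twist_tensor)
  also have "braid C A A \<cdot> braid C A A \<cdot> (?t \<otimes>\<^sub>a ?t) = braid C A A \<bullet> braid C A A \<bullet> (?t \<otimes>\<^sub>a ?t)"
    by (rule comp_assoc) (rule ty)+
  also have "m \<bullet> \<dots> = m \<bullet> braid C A A \<bullet> (?t \<otimes>\<^sub>a ?t)"
    by (rule comp_collapse_right[OF commutative]) (rule ty)+
  also have "\<dots> = m \<bullet> (?t \<otimes>\<^sub>a ?t)"
    by (rule comp_collapse_right[OF commutative]) (rule ty)+
  finally have "?t \<bullet> m = m \<bullet> (?t \<otimes>\<^sub>a ?t)" .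
  then have "hat (Tens ?a ?a) ?a (?t \<bullet> m) Z = hat (Tens ?a ?a) ?a (m \<bullet> (?t \<otimes>\<^sub>a ?t)) Z" by simp
  then show ?thesis
    using hat_comp[of m "Tens ?a ?a" ?a ?t ?a Z] hat_comp[of "?t \<otimes>\<^sub>a ?t" "Tens ?a ?a" "Tens ?a ?a" m ?a Z]
      m_hom t tensor_hom[OF t t] hat_tensor[of ?t ?a ?a ?t ?a ?a Z] hat_Obj[OF t]
    by (simp add: mul_def)
qed

text \<open>The spherical structure is split into the Drinfeld morphism and the twist. The former
  disappears by \<open>ev_drinfeld\<close>, leaving the braided evaluation; the twist of
  \<open>A\<close> stays and has to be shown trivial later.\<close>

lemma trace_tail_ev:
  "trace_tail Z = evt A Z \<bullet> braid_tail A (dual C A) Z \<bullet> twt (dual C A \<odot> Z) \<bullet>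
     mul (dual C A \<odot> Z) \<bullet> (A \<lhd> coevt A Z)"
proof -
  define D where "D = dual C A"
  let ?a = "Obj A" and ?d = "Obj D" and ?E = "dual C D" and ?s = "spherical_str C A"
  let ?e = "Obj ?E"
  have s: "?s \<in> hom C A ?E" unfolding D_def by (rule spherical_str_hom)
  have dr: "drinfeld_arr C A \<in> hom C A ?E" unfolding D_def by (rule drinfeld_tail)
  have cv: "coev C A \<in> hom C \<I> (A \<odot> D)" unfolding D_def by (rule coev_hom)
  note ty = comp_hom tensor_hom idt_hom ev_hom s m_hom assoc_inv_hom cv runit_inv_hom
  have 1: "hat (Tens ?a ?d) (Tens ?e ?d) (?s \<rhd> D) Z = ?s \<rhd> (D \<odot> Z)"
    using hat_whisker_right[of ?s ?a ?e ?d Z] s hat_Obj[OF s] by simp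
  have 2: "hat (Tens (Tens ?a ?a) ?d) (Tens ?a ?d) (m \<rhd> D) Z = mul (D \<odot> Z)"
    using hat_whisker_right[of m "Tens ?a ?a" ?a ?d Z] m_hom by (simp add: mul_def)
  have 3: "hat (Tens ?a Unit) (Tens ?a (Tens ?a ?d)) (A \<lhd> coev C A) Z = A \<lhd> copair A D (coev C A) Z"
    using hat_whisker_left[of "coev C A" Unit "Tens ?a ?d" ?a Z] cv by (simp add: copair_def)
  have "trace_tail Z = ((((evt D Z \<cdot> (?s \<rhd> (D \<odot> Z))) \<cdot> mul (D \<odot> Z)) \<cdot>
      hat (Tens ?a (Tens ?a ?d)) (Tens (Tens ?a ?a) ?d) (assoc_inv C A A D) Z) \<cdot>
      (A \<lhd> coevt A Z)) \<cdot> hat ?a (Tens ?a Unit) (runit_inv C A) Z"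
    unfolding trace_tail_def canonical_trace_def D_def[symmetric] pair_def 1[symmetric] 2[symmetric] 3[symmetric]
    apply (subst hat_comp[of _ _ "Tens ?a Unit"], (simp only: wobj.simps, (rule ty)+)+)
    apply (subst hat_comp[of _ _ "Tens ?a (Tens ?a ?d)"], (simp only: wobj.simps, (rule ty)+)+)
    apply (subst hat_comp[of _ _ "Tens (Tens ?a ?a) ?d"], (simp only: wobj.simps, (rule ty)+)+)
    apply (subst hat_comp[of _ _ "Tens ?a ?d"], (simp only: wobj.simps, (rule ty)+)+)
    apply (subst hat_comp[of _ _ "Tens ?e ?d"], (simp only: wobj.simps, (rule ty)+)+)
    apply (rule refl)
    done
  also have "\<dots> = ((evt D Z \<cdot> (?s \<rhd> (D \<odot> Z))) \<cdot> mul (D \<odot> Z)) \<cdot> (A \<lhd> coevt A Z)"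
  proof -
    have "(evt D Z \<cdot> (?s \<rhd> (D \<odot> Z))) \<cdot> mul (D \<odot> Z) \<in> hom C (A \<odot> A \<odot> D \<odot> Z) Z"
      and "A \<lhd> coevt A Z \<in> hom C (A \<odot> Z) (A \<odot> A \<odot> D \<odot> Z)"
      unfolding D_def by (rule tail_typing spherical_str_hom)+
    note t = this
    show ?thesis
      using hat_assoc_inv[of ?a ?a ?d Z] hat_runit_inv[of ?a Z]
      by (simp add: comp_idt_right[OF t(1)] comp_idt_right[OF comp_hom[OF t]])
  qed
  also have "?s \<rhd> (D \<odot> Z) = (drinfeld_arr C A \<rhd> (D \<odot> Z)) \<bullet> twt (D \<odot> Z)"
    unfolding spherical_str_def by (rule tensor_comp_left) (rule twist_hom dr)+
  also have "evt D Z \<bullet> \<dots> = (evt A Z \<bullet> braid_tail A D Z) \<bullet> twt (D \<odot> Z)"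
    unfolding D_def ev_drinfeld[symmetric]
    by (rule comp_assoc[symmetric]) (rule tail_typing drinfeld_tail)+
  also have "\<dots> = evt A Z \<bullet> braid_tail A D Z \<bullet> twt (D \<odot> Z)"
    unfolding D_def by (rule comp_assoc) (rule tail_typing)+
  also have "(\<dots> \<bullet> mul (D \<odot> Z)) \<bullet> (A \<lhd> coevt A Z) = \<dots> \<bullet> mul (D \<odot> Z) \<bullet> (A \<lhd> coevt A Z)"
    unfolding D_def by (rule comp_assoc) (rule tail_typing)+
  also have "\<dots> = evt A Z \<bullet> (braid_tail A D Z \<bullet> twt (D \<odot> Z)) \<bullet> mul (D \<odot> Z) \<bullet> (A \<lhd> coevt A Z)"
    unfolding D_def by (rule comp_assoc) (rule tail_typing)+
  also have "(braid_tail A D Z \<bullet> twt (D \<odot> Z)) \<bullet> mul (D \<odot> Z) \<bullet> (A \<lhd> coevt A Z) =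
     braid_tail A D Z \<bullet> twt (D \<odot> Z) \<bullet> mul (D \<odot> Z) \<bullet> (A \<lhd> coevt A Z)"
    unfolding D_def by (rule comp_assoc) (rule tail_typing)+
  finally show ?thesis unfolding D_def .
qed

section \<open>The symmetry of the copairing and the Frobenius relation\<close>

context
  fixes \<kappa> :: 'm
  assumes kappa_hom: "\<kappa> \<in> hom C \<I> (A \<odot> A)"
    and kappa: "lunit C A \<cdot> (pairing \<rhd> A) \<cdot> assoc_inv C A A A \<cdot>
      (A \<lhd> \<kappa>) \<cdot> runit_inv C A = idt C A"
begin

abbreviation "kt \<equiv> copair A A \<kappa>"

lemmas kappa_typing = tail_typing copair_hom[OF kappa_hom]

lemma snake_left: "pt (A \<odot> Z) \<bullet> (A \<lhd> kt Z) = idt C (A \<odot> Z)"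
  using hat_snake_left[OF pairing_hom kappa_hom, of Z] hat_idt[of "Obj A" Z]
  unfolding pair_def copair_def kappa by simp

lemma braided_kappa_hom: "braid C A A \<bullet> \<kappa> \<in> hom C \<I> (A \<odot> A)"
  by (rule comp_hom braid_hom kappa_hom)+

lemma braided_kappa_tail: "copair A A (braid C A A \<bullet> \<kappa>) Z = brt Z \<bullet> kt Z"
  using hat_comp[of \<kappa> Unit "Tens (Obj A) (Obj A)" "braid C A A" "Tens (Obj A) (Obj A)" Z] kappa_hom braid_hom
  by (simp add: copair_def braid_tail_def hat_braid_def)

text \<open>Slide the pairing of the first snake identity over the free strand, absorb one crossing
  into the pairing by commutativity, and slide the copairing back.\<close>

lemma snake_right_braided: "(A \<lhd> pt Z) \<bullet> brt (A \<odot> Z) \<bullet> kt (A \<odot> Z) = idt C (A \<odot> Z)"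
proof -
  let ?k = "copair A A (braid C A A \<bullet> \<kappa>)"
  have kh: "?k Z \<in> hom C Z (A \<odot> A \<odot> Z)" for Z by (rule copair_hom[OF braided_kappa_hom])
  have "idt C (A \<odot> Z) = pt (A \<odot> Z) \<bullet> (A \<lhd> kt Z)" by (rule snake_left[symmetric])
  also have "pt (A \<odot> Z) = ((A \<lhd> pt Z) \<bullet> brt (A \<odot> Z)) \<bullet> (A \<lhd> brt Z)"
    unfolding pair_slide[OF pairing_hom] by (rule comp_assoc[symmetric]) (rule kappa_typing)+
  also have "\<dots> \<bullet> (A \<lhd> kt Z) = ((A \<lhd> pt Z) \<bullet> brt (A \<odot> Z)) \<bullet> (A \<lhd> brt Z) \<bullet> (A \<lhd> kt Z)"
    by (rule comp_assoc) (rule kappa_typing)+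
  also have "(A \<lhd> brt Z) \<bullet> (A \<lhd> kt Z) = A \<lhd> ?k Z"
    by (rule whisker_collapse[OF braided_kappa_tail[symmetric]]) (rule kappa_typing)+
  also have "A \<lhd> pt Z = (A \<lhd> pt Z) \<bullet> (A \<lhd> brt Z)"
    by (rule whisker_collapse[OF pt_braid, symmetric]) (rule kappa_typing)+
  also have "(((A \<lhd> pt Z) \<bullet> (A \<lhd> brt Z)) \<bullet> brt (A \<odot> Z)) \<bullet> (A \<lhd> ?k Z) =
    ((A \<lhd> pt Z) \<bullet> (A \<lhd> brt Z)) \<bullet> brt (A \<odot> Z) \<bullet> (A \<lhd> ?k Z)"
    by (rule comp_assoc) (rule kappa_typing kh)+
  also have "\<dots> = (A \<lhd> pt Z) \<bullet> (A \<lhd> brt Z) \<bullet> brt (A \<odot> Z) \<bullet> (A \<lhd> ?k Z)"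
    by (rule comp_assoc) (rule kappa_typing kh)+
  also have "(A \<lhd> brt Z) \<bullet> brt (A \<odot> Z) \<bullet> (A \<lhd> ?k Z) = ?k (A \<odot> Z)"
    by (rule copair_slide[OF braided_kappa_hom])
  finally show ?thesis by (simp add: braided_kappa_tail)
qed

text \<open>Two one-sided inverses of the same pairing coincide: \<kappa> satisfies the snake
  identity on one side and the braided \<kappa> satisfies it on the other. Separability supplies one
  side only; the symmetry found here yields the other.\<close>

lemma braid_kappa_tail: "brt Z \<bullet> kt Z = kt Z"
proof -
  let ?k = "copair A A (braid C A A \<bullet> \<kappa>)"
  have kh: "?k Z \<in> hom C Z (A \<odot> A \<odot> Z)" for Z by (rule copair_hom[OF braided_kappa_hom])
  have "?k Z = idt C (A \<odot> A \<odot> Z) \<bullet> ?k Z" by (rule comp_idt_left[symmetric]) (rule kh)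
  also have "idt C (A \<odot> A \<odot> Z) = (A \<lhd> pt (A \<odot> Z)) \<bullet> (A \<lhd> A \<lhd> kt Z)"
    by (rule whisker_cancel[OF snake_left, symmetric]) (rule kappa_typing)+
  also have "\<dots> \<bullet> ?k Z = (A \<lhd> pt (A \<odot> Z)) \<bullet> (A \<lhd> A \<lhd> kt Z) \<bullet> ?k Z"
    by (rule comp_assoc) (rule kappa_typing kh)+
  also have "(A \<lhd> A \<lhd> kt Z) \<bullet> ?k Z = ?k (A \<odot> A \<odot> Z) \<bullet> kt Z"
    by (rule copair_natural[OF braided_kappa_hom, symmetric]) (rule kappa_typing)
  also have "(A \<lhd> pt (A \<odot> Z)) \<bullet> \<dots> = idt C (A \<odot> A \<odot> Z) \<bullet> kt Z"
    by (rule comp_collapse_right, simp only: braided_kappa_tail, rule snake_right_braided) (rule kappa_typing kh)+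
  also have "\<dots> = kt Z" by (rule comp_idt_left) (rule kappa_typing)
  finally show ?thesis by (simp add: braided_kappa_tail)
qed

lemma snake_right: "(A \<lhd> pt Z) \<bullet> kt (A \<odot> Z) = idt C (A \<odot> Z)"
  using snake_right_braided by (simp add: braid_kappa_tail)

text \<open>In elements, with \<kappa> = \<Sum> u \<otimes> v: \<Sum> a u \<otimes> v = \<Sum> u
  \<otimes> v a. A snake is inserted on the left-hand side, invariance of the pairing
  (\<open>pt_assoc\<close>) moves the product to the other argument of the pairing, and the opposite
  snake is removed.\<close>

lemma frobenius: "mul (A \<odot> Z) \<bullet> (A \<lhd> kt Z) = (A \<lhd> mul Z) \<bullet> kt (A \<odot> Z)"
proof -
  let ?l = "mul (A \<odot> Z) \<bullet> (A \<lhd> kt Z)"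
  have "?l = idt C (A \<odot> A \<odot> Z) \<bullet> ?l" by (rule comp_idt_left[symmetric]) (rule kappa_typing)+
  also have "\<dots> = (A \<lhd> pt (A \<odot> Z)) \<bullet> kt (A \<odot> A \<odot> Z) \<bullet> ?l"
    by (rule comp_collapse_right[OF snake_right, symmetric]) (rule kappa_typing)+
  also have "kt (A \<odot> A \<odot> Z) \<bullet> ?l =
      (A \<lhd> A \<lhd> mul (A \<odot> Z)) \<bullet> kt (A \<odot> A \<odot> A \<odot> Z) \<bullet> (A \<lhd> kt Z)"
    by (rule comp_cong_right[OF copair_natural[OF kappa_hom]]) (rule kappa_typing)+
  also have "kt (A \<odot> A \<odot> A \<odot> Z) \<bullet> (A \<lhd> kt Z) = (A \<lhd> A \<lhd> A \<lhd> kt Z) \<bullet> kt (A \<odot> Z)"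
    by (rule copair_natural[OF kappa_hom]) (rule kappa_typing)+
  also have "(A \<lhd> pt (A \<odot> Z)) \<bullet> (A \<lhd> A \<lhd> mul (A \<odot> Z)) \<bullet> (A \<lhd> A \<lhd> A \<lhd> kt Z) \<bullet> kt (A \<odot> Z) =
     (A \<lhd> pt (A \<odot> Z)) \<bullet> (A \<lhd> mul (A \<odot> A \<odot> Z)) \<bullet> (A \<lhd> A \<lhd> A \<lhd> kt Z) \<bullet> kt (A \<odot> Z)"
    by (rule comp_cong_right[OF whisker_cong[OF pt_assoc]]) (rule kappa_typing)+
  also have "(A \<lhd> mul (A \<odot> A \<odot> Z)) \<bullet> (A \<lhd> A \<lhd> A \<lhd> kt Z) \<bullet> kt (A \<odot> Z) =
     (A \<lhd> A \<lhd> kt Z) \<bullet> (A \<lhd> mul Z) \<bullet> kt (A \<odot> Z)"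
    by (rule comp_cong_right[OF whisker_cong[OF mul_natural]]) (rule kappa_typing)+
  also have "(A \<lhd> pt (A \<odot> Z)) \<bullet> \<dots> = (A \<lhd> mul Z) \<bullet> kt (A \<odot> Z)"
    by (rule comp_cancel_right[OF whisker_cancel[OF snake_left]]) (rule kappa_typing)+
  finally show ?thesis .
qed

text \<open>The comparison \<open>\<phi>: A\<^sup>* \<rightarrow> A\<close> of the given dual with the self-duality by \<open>\<kappa>\<close> turns the
  canonical trace into a trace formed with the pairing and \<open>\<kappa>\<close> alone.\<close>

lemma trace_tail_kappa: "trace_tail Z = pt Z \<bullet> twt (A \<odot> Z) \<bullet> mul (A \<odot> Z) \<bullet> (A \<lhd> kt Z)"
proof -
  define D where "D = dual C A"
  define \<phi> where "\<phi> = lunit C A \<cdot> (ev C A \<rhd> A) \<cdot> assoc_inv C D A A \<cdot> (D \<lhd> \<kappa>) \<cdot> runit_inv C D"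
  have e: "ev C A \<in> hom C (D \<odot> A) \<I>" unfolding D_def by (rule ev_hom)
  have phi: "\<phi> \<in> hom C D A"
    unfolding \<phi>_def by (rule typing e kappa_hom assoc_inv_hom runit_inv_hom)+
  define p where "p Z = \<phi> \<rhd> Z" for Z
  have ph: "p Z \<in> hom C (D \<odot> Z) (A \<odot> Z)" for Z unfolding p_def by (rule tensor_hom phi idt_hom)+
  have p: "p Z = evt A (A \<odot> Z) \<bullet> (D \<lhd> kt Z)" for Z
    unfolding p_def using hat_Obj[OF phi, symmetric] hat_snake_left[OF e kappa_hom]
    by (simp add: \<phi>_def pair_def copair_def D_def)
  have eh: "evt A Z \<in> hom C (D \<odot> A \<odot> Z) Z" and ch: "coevt A Z \<in> hom C Z (A \<odot> D \<odot> Z)" for Z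
    unfolding D_def by (rule tail_homs)+
  note ty = kappa_typing ph eh ch
  have p_coev: "(A \<lhd> p Z) \<bullet> coevt A Z = kt Z"
  proof -
    have "(A \<lhd> p Z) \<bullet> coevt A Z = ((A \<lhd> evt A (A \<odot> Z)) \<bullet> (A \<lhd> D \<lhd> kt Z)) \<bullet> coevt A Z"
      unfolding p by (subst tensor_comp_right) (rule ty refl)+
    also have "\<dots> = (A \<lhd> evt A (A \<odot> Z)) \<bullet> (A \<lhd> D \<lhd> kt Z) \<bullet> coevt A Z"
      by (rule comp_assoc) (rule eh tensor_hom idt_hom kappa_typing ch)+
    also have "(A \<lhd> D \<lhd> kt Z) \<bullet> coevt A Z = coevt A (A \<odot> A \<odot> Z) \<bullet> kt Z"
      unfolding D_def by (rule copair_natural[OF coev_hom, symmetric]) (rule ty)+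
    also have "(A \<lhd> evt A (A \<odot> Z)) \<bullet> \<dots> = kt Z"
      by (rule comp_cancel_right[OF ev_coev_obj]) (rule kappa_typing)+
    finally show ?thesis .
  qed
  have pt_p: "pt Z \<bullet> p (A \<odot> Z) = evt A Z" for Z
  proof -
    have "pt Z \<bullet> p (A \<odot> Z) = evt A Z \<bullet> (D \<lhd> A \<lhd> pt Z) \<bullet> (D \<lhd> kt (A \<odot> Z))"
      unfolding p D_def
      by (rule comp_cong_right[OF pair_natural[OF ev_hom, symmetric]]) (rule kappa_typing)+
    also have "(D \<lhd> A \<lhd> pt Z) \<bullet> (D \<lhd> kt (A \<odot> Z)) = idt C (D \<odot> A \<odot> Z)"
      by (rule whisker_cancel[OF snake_right]) (rule kappa_typing)+
    also have "evt A Z \<bullet> \<dots> = evt A Z" by (rule comp_idt_right) (rule eh)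
    finally show ?thesis .
  qed
  \<comment> \<open>Invariance of the pairing under the braiding moves \<phi> from the first leg to
    the second, where it can travel past the twist and the product until it meets the
    coevaluation.\<close>
  have pt_p': "evt A Z \<bullet> braid_tail A D Z = pt Z \<bullet> (A \<lhd> p Z)"
  proof -
    have "pt Z \<bullet> (A \<lhd> p Z) = pt Z \<bullet> brt Z \<bullet> (A \<lhd> p Z)"
      by (rule comp_collapse_right[OF pt_braid, symmetric]) (rule ty)+
    also have "brt Z \<bullet> (A \<lhd> p Z) = p (A \<odot> Z) \<bullet> braid_tail A D Z"
      unfolding p_def by (rule braid_tail_natural_second) (rule phi)
    also have "pt Z \<bullet> \<dots> = evt A Z \<bullet> braid_tail A D Z"
      by (rule comp_collapse_right[OF pt_p]) (rule ph ty)+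
    finally show ?thesis ..
  qed
  let ?r = "mul (D \<odot> Z) \<bullet> (A \<lhd> coevt A Z)"
  have "trace_tail Z = evt A Z \<bullet> braid_tail A D Z \<bullet> twt (D \<odot> Z) \<bullet> ?r"
    unfolding trace_tail_ev D_def ..
  also have "\<dots> = pt Z \<bullet> (A \<lhd> p Z) \<bullet> twt (D \<odot> Z) \<bullet> ?r"
    by (rule comp_cong_right[OF pt_p']) (rule eh braid_tail_hom ph comp_hom tensor_hom idt_hom twist_hom mul_hom ch pair_hom[OF pairing_hom])+
  also have "(A \<lhd> p Z) \<bullet> twt (D \<odot> Z) \<bullet> ?r = twt (A \<odot> Z) \<bullet> (A \<lhd> p Z) \<bullet> ?r"
    by (rule comp_cong_right)
      (simp add: interchange[OF twist_hom ph], (rule ph comp_hom tensor_hom idt_hom twist_hom mul_hom ch)+)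
  also have "(A \<lhd> p Z) \<bullet> ?r = mul (A \<odot> Z) \<bullet> (A \<lhd> A \<lhd> p Z) \<bullet> (A \<lhd> coevt A Z)"
    by (rule comp_cong_right[OF mul_natural[symmetric]]) (rule ph comp_hom tensor_hom idt_hom mul_hom ch)+
  also have "(A \<lhd> A \<lhd> p Z) \<bullet> (A \<lhd> coevt A Z) = A \<lhd> kt Z"
    by (rule whisker_collapse[OF p_coev]) (rule ph tensor_hom idt_hom ch)+
  finally show ?thesis .
qed

end

section \<open>Triviality of the twist and the normalised Casimir element\<close>

definition casimir :: "'m \<Rightarrow> bool" where
  "casimir \<kappa> \<longleftrightarrow> \<kappa> \<in> hom C \<I> (A \<odot> A) \<and>
    (\<forall>Z. mul (A \<odot> Z) \<bullet> (A \<lhd> copair A A \<kappa> Z) = (A \<lhd> mul Z) \<bullet> copair A A \<kappa> (A \<odot> Z))"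

text \<open>Existence and uniqueness of the scalar, for typed arguments, are the axiom
  \<open>connected\<close>.\<close>

definition form :: "'m \<Rightarrow> 'm \<Rightarrow> 'm \<Rightarrow> 'k" where
  "form \<kappa> f g = (THE a. m \<bullet> (f \<otimes>\<^sub>a g) \<bullet> \<kappa> = a *\<^sub>s \<iota>)"

lemma scale_unit_inj: "a *\<^sub>s \<iota> = b *\<^sub>s \<iota> \<Longrightarrow> a = b"
  using connected by (auto simp: bij_betw_def inj_on_def)

lemma unit_nonzero: "\<iota> \<noteq> 0"
  using scale_unit_inj[of 1 0] by auto

lemma form_eqI: "m \<bullet> (f \<otimes>\<^sub>a g) \<bullet> \<kappa> = a *\<^sub>s \<iota> \<Longrightarrow> form \<kappa> f g = a"
  unfolding form_def using scale_unit_inj by (intro the_equality) auto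

lemma form:
  assumes "\<kappa> \<in> hom C \<I> (A \<odot> A)" "f \<in> hom C A A" "g \<in> hom C A A"
  shows "m \<bullet> (f \<otimes>\<^sub>a g) \<bullet> \<kappa> = form \<kappa> f g *\<^sub>s \<iota>"
proof -
  have "m \<bullet> (f \<otimes>\<^sub>a g) \<bullet> \<kappa> \<in> hom C \<I> A" by (rule comp_hom tensor_hom m_hom assms)+
  then obtain a where a: "m \<bullet> (f \<otimes>\<^sub>a g) \<bullet> \<kappa> = a *\<^sub>s \<iota>"
    using connected by (auto simp: bij_betw_def)
  then show ?thesis using form_eqI by blast
qed

lemma form_tail:
  assumes k: "\<kappa> \<in> hom C \<I> (A \<odot> A)" and f: "f \<in> hom C A A" and g: "g \<in> hom C A A"
  shows "mul Z \<bullet> (f \<rhd> (A \<odot> Z)) \<bullet> (A \<lhd> (g \<rhd> Z)) \<bullet> copair A A \<kappa> Z =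
    form \<kappa> f g *\<^sub>s unt Z"
proof -
  let ?a = "Obj A" and ?aa = "Tens (Obj A) (Obj A)"
  have fg: "f \<otimes>\<^sub>a g \<in> hom C (A \<odot> A) (A \<odot> A)" by (rule tensor_hom f g)+
  have "form \<kappa> f g *\<^sub>s unt Z = hat Unit ?a (m \<bullet> (f \<otimes>\<^sub>a g) \<bullet> \<kappa>) Z"
    unfolding form[OF assms] using hat_scale[of \<iota> Unit ?a _ Z] \<iota>_hom by (simp add: unt_def)
  also have "\<dots> = mul Z \<bullet> hat Unit ?aa ((f \<otimes>\<^sub>a g) \<bullet> \<kappa>) Z"
    unfolding mul_def by (rule hat_comp) (simp_all add: m_hom comp_hom[OF fg k])
  also have "hat Unit ?aa ((f \<otimes>\<^sub>a g) \<bullet> \<kappa>) Z = hat ?aa ?aa (f \<otimes>\<^sub>a g) Z \<bullet> copair A A \<kappa> Z"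
    unfolding copair_def by (rule hat_comp) (simp_all add: fg k)
  also have "hat ?aa ?aa (f \<otimes>\<^sub>a g) Z = (f \<rhd> (A \<odot> Z)) \<bullet> (A \<lhd> (g \<rhd> Z))"
    using hat_tensor[of f ?a ?a g ?a ?a Z] f g by (simp add: hat_Obj)
  also have "\<dots> \<bullet> copair A A \<kappa> Z =
      (f \<rhd> (A \<odot> Z)) \<bullet> (A \<lhd> (g \<rhd> Z)) \<bullet> copair A A \<kappa> Z"
    by (rule comp_assoc) (rule tensor_hom idt_hom f g copair_hom[OF k])+
  finally show ?thesis ..
qed

lemma form_tail_id:
  assumes k: "\<kappa> \<in> hom C \<I> (A \<odot> A)" and f: "f \<in> hom C A A"
  shows "mul Z \<bullet> (f \<rhd> (A \<odot> Z)) \<bullet> copair A A \<kappa> Z =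
    form \<kappa> f (idt C A) *\<^sub>s unt Z"
  using form_tail[OF k f idt_hom, of Z] comp_idt_left[OF copair_hom[OF k], of Z]
  by (simp add: tensor_idt)

lemma mult_scaled_unit: "mul Z \<bullet> (A \<lhd> (a *\<^sub>s unt Z)) = a *\<^sub>s idt C (A \<odot> Z)"
  unfolding tensor_scale_right[OF idt_hom unt_hom]
    comp_scale_right[OF mul_hom tensor_hom[OF idt_hom unt_hom]] mult_unit_right_tail ..

text \<open>The twist of a commutative algebra is an algebra automorphism. For such an \<open>f\<close> the scalar
  \<open>form \<kappa> f 1\<close> vanishes unless \<open>f = 1\<close>, as in Dedekind's independence of characters: compare
  this lemma with the Frobenius relation.\<close>

lemma twist_mult_kappa:
  assumes k: "\<kappa> \<in> hom C \<I> (A \<odot> A)"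
  shows "mul Z \<bullet> twt (A \<odot> Z) \<bullet> mul (A \<odot> Z) \<bullet> (A \<lhd> copair A A \<kappa> Z) =
    form \<kappa> (twist C A) (idt C A) *\<^sub>s twt Z"
proof -
  let ?k = "copair A A \<kappa>" and ?d = "form \<kappa> (twist C A) (idt C A)"
  note ty = tail_typing copair_hom[OF k]
  have "mul Z \<bullet> twt (A \<odot> Z) \<bullet> mul (A \<odot> Z) \<bullet> (A \<lhd> ?k Z) =
     mul Z \<bullet> mul (A \<odot> Z) \<bullet> (twt (A \<odot> A \<odot> Z) \<bullet> (A \<lhd> twt (A \<odot> Z))) \<bullet> (A \<lhd> ?k Z)"
    by (subst comp_cong_right[OF twist_mult]) (rule ty refl)+
  also have "(twt (A \<odot> A \<odot> Z) \<bullet> (A \<lhd> twt (A \<odot> Z))) \<bullet> (A \<lhd> ?k Z) =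
     twt (A \<odot> A \<odot> Z) \<bullet> (A \<lhd> twt (A \<odot> Z)) \<bullet> (A \<lhd> ?k Z)"
    by (rule comp_assoc) (rule ty)+
  also have "(A \<lhd> twt (A \<odot> Z)) \<bullet> (A \<lhd> ?k Z) = A \<lhd> (twt (A \<odot> Z) \<bullet> ?k Z)"
    by (rule tensor_comp_right[symmetric]) (rule ty)+
  also have "mul Z \<bullet> mul (A \<odot> Z) \<bullet> twt (A \<odot> A \<odot> Z) \<bullet> (A \<lhd> (twt (A \<odot> Z) \<bullet> ?k Z)) =
     mul Z \<bullet> (A \<lhd> mul Z) \<bullet> twt (A \<odot> A \<odot> Z) \<bullet> (A \<lhd> (twt (A \<odot> Z) \<bullet> ?k Z))"
    by (rule comp_cong_right[OF mul_assoc]) (rule ty)+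
  also have "(A \<lhd> mul Z) \<bullet> twt (A \<odot> A \<odot> Z) \<bullet> (A \<lhd> (twt (A \<odot> Z) \<bullet> ?k Z)) =
     twt (A \<odot> Z) \<bullet> (A \<lhd> mul Z) \<bullet> (A \<lhd> (twt (A \<odot> Z) \<bullet> ?k Z))"
    by (rule comp_cong_right) (simp add: interchange[OF twist_hom mul_hom], (rule ty)+)
  also have "(A \<lhd> mul Z) \<bullet> (A \<lhd> (twt (A \<odot> Z) \<bullet> ?k Z)) = A \<lhd> (?d *\<^sub>s unt Z)"
    unfolding form_tail_id[OF k twist_hom, symmetric]
    by (rule tensor_comp_right[symmetric]) (rule ty)+
  also have "twt (A \<odot> Z) \<bullet> (A \<lhd> (?d *\<^sub>s unt Z)) = (A \<lhd> (?d *\<^sub>s unt Z)) \<bullet> twt Z"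
    by (simp add: interchange[OF twist_hom hom_scale[OF unt_hom]])
  also have "mul Z \<bullet> (A \<lhd> (?d *\<^sub>s unt Z)) \<bullet> twt Z = (?d *\<^sub>s idt C (A \<odot> Z)) \<bullet> twt Z"
    by (rule comp_collapse_right[OF mult_scaled_unit]) (rule ty hom_scale)+
  also have "\<dots> = ?d *\<^sub>s twt Z"
    unfolding comp_scale_left[OF idt_hom tensor_hom[OF twist_hom idt_hom]]
      comp_idt_left[OF tensor_hom[OF twist_hom idt_hom]] ..
  finally show ?thesis .
qed

lemma exists_casimir:
  obtains \<kappa> where "casimir \<kappa>" "braid C A A \<bullet> \<kappa> = \<kappa>" "m \<bullet> \<kappa> = \<iota>"
proof -
  obtain \<kappa> where k: "\<kappa> \<in> hom C \<I> (A \<odot> A)"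
    and kappa: "lunit C A \<cdot> (pairing \<rhd> A) \<cdot> assoc_inv C A A A \<cdot>
      (A \<lhd> \<kappa>) \<cdot> runit_inv C A = idt C A"
    using separable unfolding nondegenerate_pairing_def by auto
  note ty = tail_typing copair_hom[OF k]
  let ?k = "copair A A \<kappa>"
  \<comment> \<open>The scalar has the twist built in, because the trace does. Only after the twist
    is known to be trivial does it become the factor between \<open>m \<bullet> \<kappa>\<close> and
    \<iota>.\<close>
  define d where "d = form \<kappa> (twist C A) (idt C A)"
  have tr: "trace_tail Z = d *\<^sub>s (trace_tail Z \<bullet> twt Z)" for Z
  proof -
    have "trace_tail Z = trace_tail Z \<bullet> mul Z \<bullet> twt (A \<odot> Z) \<bullet> mul (A \<odot> Z) \<bullet> (A \<lhd> ?k Z)"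
      by (subst trace_tail_kappa[OF k kappa], unfold pt_eq, rule comp_assoc) (rule ty)+
    also have "\<dots> = d *\<^sub>s (trace_tail Z \<bullet> twt Z)"
      unfolding twist_mult_kappa[OF k] d_def
      by (rule comp_scale_right) (rule ty)+
    finally show ?thesis .
  qed
  \<comment> \<open>If \<open>d\<close> were zero, the trace and with it the pairing would vanish;
    the snake identity would make an identity arrow zero and finally \<iota> itself.\<close>
  have d: "d \<noteq> 0"
  proof
    assume "d = 0"
    then have "trace_tail Z = 0" for Z using tr[of Z] by simp
    then have "pt Z = 0" for Z unfolding pt_eq using comp_zero_left[OF mul_hom] by simp
    then have "idt C (A \<odot> \<I>) = 0"
      using snake_left[OF k kappa, of \<I>] comp_zero_left[of "A \<lhd> ?k \<I>"] ty by (simp add: comp_zero_left[OF tensor_hom[OF idt_hom copair_hom[OF k]]])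
    then have "unt \<I> = 0"
      using comp_idt_left[OF unt_hom, of \<I>] comp_zero_left[OF unt_hom] by simp
    then have "hat Unit (Obj A) \<iota> \<I> = hat Unit (Obj A) (0 *\<^sub>s \<iota>) \<I>"
      using hat_scale[of \<iota> Unit "Obj A" 0 \<I>] \<iota>_hom by (simp add: unt_def)
    then have "\<iota> = 0 *\<^sub>s \<iota>"
      by (rule hat_cancel[rotated 2]) (simp_all add: \<iota>_hom hom_zero)
    then show False using unit_nonzero by simp
  qed
  \<comment> \<open>One arrow is evaluated twice. With \<kappa> = \<Sum> u \<otimes> v and \<theta>
    the twist, \<Sum> \<theta>(a u) v is \<open>d\<close> times \<theta>(a) by multiplicativity; by
    the Frobenius relation it is also \<Sum> \<theta>(u) v a, where \<theta> does not reach a, hence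
    \<open>d\<close> times a.\<close>
  have twist: "twt Z = idt C (A \<odot> Z)" for Z
  proof -
    have "d *\<^sub>s twt Z = mul Z \<bullet> twt (A \<odot> Z) \<bullet> (A \<lhd> mul Z) \<bullet> ?k (A \<odot> Z)"
      unfolding d_def twist_mult_kappa[OF k, symmetric] frobenius[OF k kappa] ..
    also have "twt (A \<odot> Z) \<bullet> (A \<lhd> mul Z) \<bullet> ?k (A \<odot> Z) =
       (A \<lhd> mul Z) \<bullet> twt (A \<odot> A \<odot> Z) \<bullet> ?k (A \<odot> Z)"
      by (rule comp_cong_right) (simp add: interchange[OF twist_hom mul_hom], (rule ty)+)
    also have "mul Z \<bullet> \<dots> = mul Z \<bullet> mul (A \<odot> Z) \<bullet> twt (A \<odot> A \<odot> Z) \<bullet> ?k (A \<odot> Z)"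
      by (rule comp_cong_right[OF mul_assoc[symmetric]]) (rule ty)+
    also have "mul (A \<odot> Z) \<bullet> twt (A \<odot> A \<odot> Z) \<bullet> ?k (A \<odot> Z) = d *\<^sub>s unt (A \<odot> Z)"
      unfolding d_def by (rule form_tail_id[OF k twist_hom])
    also have "mul Z \<bullet> \<dots> = d *\<^sub>s idt C (A \<odot> Z)"
      unfolding comp_scale_right[OF mul_hom unt_hom] mult_unit_left_tail ..
    finally show ?thesis using d by simp
  qed
  have "twist C A = idt C A"
    by (rule tensor_id_cancel) (rule twist_hom idt_hom | simp add: twist tensor_idt)+
  then have mk: "m \<bullet> \<kappa> = d *\<^sub>s \<iota>"
    using form[OF k idt_hom idt_hom] comp_idt_left[OF k] by (simp add: d_def tensor_idt)
  have bk: "braid C A A \<bullet> \<kappa> = \<kappa>"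
  proof (rule hat_cancel[of _ Unit "Tens (Obj A) (Obj A)"])
    show "hat Unit (Tens (Obj A) (Obj A)) (braid C A A \<bullet> \<kappa>) \<I> = hat Unit (Tens (Obj A) (Obj A)) \<kappa> \<I>"
      using braided_kappa_tail[OF k kappa, of \<I>] braid_kappa_tail[OF k kappa, of \<I>]
      by (simp add: copair_def)
  qed (simp_all add: k comp_hom[OF braid_hom k])
  have kt: "copair A A (a *\<^sub>s \<kappa>) Z = a *\<^sub>s ?k Z" for a Z
    unfolding copair_def by (rule hat_scale) (simp add: k)
  show ?thesis
  proof (rule that[of "inverse d *\<^sub>s \<kappa>"])
    show "casimir (inverse d *\<^sub>s \<kappa>)"
      unfolding casimir_def kt tensor_scale_right[OF idt_hom copair_hom[OF k]]
        comp_scale_right[OF mul_hom tensor_hom[OF idt_hom copair_hom[OF k]]]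
        comp_scale_right[OF tensor_hom[OF idt_hom mul_hom] copair_hom[OF k]] frobenius[OF k kappa]
      by (simp add: hom_scale k)
    show "braid C A A \<bullet> (inverse d *\<^sub>s \<kappa>) = inverse d *\<^sub>s \<kappa>"
      by (simp add: comp_scale_right[OF braid_hom k] bk)
    show "m \<bullet> (inverse d *\<^sub>s \<kappa>) = \<iota>"
      using d by (simp add: comp_scale_right[OF m_hom k] mk)
  qed
qed

section \<open>Contractions of arrows A \<otimes> A \<rightarrow> A with the Casimir element\<close>

definition bin_tail :: "'m \<Rightarrow> 'o \<Rightarrow> 'm" where
  "bin_tail F Z = hat (Tens (Obj A) (Obj A)) (Obj A) F Z"

text \<open>Both contractions turn \<open>F: A \<otimes> A \<rightarrow> A\<close> into an endomorphism of \<open>A \<otimes> I\<close> by composing with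
  \<open>\<kappa>\<close> and an endomorphism; on \<open>F = m (p \<otimes> q)\<close> they evaluate one tensor leg by the form.\<close>

definition contract_right :: "'m \<Rightarrow> 'm \<Rightarrow> 'm \<Rightarrow> 'm" where
  "contract_right \<kappa> g F = mul \<I> \<bullet> bin_tail F (A \<odot> \<I>) \<bullet>
     (A \<lhd> A \<lhd> (g \<rhd> \<I>)) \<bullet> (A \<lhd> copair A A \<kappa> \<I>)"

definition contract_left :: "'m \<Rightarrow> 'm \<Rightarrow> 'm \<Rightarrow> 'm" where
  "contract_left \<kappa> f F = mul \<I> \<bullet> (f \<rhd> (A \<odot> \<I>)) \<bullet>
     (A \<lhd> bin_tail F \<I>) \<bullet> copair A A \<kappa> (A \<odot> \<I>)"

lemma bin_tail_hom: "F \<in> hom C (A \<odot> A) A \<Longrightarrow> bin_tail F Z \<in> hom C (A \<odot> A \<odot> Z) (A \<odot> Z)"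
  unfolding bin_tail_def using hat_hom[of F "Tens (Obj A) (Obj A)" "Obj A" Z] by simp

lemma bin_tail_pure:
  assumes p: "p \<in> hom C A A" and q: "q \<in> hom C A A"
  shows "bin_tail (m \<bullet> (p \<otimes>\<^sub>a q)) Z = mul Z \<bullet> (p \<rhd> (A \<odot> Z)) \<bullet> (A \<lhd> (q \<rhd> Z))"
  using hat_comp[of "p \<otimes>\<^sub>a q" "Tens (Obj A) (Obj A)" "Tens (Obj A) (Obj A)" m "Obj A" Z]
    hat_tensor[of p "Obj A" "Obj A" q "Obj A" "Obj A" Z] p q tensor_hom[OF p q] m_hom
  by (simp add: bin_tail_def mul_def hat_Obj)

lemma bin_tail_post:
  assumes f: "f \<in> hom C A A"
  shows "bin_tail (f \<bullet> m) Z = (f \<rhd> Z) \<bullet> mul Z"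
  using hat_comp[of m "Tens (Obj A) (Obj A)" "Obj A" f "Obj A" Z] f m_hom
  by (simp add: bin_tail_def mul_def hat_Obj)

text \<open>Associativity regroups the triple product so that the strands of \<open>q\<close> and
  \<open>g\<close> are multiplied with each other first. Both start at \<kappa>, so they produce a
  scalar and only \<open>p\<close> remains. For \<open>contract_left\<close> the roles of the legs
  are exchanged, and \<open>q\<close> is carried along in the tail of \<kappa>.\<close>

lemma contract_right_pure:
  assumes k: "\<kappa> \<in> hom C \<I> (A \<odot> A)" and p: "p \<in> hom C A A" and q: "q \<in> hom C A A" and g: "g \<in> hom C A A"
  shows "contract_right \<kappa> g (m \<bullet> (p \<otimes>\<^sub>a q)) = form \<kappa> q g *\<^sub>s (p \<rhd> \<I>)"
proof -
  define Z where "Z = \<I>"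
  let ?k = "copair A A \<kappa>" and ?c = "form \<kappa> q g"
  let ?p = "\<lambda>Z. p \<rhd> Z" and ?q = "\<lambda>Z. q \<rhd> Z" and ?g = "\<lambda>Z. g \<rhd> Z"
  note ty = tail_typing copair_hom[OF k] p q g
  have "contract_right \<kappa> g (m \<bullet> (p \<otimes>\<^sub>a q)) =
      mul Z \<bullet> (mul (A \<odot> Z) \<bullet> ?p (A \<odot> A \<odot> Z) \<bullet> (A \<lhd> ?q (A \<odot> Z))) \<bullet> (A \<lhd> A \<lhd> ?g Z) \<bullet> (A \<lhd> ?k Z)"
    unfolding contract_right_def bin_tail_pure[OF p q] Z_def ..
  also have "(mul (A \<odot> Z) \<bullet> ?p (A \<odot> A \<odot> Z) \<bullet> (A \<lhd> ?q (A \<odot> Z))) \<bullet> (A \<lhd> A \<lhd> ?g Z) \<bullet> (A \<lhd> ?k Z) =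
     mul (A \<odot> Z) \<bullet> (?p (A \<odot> A \<odot> Z) \<bullet> (A \<lhd> ?q (A \<odot> Z))) \<bullet> (A \<lhd> A \<lhd> ?g Z) \<bullet> (A \<lhd> ?k Z)"
    by (rule comp_assoc) (rule ty)+
  also have "(?p (A \<odot> A \<odot> Z) \<bullet> (A \<lhd> ?q (A \<odot> Z))) \<bullet> (A \<lhd> A \<lhd> ?g Z) \<bullet> (A \<lhd> ?k Z) =
     ?p (A \<odot> A \<odot> Z) \<bullet> (A \<lhd> ?q (A \<odot> Z)) \<bullet> (A \<lhd> A \<lhd> ?g Z) \<bullet> (A \<lhd> ?k Z)"
    by (rule comp_assoc) (rule ty)+
  also have "(A \<lhd> A \<lhd> ?g Z) \<bullet> (A \<lhd> ?k Z) = A \<lhd> ((A \<lhd> ?g Z) \<bullet> ?k Z)"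
    by (rule tensor_comp_right[symmetric]) (rule ty)+
  also have "(A \<lhd> ?q (A \<odot> Z)) \<bullet> \<dots> = A \<lhd> (?q (A \<odot> Z) \<bullet> (A \<lhd> ?g Z) \<bullet> ?k Z)"
    by (rule tensor_comp_right[symmetric]) (rule ty)+
  also have "mul Z \<bullet> mul (A \<odot> Z) \<bullet> ?p (A \<odot> A \<odot> Z) \<bullet> \<dots> =
     mul Z \<bullet> (A \<lhd> mul Z) \<bullet> ?p (A \<odot> A \<odot> Z) \<bullet> \<dots>"
    by (rule comp_cong_right[OF mul_assoc]) (rule ty)+
  also have "(A \<lhd> mul Z) \<bullet> ?p (A \<odot> A \<odot> Z) \<bullet> (A \<lhd> (?q (A \<odot> Z) \<bullet> (A \<lhd> ?g Z) \<bullet> ?k Z)) =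
     ?p (A \<odot> Z) \<bullet> (A \<lhd> mul Z) \<bullet> (A \<lhd> (?q (A \<odot> Z) \<bullet> (A \<lhd> ?g Z) \<bullet> ?k Z))"
    by (rule comp_cong_right) (simp add: interchange[OF p mul_hom], (rule ty)+)
  also have "(A \<lhd> mul Z) \<bullet> (A \<lhd> (?q (A \<odot> Z) \<bullet> (A \<lhd> ?g Z) \<bullet> ?k Z)) = A \<lhd> (?c *\<^sub>s unt Z)"
    unfolding form_tail[OF k q g, symmetric]
    by (rule tensor_comp_right[symmetric]) (rule ty)+
  also have "?p (A \<odot> Z) \<bullet> (A \<lhd> (?c *\<^sub>s unt Z)) = (A \<lhd> (?c *\<^sub>s unt Z)) \<bullet> ?p Z"
    by (simp add: interchange[OF p hom_scale[OF unt_hom]])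
  also have "mul Z \<bullet> (A \<lhd> (?c *\<^sub>s unt Z)) \<bullet> ?p Z = (?c *\<^sub>s idt C (A \<odot> Z)) \<bullet> ?p Z"
    by (rule comp_collapse_right[OF mult_scaled_unit]) (rule ty hom_scale)+
  also have "\<dots> = ?c *\<^sub>s ?p Z"
    unfolding comp_scale_left[OF idt_hom tensor_hom[OF p idt_hom]] comp_idt_left[OF tensor_hom[OF p idt_hom]] ..
  finally show ?thesis unfolding Z_def .
qed

lemma contract_left_pure:
  assumes k: "\<kappa> \<in> hom C \<I> (A \<odot> A)" and p: "p \<in> hom C A A" and q: "q \<in> hom C A A" and f: "f \<in> hom C A A"
  shows "contract_left \<kappa> f (m \<bullet> (p \<otimes>\<^sub>a q)) = form \<kappa> f p *\<^sub>s (q \<rhd> \<I>)"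
proof -
  define Z where "Z = \<I>"
  let ?k = "copair A A \<kappa>" and ?c = "form \<kappa> f p"
  let ?p = "\<lambda>Z. p \<rhd> Z" and ?q = "\<lambda>Z. q \<rhd> Z" and ?f = "\<lambda>Z. f \<rhd> Z"
  note ty = tail_typing copair_hom[OF k] p q f
  have "contract_left \<kappa> f (m \<bullet> (p \<otimes>\<^sub>a q)) =
      mul Z \<bullet> ?f (A \<odot> Z) \<bullet> (A \<lhd> (mul Z \<bullet> ?p (A \<odot> Z) \<bullet> (A \<lhd> ?q Z))) \<bullet> ?k (A \<odot> Z)"
    unfolding contract_left_def bin_tail_pure[OF p q] Z_def ..
  also have "A \<lhd> (mul Z \<bullet> ?p (A \<odot> Z) \<bullet> (A \<lhd> ?q Z)) =
      (A \<lhd> mul Z) \<bullet> (A \<lhd> (?p (A \<odot> Z) \<bullet> (A \<lhd> ?q Z)))"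
    by (rule tensor_comp_right) (rule ty)+
  also have "(\<dots>) \<bullet> ?k (A \<odot> Z) = (A \<lhd> mul Z) \<bullet> (A \<lhd> (?p (A \<odot> Z) \<bullet> (A \<lhd> ?q Z))) \<bullet> ?k (A \<odot> Z)"
    by (rule comp_assoc) (rule ty)+
  also have "A \<lhd> (?p (A \<odot> Z) \<bullet> (A \<lhd> ?q Z)) = (A \<lhd> ?p (A \<odot> Z)) \<bullet> (A \<lhd> A \<lhd> ?q Z)"
    by (rule tensor_comp_right) (rule ty)+
  also have "(\<dots>) \<bullet> ?k (A \<odot> Z) = (A \<lhd> ?p (A \<odot> Z)) \<bullet> (A \<lhd> A \<lhd> ?q Z) \<bullet> ?k (A \<odot> Z)"
    by (rule comp_assoc) (rule ty)+
  also have "(A \<lhd> A \<lhd> ?q Z) \<bullet> ?k (A \<odot> Z) = ?k (A \<odot> Z) \<bullet> ?q Z"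
    by (rule copair_natural[OF k, symmetric]) (rule ty)+
  also have "?f (A \<odot> Z) \<bullet> (A \<lhd> mul Z) \<bullet> (A \<lhd> ?p (A \<odot> Z)) \<bullet> ?k (A \<odot> Z) \<bullet> ?q Z =
     (A \<lhd> mul Z) \<bullet> ?f (A \<odot> A \<odot> Z) \<bullet> (A \<lhd> ?p (A \<odot> Z)) \<bullet> ?k (A \<odot> Z) \<bullet> ?q Z"
    by (rule comp_cong_right) (simp add: interchange[OF f mul_hom], (rule ty)+)
  also have "mul Z \<bullet> \<dots> =
     mul Z \<bullet> mul (A \<odot> Z) \<bullet> ?f (A \<odot> A \<odot> Z) \<bullet> (A \<lhd> ?p (A \<odot> Z)) \<bullet> ?k (A \<odot> Z) \<bullet> ?q Z"
    by (rule comp_cong_right[OF mul_assoc[symmetric]]) (rule ty)+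
  also have "(A \<lhd> ?p (A \<odot> Z)) \<bullet> ?k (A \<odot> Z) \<bullet> ?q Z = ((A \<lhd> ?p (A \<odot> Z)) \<bullet> ?k (A \<odot> Z)) \<bullet> ?q Z"
    by (rule comp_assoc[symmetric]) (rule ty)+
  also have "?f (A \<odot> A \<odot> Z) \<bullet> \<dots> = (?f (A \<odot> A \<odot> Z) \<bullet> (A \<lhd> ?p (A \<odot> Z)) \<bullet> ?k (A \<odot> Z)) \<bullet> ?q Z"
    by (rule comp_assoc[symmetric]) (rule ty)+
  also have "mul (A \<odot> Z) \<bullet> \<dots> = (?c *\<^sub>s unt (A \<odot> Z)) \<bullet> ?q Z"
    by (rule comp_collapse_right[OF form_tail[OF k f p]]) (rule ty)+
  also have "mul Z \<bullet> \<dots> = (?c *\<^sub>s idt C (A \<odot> Z)) \<bullet> ?q Z"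
    by (rule comp_collapse_right)
      (simp add: comp_scale_right[OF mul_hom unt_hom] mult_unit_left_tail, (rule ty hom_scale)+)
  also have "\<dots> = ?c *\<^sub>s ?q Z"
    unfolding comp_scale_left[OF idt_hom tensor_hom[OF q idt_hom]] comp_idt_left[OF tensor_hom[OF q idt_hom]] ..
  finally show ?thesis unfolding Z_def .
qed

text \<open>With \<kappa> = \<Sum> u \<otimes> v the two sides send a to \<Sum> f(a u) g(v) and
  \<Sum> f(u) g(v a); they agree by the Frobenius relation. For arrows of the form
  \<open>\<rho> x\<close> and \<open>\<rho> y\<close> this becomes the identity
  \<open>form_casimir\<close> in \<open>H\<close>.\<close>

lemma contract_swap:
  assumes k: "casimir \<kappa>" and f: "f \<in> hom C A A" and g: "g \<in> hom C A A"
  shows "contract_right \<kappa> g (f \<bullet> m) = contract_left \<kappa> f (g \<bullet> m)"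
proof -
  define Z where "Z = \<I>"
  let ?k = "copair A A \<kappa>"
  let ?f = "\<lambda>Z. f \<rhd> Z" and ?g = "\<lambda>Z. g \<rhd> Z"
  have kh: "\<kappa> \<in> hom C \<I> (A \<odot> A)"
    and frob: "mul (A \<odot> Z) \<bullet> (A \<lhd> ?k Z) = (A \<lhd> mul Z) \<bullet> ?k (A \<odot> Z)"
    using k by (auto simp: casimir_def)
  note ty = tail_typing copair_hom[OF kh] f g
  have "contract_right \<kappa> g (f \<bullet> m) =
      mul Z \<bullet> (?f (A \<odot> Z) \<bullet> mul (A \<odot> Z)) \<bullet> (A \<lhd> A \<lhd> ?g Z) \<bullet> (A \<lhd> ?k Z)"
    unfolding contract_right_def bin_tail_post[OF f] Z_def ..
  also have "(?f (A \<odot> Z) \<bullet> mul (A \<odot> Z)) \<bullet> (A \<lhd> A \<lhd> ?g Z) \<bullet> (A \<lhd> ?k Z) =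
      ?f (A \<odot> Z) \<bullet> mul (A \<odot> Z) \<bullet> (A \<lhd> A \<lhd> ?g Z) \<bullet> (A \<lhd> ?k Z)"
    by (rule comp_assoc) (rule ty)+
  also have "mul (A \<odot> Z) \<bullet> (A \<lhd> A \<lhd> ?g Z) \<bullet> (A \<lhd> ?k Z) =
      (A \<lhd> ?g Z) \<bullet> mul (A \<odot> Z) \<bullet> (A \<lhd> ?k Z)"
    by (rule comp_cong_right[OF mul_natural]) (rule ty)+
  also have "\<dots> = (A \<lhd> ?g Z) \<bullet> (A \<lhd> mul Z) \<bullet> ?k (A \<odot> Z)" by (simp add: frob)
  also have "\<dots> = (A \<lhd> (?g Z \<bullet> mul Z)) \<bullet> ?k (A \<odot> Z)"
    by (rule comp_collapse_right, rule tensor_comp_right[symmetric]) (rule ty)+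
  finally show ?thesis unfolding contract_left_def bin_tail_post[OF g] Z_def .
qed

lemma contract_right_linear:
  assumes k: "\<kappa> \<in> hom C \<I> (A \<odot> A)" and g: "g \<in> hom C A A"
  shows "linear_on (scale C) (scale C) (hom C (A \<odot> A) A) (contract_right \<kappa> g)"
proof -
  let ?R = "(A \<lhd> A \<lhd> (g \<rhd> \<I>)) \<bullet> (A \<lhd> copair A A \<kappa> \<I>)"
  have R: "?R \<in> hom C (A \<odot> \<I>) (A \<odot> A \<odot> A \<odot> \<I>)"
    by (rule tail_typing copair_hom[OF k] g)+
  have "contract_right \<kappa> g (F + F') = contract_right \<kappa> g F + contract_right \<kappa> g F'"
    if "F \<in> hom C (A \<odot> A) A" "F' \<in> hom C (A \<odot> A) A" for F F'
    using that hat_add[of F "Tens (Obj A) (Obj A)" "Obj A" F' "A \<odot> \<I>"]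
    by (simp add: contract_right_def bin_tail_def[symmetric] comp_add_left[OF bin_tail_hom bin_tail_hom R]
        comp_add_right[OF mul_hom comp_hom[OF bin_tail_hom R] comp_hom[OF bin_tail_hom R]])
  moreover have "contract_right \<kappa> g (a *\<^sub>s F) = a *\<^sub>s contract_right \<kappa> g F"
    if "F \<in> hom C (A \<odot> A) A" for F a
    using that hat_scale[of F "Tens (Obj A) (Obj A)" "Obj A" a "A \<odot> \<I>"]
    by (simp add: contract_right_def bin_tail_def[symmetric] comp_scale_left[OF bin_tail_hom R]
        comp_scale_right[OF mul_hom comp_hom[OF bin_tail_hom R]])
  ultimately show ?thesis by (auto simp: linear_on_def)
qed

lemma contract_left_linear:
  assumes k: "\<kappa> \<in> hom C \<I> (A \<odot> A)" and f: "f \<in> hom C A A"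
  shows "linear_on (scale C) (scale C) (hom C (A \<odot> A) A) (contract_left \<kappa> f)"
proof -
  let ?k = "copair A A \<kappa> (A \<odot> \<I>)" and ?f = "f \<rhd> (A \<odot> \<I>)"
  have K: "?k \<in> hom C (A \<odot> \<I>) (A \<odot> A \<odot> A \<odot> \<I>)" by (rule copair_hom[OF k])
  have F: "?f \<in> hom C (A \<odot> A \<odot> \<I>) (A \<odot> A \<odot> \<I>)" by (rule tensor_hom f idt_hom)+
  note w = tensor_hom[OF idt_hom bin_tail_hom]
  have "contract_left \<kappa> f (G + G') = contract_left \<kappa> f G + contract_left \<kappa> f G'"
    if "G \<in> hom C (A \<odot> A) A" "G' \<in> hom C (A \<odot> A) A" for G G'
    using that hat_add[of G "Tens (Obj A) (Obj A)" "Obj A" G' \<I>]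
    by (simp add: contract_left_def bin_tail_def[symmetric] tensor_add_right[OF idt_hom bin_tail_hom bin_tail_hom]
        comp_add_left[OF w w K] comp_add_right[OF F comp_hom[OF w K] comp_hom[OF w K]]
        comp_add_right[OF mul_hom comp_hom[OF F comp_hom[OF w K]] comp_hom[OF F comp_hom[OF w K]]])
  moreover have "contract_left \<kappa> f (a *\<^sub>s G) = a *\<^sub>s contract_left \<kappa> f G"
    if "G \<in> hom C (A \<odot> A) A" for G a
    using that hat_scale[of G "Tens (Obj A) (Obj A)" "Obj A" a \<I>]
    by (simp add: contract_left_def bin_tail_def[symmetric] tensor_scale_right[OF idt_hom bin_tail_hom]
        comp_scale_left[OF w K] comp_scale_right[OF F comp_hom[OF w K]]
        comp_scale_right[OF mul_hom comp_hom[OF F comp_hom[OF w K]]])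
  ultimately show ?thesis by (auto simp: linear_on_def)
qed

lemma form_linear_left:
  assumes k: "\<kappa> \<in> hom C \<I> (A \<odot> A)" and g: "g \<in> hom C A A"
  shows "linear_on (scale C) (*) (hom C A A) (\<lambda>f. form \<kappa> f g)"
proof -
  have "form \<kappa> (f + f') g = form \<kappa> f g + form \<kappa> f' g" if f: "f \<in> hom C A A" "f' \<in> hom C A A" for f f'
    using f by (intro form_eqI) (simp add: tensor_add_left[OF f g] comp_add_left[OF tensor_hom[OF f(1) g] tensor_hom[OF f(2) g] k]
      comp_add_right[OF m_hom comp_hom[OF tensor_hom[OF f(1) g] k] comp_hom[OF tensor_hom[OF f(2) g] k]]
      form[OF k _ g] scl.scale_left_distrib)
  moreover have "form \<kappa> (a *\<^sub>s f) g = a * form \<kappa> f g" if f: "f \<in> hom C A A" for f a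
    using f by (intro form_eqI) (simp add: tensor_scale_left[OF f g] comp_scale_left[OF tensor_hom[OF f g] k]
      comp_scale_right[OF m_hom comp_hom[OF tensor_hom[OF f g] k]] form[OF k _ g])
  ultimately show ?thesis by (auto simp: linear_on_def)
qed

text \<open>Commutativity of \<open>A\<close> in the form that later exchanges the two legs of a
  coproduct.\<close>

lemma mult_tensor_swap:
  assumes p: "p \<in> hom C A A" and q: "q \<in> hom C A A"
  shows "m \<bullet> (p \<otimes>\<^sub>a q) \<bullet> braid C A A = m \<bullet> (q \<otimes>\<^sub>a p)"
proof -
  have "m \<bullet> (p \<otimes>\<^sub>a q) \<bullet> braid C A A = m \<bullet> braid C A A \<bullet> (q \<otimes>\<^sub>a p)"
    by (simp add: braid_natural[OF q p])
  also have "\<dots> = m \<bullet> (q \<otimes>\<^sub>a p)"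
    by (rule comp_collapse_right[OF commutative]) (rule m_hom braid_hom tensor_hom p q)+
  finally show ?thesis .
qed

lemma form_sym:
  assumes k: "\<kappa> \<in> hom C \<I> (A \<odot> A)" and bk: "braid C A A \<bullet> \<kappa> = \<kappa>"
    and f: "f \<in> hom C A A" and g: "g \<in> hom C A A"
  shows "form \<kappa> f g = form \<kappa> g f"
proof (rule form_eqI)
  note ty = comp_hom m_hom braid_hom tensor_hom f g k
  have "m \<bullet> (f \<otimes>\<^sub>a g) \<bullet> \<kappa> = m \<bullet> (f \<otimes>\<^sub>a g) \<bullet> braid C A A \<bullet> \<kappa>" by (simp add: bk)
  also have "(f \<otimes>\<^sub>a g) \<bullet> braid C A A \<bullet> \<kappa> = ((f \<otimes>\<^sub>a g) \<bullet> braid C A A) \<bullet> \<kappa>"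
    by (rule comp_assoc[symmetric]) (rule ty)+
  also have "m \<bullet> \<dots> = (m \<bullet> (f \<otimes>\<^sub>a g) \<bullet> braid C A A) \<bullet> \<kappa>"
    by (rule comp_assoc[symmetric]) (rule ty)+
  also have "\<dots> = m \<bullet> (g \<otimes>\<^sub>a f) \<bullet> \<kappa>"
    unfolding mult_tensor_swap[OF f g] by (rule comp_assoc) (rule ty)+
  finally show "m \<bullet> (f \<otimes>\<^sub>a g) \<bullet> \<kappa> = form \<kappa> g f *\<^sub>s \<iota>" using form[OF k g f] by simp
qed

end

section \<open>Tensors\<close>

abbreviation "supp \<equiv> Poly_Mapping.keys"

lemma lookup_free_scale: "Poly_Mapping.lookup (free_scale a t) x = a * Poly_Mapping.lookup t x"
  unfolding free_scale_def by (subst map.rep_eq) (simp add: when_def)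

lemma free_vector_space: "vector_space (free_scale :: 'k::field \<Rightarrow> ('x \<Rightarrow>\<^sub>0 'k) \<Rightarrow> ('x \<Rightarrow>\<^sub>0 'k))"
  by unfold_locales (auto intro!: poly_mapping_eqI simp: lookup_free_scale lookup_add algebra_simps)

interpretation fvs: vector_space "free_scale :: 'k::field \<Rightarrow> ('x \<Rightarrow>\<^sub>0 'k) \<Rightarrow> ('x \<Rightarrow>\<^sub>0 'k)"
  by (rule free_vector_space)

context vector_space begin

lemma free_extend_superset:
  assumes "finite S" "supp t \<subseteq> S"
  shows "free_extend scale F t = (\<Sum>x\<in>S. scale (Poly_Mapping.lookup t x) (F x))"
  unfolding free_extend_def using assms by (intro sum.mono_neutral_left) (auto simp: in_keys_iff)

lemma free_extend_add: "free_extend scale F (t + u) = free_extend scale F t + free_extend scale F u"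
proof -
  let ?S = "supp t \<union> supp u"
  have "supp (t + u) \<subseteq> ?S" by (rule keys_add)
  then show ?thesis
    by (simp add: free_extend_superset[of ?S] lookup_add scale_left_distrib sum.distrib)
qed

lemma free_extend_scale: "free_extend scale F (free_scale a t) = scale a (free_extend scale F t)"
proof -
  have "supp (free_scale a t) \<subseteq> supp t"
    by (auto simp: in_keys_iff lookup_free_scale)
  then show ?thesis
    by (simp add: free_extend_superset[of "supp t"] lookup_free_scale scale_sum_right)
qed

lemma free_extend_zero: "free_extend scale F 0 = 0"
  by (simp add: free_extend_def)

lemma free_extend_uminus: "free_extend scale F (- t) = - free_extend scale F t"
  by (simp add: free_extend_def sum_negf)

lemma free_extend_diff: "free_extend scale F (t - u) = free_extend scale F t - free_extend scale F u"
  using free_extend_add[of F t "- u"] by (simp add: free_extend_uminus)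

lemma free_extend_single: "free_extend scale F (Poly_Mapping.single x a) = scale a (F x)"
  by (simp add: free_extend_def)

lemma free_extend_sum: "free_extend scale F (\<Sum>i\<in>I. t i) = (\<Sum>i\<in>I. free_extend scale F (t i))"
  by (induction I rule: infinite_finite_induct) (simp_all add: free_extend_zero free_extend_add)

lemma free_extend_cong:
  "(\<And>x. x \<in> supp t \<Longrightarrow> F x = G x) \<Longrightarrow> free_extend scale F t = free_extend scale G t"
  by (simp add: free_extend_def)

lemma free_extend_nested:
  "free_extend scale F (free_extend free_scale G t) = free_extend scale (\<lambda>x. free_extend scale F (G x)) t"
proof -
  have "free_extend scale F (free_extend free_scale G t) =
    (\<Sum>x\<in>supp t. free_extend scale F (free_scale (Poly_Mapping.lookup t x) (G x)))"
    unfolding free_extend_def[of free_scale] by (rule free_extend_sum)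
  then show ?thesis by (simp add: free_extend_scale free_extend_def[of scale _ t])
qed

lemma free_extend_in_subspace:
  assumes "subspace V" "\<And>x. x \<in> supp t \<Longrightarrow> F x \<in> V"
  shows "free_extend scale F t \<in> V"
  unfolding free_extend_def using assms by (intro subspace_sum subspace_scale) auto

lemma free_extend_zero_fun: "free_extend scale (\<lambda>x. 0) t = 0"
  by (simp add: free_extend_def)

end

lemma free_expand:
  "(\<Sum>x\<in>supp t. free_scale (Poly_Mapping.lookup t x) (basis_elt x)) = t"
proof (rule poly_mapping_eqI)
  fix y
  have "Poly_Mapping.lookup (free_scale (Poly_Mapping.lookup t x) (basis_elt x)) y =
      (if x = y then Poly_Mapping.lookup t y else 0)" for x
    by (simp add: lookup_free_scale lookup_single when_def)
  then show "Poly_Mapping.lookup (\<Sum>x\<in>supp t. free_scale (Poly_Mapping.lookup t x) (basis_elt x)) y =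
      Poly_Mapping.lookup t y"
    by (simp add: lookup_sum sum.delta in_keys_iff)
qed

lemma linear_on_sum:
  assumes "vector_space s" "vector_space s'" "module.subspace s V" "linear_on s s' V f"
    "\<And>i. i \<in> I \<Longrightarrow> g i \<in> V"
  shows "f (\<Sum>i\<in>I. s (a i) (g i)) = (\<Sum>i\<in>I. s' (a i) (f (g i)))"
proof -
  interpret s: vector_space s by fact
  interpret s': vector_space s' by fact
  have z: "f 0 = 0"
    using assms(4) s.subspace_0[OF assms(3)] s.scale_zero_left[of 0] s'.scale_zero_left
    unfolding linear_on_def by metis
  show ?thesis
    using assms(5)
  proof (induction I rule: infinite_finite_induct)
    case (insert i I)
    have "(\<Sum>i\<in>I. s (a i) (g i)) \<in> V"
      using insert.prems by (intro s.subspace_sum s.subspace_scale assms(3)) auto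
    moreover have "s (a i) (g i) \<in> V"
      using insert.prems by (intro s.subspace_scale assms(3)) auto
    ultimately show ?case using insert assms(4) by (simp add: linear_on_def)
  qed (simp_all add: z)
qed

lemma linear_on_free_extend:
  assumes "vector_space s" "vector_space s'" "module.subspace s V" "linear_on s s' V f"
    "\<And>x. x \<in> supp t \<Longrightarrow> F x \<in> V"
  shows "f (free_extend s F t) = free_extend s' (\<lambda>x. f (F x)) t"
  unfolding free_extend_def using linear_on_sum[OF assms(1-4)] assms(5) by blast

lemma linear_on_zero:
  assumes "vector_space s" "vector_space s'" "module.subspace s V" "linear_on s s' V f"
  shows "f 0 = 0"
  using linear_on_sum[OF assms, of "{}"] by simp

section \<open>Multilinear maps and equality of tensors\<close>

definition bilinear_on ::
    "('k \<Rightarrow> 'v \<Rightarrow> 'v) \<Rightarrow> ('k \<Rightarrow> 'w \<Rightarrow> 'w) \<Rightarrow> 'v::plus set \<Rightarrow> ('v \<Rightarrow> 'v \<Rightarrow> 'w::plus) \<Rightarrow> bool" where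
  "bilinear_on s s' V F \<longleftrightarrow>
     (\<forall>y\<in>V. linear_on s s' V (\<lambda>x. F x y)) \<and> (\<forall>x\<in>V. linear_on s s' V (F x))"

text \<open>The universal property of the tensor square: the kernel of the linear extension of
  \<open>F\<close> is a subspace containing the bilinearity relations, hence their span.\<close>

lemma bilinear_on_free_extend:
  assumes s': "vector_space (s' :: 'k::field \<Rightarrow> 'w \<Rightarrow> 'w::ab_group_add)" and F: "bilinear_on s s' V F"
    and tu: "tensor2_eq s V t u"
  shows "free_extend s' (\<lambda>(p, q). F p q) t = free_extend s' (\<lambda>(p, q). F p q) u"
proof -
  interpret s': vector_space s' by fact
  let ?L = "free_extend s' (\<lambda>(p, q). F p q)"
  have K: "fvs.subspace {t. ?L t = 0}"
    by (rule fvs.subspaceI) (simp_all add: s'.free_extend_zero s'.free_extend_add s'.free_extend_scale)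
  have "tensor2_relations s V \<subseteq> {t. ?L t = 0}"
    using F unfolding tensor2_relations_def bilinear_on_def linear_on_def
    by (auto simp: s'.free_extend_diff s'.free_extend_scale s'.free_extend_single)
  then have "module.span free_scale (tensor2_relations s V) \<subseteq> {t. ?L t = 0}"
    by (rule fvs.span_minimal[OF _ K])
  then have "?L (t - u) = 0" using tu unfolding tensor2_eq_def by blast
  then show ?thesis by (simp add: s'.free_extend_diff)
qed

lemma trilinear_on_free_extend:
  assumes s': "vector_space (s' :: 'k::field \<Rightarrow> 'w \<Rightarrow> 'w::ab_group_add)"
    and F1: "\<And>y z. \<lbrakk>y \<in> V; z \<in> V\<rbrakk> \<Longrightarrow> linear_on s s' V (\<lambda>x. F x y z)"
    and F2: "\<And>x z. \<lbrakk>x \<in> V; z \<in> V\<rbrakk> \<Longrightarrow> linear_on s s' V (\<lambda>y. F x y z)"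
    and F3: "\<And>x y. \<lbrakk>x \<in> V; y \<in> V\<rbrakk> \<Longrightarrow> linear_on s s' V (\<lambda>z. F x y z)"
    and tu: "tensor3_eq s V t u"
  shows "free_extend s' (\<lambda>(p, q, r). F p q r) t = free_extend s' (\<lambda>(p, q, r). F p q r) u"
proof -
  interpret s': vector_space s' by fact
  let ?L = "free_extend s' (\<lambda>(p, q, r). F p q r)"
  have K: "fvs.subspace {t. ?L t = 0}"
    by (rule fvs.subspaceI) (simp_all add: s'.free_extend_zero s'.free_extend_add s'.free_extend_scale)
  have "tensor3_relations s V \<subseteq> {t. ?L t = 0}"
    using F1 F2 F3 unfolding tensor3_relations_def linear_on_def
    by (auto simp: s'.free_extend_diff s'.free_extend_scale s'.free_extend_single)
  then have "module.span free_scale (tensor3_relations s V) \<subseteq> {t. ?L t = 0}"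
    by (rule fvs.span_minimal[OF _ K])
  then have "?L (t - u) = 0" using tu unfolding tensor3_eq_def by blast
  then show ?thesis by (simp add: s'.free_extend_diff)
qed

lemma tensor2_eq_refl: "tensor2_eq s V t t"
  by (simp add: tensor2_eq_def fvs.span_zero)

lemma tensor2_eq_sym: "tensor2_eq s V t u \<Longrightarrow> tensor2_eq s V u t"
  unfolding tensor2_eq_def using fvs.span_neg by fastforce

lemma tensor2_eq_trans: "tensor2_eq s V t u \<Longrightarrow> tensor2_eq s V u v \<Longrightarrow> tensor2_eq s V t v"
  unfolding tensor2_eq_def using fvs.span_add by fastforce

lemma tensor2_eq_add:
  "tensor2_eq s V t u \<Longrightarrow> tensor2_eq s V t' u' \<Longrightarrow> tensor2_eq s V (t + t') (u + u')"
  unfolding tensor2_eq_def using fvs.span_add by (fastforce simp: algebra_simps)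

lemma tensor2_eq_scale:
  "tensor2_eq s V t u \<Longrightarrow> tensor2_eq s V (free_scale a t) (free_scale a u)"
  unfolding tensor2_eq_def using fvs.span_scale by (fastforce simp: fvs.scale_right_diff_distrib[symmetric])

lemma tensor2_eq_sum:
  "(\<And>i. i \<in> I \<Longrightarrow> tensor2_eq s V (t i) (u i)) \<Longrightarrow> tensor2_eq s V (\<Sum>i\<in>I. t i) (\<Sum>i\<in>I. u i)"
  by (induction I rule: infinite_finite_induct) (auto intro: tensor2_eq_refl tensor2_eq_add)

lemma tensor2_eq_relation: "t - u \<in> tensor2_relations s V \<Longrightarrow> tensor2_eq s V t u"
  unfolding tensor2_eq_def by (rule fvs.span_base)

locale tensor_square = vector_space s for s :: "'k::field \<Rightarrow> 'v \<Rightarrow> 'v::ab_group_add" +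
  fixes V :: "'v set"
  assumes V: "subspace V"
begin

abbreviation teq (infix "\<approx>" 50) where "t \<approx> u \<equiv> tensor2_eq s V t u"

lemma teq_add_left:
  "\<lbrakk>x \<in> V; x' \<in> V; y \<in> V\<rbrakk> \<Longrightarrow> basis_elt (x + x', y) \<approx> basis_elt (x, y) + basis_elt (x', y)"
  by (rule tensor2_eq_relation, unfold tensor2_relations_def diff_diff_eq[symmetric]) blast

lemma teq_add_right:
  "\<lbrakk>x \<in> V; y \<in> V; y' \<in> V\<rbrakk> \<Longrightarrow> basis_elt (x, y + y') \<approx> basis_elt (x, y) + basis_elt (x, y')"
  by (rule tensor2_eq_relation, unfold tensor2_relations_def diff_diff_eq[symmetric]) blast

lemma teq_scale_left:
  "\<lbrakk>x \<in> V; y \<in> V\<rbrakk> \<Longrightarrow> basis_elt (s a x, y) \<approx> free_scale a (basis_elt (x, y))"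
  by (rule tensor2_eq_relation, unfold tensor2_relations_def) blast

lemma teq_scale_right:
  "\<lbrakk>x \<in> V; y \<in> V\<rbrakk> \<Longrightarrow> basis_elt (x, s a y) \<approx> free_scale a (basis_elt (x, y))"
  by (rule tensor2_eq_relation, unfold tensor2_relations_def) blast

lemma teq_zero: "y \<in> V \<Longrightarrow> basis_elt (0, y) \<approx> 0" "x \<in> V \<Longrightarrow> basis_elt (x, 0) \<approx> 0"
  using teq_scale_left[of 0 y 0] teq_scale_right[of x 0 0] subspace_0[OF V] by simp_all

lemma teq_sum_left:
  assumes "\<And>i. i \<in> I \<Longrightarrow> f i \<in> V" "y \<in> V"
  shows "basis_elt (\<Sum>i\<in>I. s (a i) (f i), y) \<approx> (\<Sum>i\<in>I. free_scale (a i) (basis_elt (f i, y)))"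
  using assms
proof (induction I rule: infinite_finite_induct)
  case (insert i I)
  have t: "(\<Sum>i\<in>I. s (a i) (f i)) \<in> V" "s (a i) (f i) \<in> V"
    using insert.prems by (auto intro!: subspace_sum subspace_scale V)
  have "basis_elt (\<Sum>i\<in>insert i I. s (a i) (f i), y) \<approx>
      basis_elt (s (a i) (f i), y) + basis_elt (\<Sum>i\<in>I. s (a i) (f i), y)"
    unfolding sum.insert[OF insert.hyps] using teq_add_left[OF t(2,1) insert.prems(2)] by simp
  moreover have "\<dots> \<approx> free_scale (a i) (basis_elt (f i, y)) + (\<Sum>i\<in>I. free_scale (a i) (basis_elt (f i, y)))"
    using insert.prems by (intro tensor2_eq_add teq_scale_left insert.IH) auto
  ultimately show ?case unfolding sum.insert[OF insert.hyps] by (rule tensor2_eq_trans)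
qed (simp_all add: teq_zero)

lemma teq_sum_right:
  assumes "\<And>i. i \<in> I \<Longrightarrow> f i \<in> V" "x \<in> V"
  shows "basis_elt (x, \<Sum>i\<in>I. s (a i) (f i)) \<approx> (\<Sum>i\<in>I. free_scale (a i) (basis_elt (x, f i)))"
  using assms
proof (induction I rule: infinite_finite_induct)
  case (insert i I)
  have t: "(\<Sum>i\<in>I. s (a i) (f i)) \<in> V" "s (a i) (f i) \<in> V"
    using insert.prems by (auto intro!: subspace_sum subspace_scale V)
  have "basis_elt (x, \<Sum>i\<in>insert i I. s (a i) (f i)) \<approx>
      basis_elt (x, s (a i) (f i)) + basis_elt (x, \<Sum>i\<in>I. s (a i) (f i))"
    unfolding sum.insert[OF insert.hyps] using teq_add_right[OF insert.prems(2) t(2,1)] by simp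
  moreover have "\<dots> \<approx> free_scale (a i) (basis_elt (x, f i)) + (\<Sum>i\<in>I. free_scale (a i) (basis_elt (x, f i)))"
    using insert.prems by (intro tensor2_eq_add teq_scale_right insert.IH) auto
  ultimately show ?case unfolding sum.insert[OF insert.hyps] by (rule tensor2_eq_trans)
qed (simp_all add: teq_zero)

text \<open>The coefficients \<open>r\<close> may come from any expansion of the first legs over the
  finite set \<open>B\<close>. They are basis coordinates in \<open>teq_normal_form\<close> and
  values of the Casimir form on grouplikes in \<open>teq_detect\<close>.\<close>

lemma teq_collect:
  assumes t: "supp t \<subseteq> V \<times> V" and B: "B \<subseteq> V"
    and r: "\<And>x y. (x, y) \<in> supp t \<Longrightarrow> x = (\<Sum>v\<in>B. s (r x v) v)"
  shows "t \<approx> (\<Sum>v\<in>B. basis_elt (v, free_extend s (\<lambda>(x, y). s (r x v) y) t))"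
proof -
  let ?K = "supp t" and ?c = "Poly_Mapping.lookup t"
  have "t = (\<Sum>k\<in>?K. free_scale (?c k) (basis_elt k))" by (rule free_expand[symmetric])
  also have "\<dots> \<approx> (\<Sum>k\<in>?K. free_scale (?c k) (\<Sum>v\<in>B. free_scale (r (fst k) v) (basis_elt (v, snd k))))"
  proof (intro tensor2_eq_sum tensor2_eq_scale)
    fix k assume k: "k \<in> ?K"
    obtain x y where xy: "k = (x, y)" by (cases k)
    then have "x = (\<Sum>v\<in>B. s (r x v) v)" "y \<in> V" using r k t by auto
    then show "basis_elt k \<approx> (\<Sum>v\<in>B. free_scale (r (fst k) v) (basis_elt (v, snd k)))"
      using teq_sum_left[of B "\<lambda>v. v" y "r x"] B xy by auto
  qed
  also have "(\<Sum>k\<in>?K. free_scale (?c k) (\<Sum>v\<in>B. free_scale (r (fst k) v) (basis_elt (v, snd k)))) =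
      (\<Sum>v\<in>B. \<Sum>k\<in>?K. free_scale (?c k * r (fst k) v) (basis_elt (v, snd k)))"
    by (simp add: fvs.scale_sum_right sum.swap[of _ ?K])
  finally have 1: "t \<approx> (\<Sum>v\<in>B. \<Sum>k\<in>?K. free_scale (?c k * r (fst k) v) (basis_elt (v, snd k)))" .
  have 2: "(\<Sum>v\<in>B. basis_elt (v, \<Sum>k\<in>?K. s (?c k * r (fst k) v) (snd k))) \<approx>
      (\<Sum>v\<in>B. \<Sum>k\<in>?K. free_scale (?c k * r (fst k) v) (basis_elt (v, snd k)))"
    using t B by (intro tensor2_eq_sum teq_sum_right) auto
  have 3: "free_extend s (\<lambda>(x, y). s (r x v) y) t = (\<Sum>k\<in>?K. s (?c k * r (fst k) v) (snd k))" for v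
    by (simp add: free_extend_def case_prod_beta)
  show ?thesis unfolding 3 using 1 2 tensor2_eq_sym tensor2_eq_trans by blast
qed

text \<open>Independent first legs allow comparing second legs coefficientwise. The set
  \<open>S\<close> prescribes vectors that must occur among the first legs: none for the radical of
  the form, and the eigenvector itself in \<open>eigenvector_Gr\<close>.\<close>

lemma teq_normal_form:
  assumes t: "supp t \<subseteq> V \<times> V" and S: "finite S" "S \<subseteq> V" "independent S"
  obtains B w where "finite B" "independent B" "S \<subseteq> B" "B \<subseteq> V" "\<And>v. v \<in> B \<Longrightarrow> w v \<in> V"
    "t \<approx> (\<Sum>v\<in>B. basis_elt (v, w v))"
proof -
  let ?T = "S \<union> fst ` supp t"
  have T: "finite ?T" "?T \<subseteq> V" using S t by auto
  obtain B where B: "S \<subseteq> B" "B \<subseteq> ?T" "independent B" "?T \<subseteq> span B"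
    using maximal_independent_subset_extend[of S ?T] S(3) by auto
  have fB: "finite B" using B(2) T(1) by (rule finite_subset)
  let ?r = "representation B"
  have r: "x = (\<Sum>v\<in>B. s (?r x v) v)" if "(x, y) \<in> supp t" for x y
  proof -
    have "x \<in> span B" using that B(4) by force
    then show ?thesis using sum_representation_eq[OF B(3) _ fB subset_refl] by simp
  qed
  show ?thesis
  proof (rule that[OF fB B(3) B(1)])
    show "B \<subseteq> V" using B(2) T(2) by blast
    show "t \<approx> (\<Sum>v\<in>B. basis_elt (v, free_extend s (\<lambda>(x, y). s (?r x v) y) t))"
      by (rule teq_collect[OF t _ r]) (use B(2) T(2) in auto)
    show "free_extend s (\<lambda>(x, y). s (?r x v) y) t \<in> V" for v
      using t by (intro free_extend_in_subspace V) (auto intro!: subspace_scale V)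
  qed
qed

lemma teq_cong_bilinear:
  assumes "vector_space (s' :: 'k \<Rightarrow> 'w \<Rightarrow> 'w::ab_group_add)" "bilinear_on s s' V F" "t \<approx> (\<Sum>v\<in>B. basis_elt (v, w v))"
  shows "free_extend s' (\<lambda>(p, q). F p q) t = (\<Sum>v\<in>B. F v (w v))"
proof -
  interpret s': vector_space s' by fact
  show ?thesis
    using bilinear_on_free_extend[OF assms] by (simp add: s'.free_extend_sum s'.free_extend_single)
qed

end

section \<open>Common eigenvectors\<close>

text \<open>The vector p(T) v, written through iterates because \<open>T\<close> will be assumed
  linear only on a subspace.\<close>

definition orbit_eval :: "('k::field \<Rightarrow> 'v \<Rightarrow> 'v) \<Rightarrow> ('v \<Rightarrow> 'v) \<Rightarrow> 'v \<Rightarrow> 'k poly \<Rightarrow> 'v::ab_group_add" where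
  "orbit_eval s T v p = (\<Sum>i\<le>degree p. s (coeff p i) ((T ^^ i) v))"

context vector_space begin

lemma orbit_eval_bound:
  assumes "degree p \<le> N"
  shows "orbit_eval scale T v p = (\<Sum>i\<le>N. scale (coeff p i) ((T ^^ i) v))"
  unfolding orbit_eval_def using assms by (intro sum.mono_neutral_left) (auto simp: coeff_eq_0)

lemma orbit_eval_add: "orbit_eval scale T v (p + q) = orbit_eval scale T v p + orbit_eval scale T v q"
proof -
  define N where "N = max (degree p) (degree q)"
  have "degree p \<le> N" "degree q \<le> N" "degree (p + q) \<le> N"
    by (auto simp: N_def intro: degree_add_le)
  then show ?thesis by (simp add: orbit_eval_bound[of _ N] scale_left_distrib sum.distrib)
qed

lemma orbit_eval_smult: "orbit_eval scale T v (smult a p) = scale a (orbit_eval scale T v p)"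
  using orbit_eval_bound[OF degree_smult_le[of a p]] by (simp add: orbit_eval_def scale_sum_right)

lemma orbit_eval_monom: "orbit_eval scale T v (monom a n) = scale a ((T ^^ n) v)"
proof -
  have "orbit_eval scale T v (monom a n) = (\<Sum>i\<le>n. scale (coeff (monom a n) i) ((T ^^ i) v))"
    by (rule orbit_eval_bound) (rule degree_monom_le)
  also have "\<dots> = (\<Sum>i\<le>n. if i = n then scale a ((T ^^ n) v) else 0)"
    by (rule sum.cong) auto
  finally show ?thesis by simp
qed

lemma orbit_eval_sum: "orbit_eval scale T v (\<Sum>i\<in>I. p i) = (\<Sum>i\<in>I. orbit_eval scale T v (p i))"
  by (induction I rule: infinite_finite_induct) (simp_all add: orbit_eval_add orbit_eval_def[of _ _ _ 0])

lemma orbit_eval_in: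
  assumes W: "subspace W" and T: "\<And>w. w \<in> W \<Longrightarrow> T w \<in> W" and v: "v \<in> W"
  shows "(T ^^ i) v \<in> W" "orbit_eval scale T v p \<in> W"
proof -
  show *: "(T ^^ i) v \<in> W" for i using T v by (induction i) auto
  show "orbit_eval scale T v p \<in> W"
    unfolding orbit_eval_def by (intro subspace_sum subspace_scale W *)
qed

lemma orbit_eval_pCons_0:
  assumes W: "subspace W" and T: "\<And>w. w \<in> W \<Longrightarrow> T w \<in> W" "linear_on scale scale W T" and v: "v \<in> W"
  shows "orbit_eval scale T v (pCons 0 p) = T (orbit_eval scale T v p)"
proof -
  have "degree (pCons 0 p) \<le> Suc (degree p)" by (simp add: degree_pCons_le)
  then have "orbit_eval scale T v (pCons 0 p) =
      (\<Sum>i\<le>Suc (degree p). scale (coeff (pCons 0 p) i) ((T ^^ i) v))"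
    by (rule orbit_eval_bound)
  also have "\<dots> = (\<Sum>i\<le>degree p. scale (coeff p i) (T ((T ^^ i) v)))"
    unfolding sum.atMost_Suc_shift by simp
  also have "\<dots> = T (orbit_eval scale T v p)"
    unfolding orbit_eval_def
    by (rule linear_on_sum[OF vector_space_axioms vector_space_axioms W T(2), symmetric])
      (rule orbit_eval_in(1)[where T = T, OF W T(1) v])
  finally show ?thesis .
qed

text \<open>All iterates lie in a space spanned by \<open>card S\<close> vectors. Either two of them
  coincide, which gives a difference of two monomials, or the first \<open>card S + 1\<close> are
  distinct and hence dependent.\<close>

lemma orbit_eval_annihilated:
  assumes S: "finite S" "range (\<lambda>i. (T ^^ i) v) \<subseteq> span S"
  shows "\<exists>p. p \<noteq> 0 \<and> orbit_eval scale T v p = 0"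
proof (cases "inj (\<lambda>i. (T ^^ i) v)")
  case False
  then obtain i j where ij: "i \<noteq> j" "(T ^^ i) v = (T ^^ j) v" by (auto simp: inj_on_def)
  let ?p = "monom (1::'a) i + smult (- 1) (monom 1 j)"
  have "coeff ?p i \<noteq> 0" using ij(1) by simp
  then have "?p \<noteq> 0" by (metis coeff_0)
  moreover have "orbit_eval scale T v ?p = 0"
    unfolding orbit_eval_add orbit_eval_smult orbit_eval_monom using ij(2) by simp
  ultimately show ?thesis by blast
next
  case inj: True
  let ?f = "\<lambda>i. (T ^^ i) v" and ?N = "card S"
  have "card (?f ` {..?N}) = Suc ?N"
    using inj by (subst card_image) (auto intro: inj_on_subset)
  then have "\<not> independent (?f ` {..?N})"
    using independent_span_bound[OF S(1), of "?f ` {..?N}"] S(2) by auto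
  then obtain u where u: "\<exists>w\<in>?f ` {..?N}. u w \<noteq> 0" "(\<Sum>w\<in>?f ` {..?N}. scale (u w) w) = 0"
    using dependent_finite[of "?f ` {..?N}"] by auto
  let ?p = "\<Sum>i\<le>?N. monom (u (?f i)) i"
  obtain j where j: "j \<le> ?N" "u (?f j) \<noteq> 0" using u(1) by auto
  have "coeff ?p j = (\<Sum>i\<le>?N. if i = j then u (?f j) else 0)"
    unfolding coeff_sum by (rule sum.cong) auto
  then have "coeff ?p j \<noteq> 0" using j by simp
  then have "?p \<noteq> 0" by (metis coeff_0)
  moreover have "orbit_eval scale T v ?p = (\<Sum>i\<le>?N. scale (u (?f i)) (?f i))"
    unfolding orbit_eval_sum orbit_eval_monom ..
  moreover have "\<dots> = 0"
    using u(2) inj by (subst (asm) sum.reindex) (auto intro: inj_on_subset simp: o_def)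
  ultimately show ?thesis by auto
qed

end

text \<open>Let p be nonzero of least degree with p(T) v = 0. It is not constant, so it has a root c
  and factors as (X - c) q; by minimality q(T) v is nonzero, and it is an eigenvector for c.\<close>

lemma eigenvector_exists:
  fixes s :: "'k::alg_closed_field \<Rightarrow> 'v \<Rightarrow> 'v::ab_group_add"
  assumes "vector_space s" and W: "module.subspace s W" and S: "finite S" "W \<subseteq> module.span s S"
    and T: "\<And>w. w \<in> W \<Longrightarrow> T w \<in> W" "linear_on s s W T" and v: "v \<in> W" "v \<noteq> 0"
  shows "\<exists>n\<in>W. n \<noteq> 0 \<and> (\<exists>c. T n = s c n)"
proof -
  interpret vector_space s by fact
  let ?e = "orbit_eval s T v"
  have "range (\<lambda>i. (T ^^ i) v) \<subseteq> span S" using orbit_eval_in(1)[where T = T, OF W T(1) v(1)] S(2) by blast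
  then have "\<exists>p. p \<noteq> 0 \<and> ?e p = 0" by (rule orbit_eval_annihilated[OF S(1)])
  then obtain p where p: "p \<noteq> 0" "?e p = 0" and min: "\<And>q. q \<noteq> 0 \<Longrightarrow> degree q < degree p \<Longrightarrow> ?e q \<noteq> 0"
    using ex_has_least_nat[of "\<lambda>p. p \<noteq> 0 \<and> ?e p = 0" _ degree] by (metis not_le)
  have "degree p > 0"
  proof (rule ccontr)
    assume "\<not> degree p > 0"
    then obtain a where a: "p = [:a:]" by (auto elim: degree_eq_zeroE)
    then show False using p v by (simp add: orbit_eval_def)
  qed
  then obtain c where "poly p c = 0" using alg_closed_imp_poly_has_root by blast
  then obtain q where q: "p = [:- c, 1:] * q" unfolding poly_eq_0_iff_dvd by (auto elim: dvdE)
  have q0: "q \<noteq> 0" using p(1) q by auto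
  have "degree p = Suc (degree q)" unfolding q using q0 by (subst degree_mult_eq) auto
  then have n: "?e q \<noteq> 0" using min[OF q0] by simp
  have pc: "?e (pCons 0 q) = T (?e q)"
    by (rule orbit_eval_pCons_0[OF W]) (use T v in auto)
  have pe: "p = smult (- c) q + pCons 0 q" by (simp add: q)
  have "?e (smult (- c) q + pCons 0 q) = 0" by (simp only: pe[symmetric] p(2))
  then have "s (- c) (?e q) + T (?e q) = 0"
    unfolding orbit_eval_add orbit_eval_smult pc .
  then have "T (?e q) = s c (?e q)" by (simp add: add_eq_0_iff)
  then show ?thesis using n orbit_eval_in(2)[where T = T, OF W T(1) v(1)] by blast
qed

text \<open>Induction on the dimension of \<open>W\<close>. If every operator is scalar on
  \<open>W\<close>, any nonzero vector will do; otherwise some operator has a proper nonzero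
  eigenspace in \<open>W\<close>, and this is stable under all operators commuting with it.\<close>

lemma common_eigenvector_exists:
  fixes s :: "'k::alg_closed_field \<Rightarrow> 'v \<Rightarrow> 'v::ab_group_add"
  assumes "vector_space s" and "module.subspace s W" and "finite S" and "W \<subseteq> module.span s S" and "W \<noteq> {0}"
    and "\<And>T w. T \<in> \<T> \<Longrightarrow> w \<in> W \<Longrightarrow> T w \<in> W" and "\<And>T. T \<in> \<T> \<Longrightarrow> linear_on s s W T"
    and "\<And>T U w. \<lbrakk>T \<in> \<T>; U \<in> \<T>; w \<in> W\<rbrakk> \<Longrightarrow> T (U w) = U (T w)"
  shows "\<exists>n\<in>W. n \<noteq> 0 \<and> (\<forall>T\<in>\<T>. \<exists>c. T n = s c n)"
  using assms(2,4-8)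
proof (induction "vector_space.dim s W" arbitrary: W rule: less_induct)
  case less
  interpret vector_space s by fact
  note W = less.prems(1) and WS = less.prems(2) and T = less.prems(4) and lin = less.prems(5) and comm = less.prems(6)
  obtain v where v: "v \<in> W" "v \<noteq> 0" using less.prems(3) subspace_0[OF W] by auto
  show ?case
  proof (cases "\<forall>T\<in>\<T>. \<exists>c. \<forall>w\<in>W. T w = s c w")
    case True
    then show ?thesis using v by blast
  next
    case False
    then obtain T where T0: "T \<in> \<T>" "\<And>c. \<exists>w\<in>W. T w \<noteq> s c w" by blast
    obtain n c where n: "n \<in> W" "n \<noteq> 0" "T n = s c n"
      using eigenvector_exists[OF \<open>vector_space s\<close> W assms(3) WS T[OF T0(1)] lin[OF T0(1)] v] by blast
    define E where "E = {w \<in> W. T w = s c w}"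
    have EW: "E \<subseteq> W" by (auto simp: E_def)
    have E: "subspace E"
      using W lin[OF T0(1)] linear_on_zero[OF assms(1) assms(1) W lin[OF T0(1)]]
      by (auto simp: E_def subspace_def linear_on_def scale_right_distrib scale_left_commute)
    \<comment> \<open>Strict decrease of the dimension is seen by extending a basis of the
      eigenspace to one of \<open>W\<close>, which is finite because \<open>W\<close> lies in the
      span of \<open>S\<close>.\<close>
    obtain b where b: "b \<subseteq> E" "independent b" "E \<subseteq> span b" by (rule maximal_independent_subset)
    obtain b' where b': "b \<subseteq> b'" "b' \<subseteq> W" "independent b'" "W \<subseteq> span b'"
      using maximal_independent_subset_extend[OF subset_trans[OF b(1) EW] b(2)] by blast
    have "b' \<subseteq> span S" using b'(2) WS by blast
    then have "finite b'" using independent_span_bound[OF assms(3) b'(3)] by blast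
    moreover have "b \<noteq> b'"
    proof
      assume "b = b'"
      then have "W \<subseteq> E" using b'(4) span_minimal[OF b(1) E] by blast
      then show False using T0(2)[of c] by (auto simp: E_def)
    qed
    ultimately have "card b < card b'" using b'(1) by (intro psubset_card_mono) auto
    then have dim: "dim E < dim W" using basis_card_eq_dim[OF b(1,3,2)] basis_card_eq_dim[OF b'(2,4,3)] by simp
    have "\<exists>n\<in>E. n \<noteq> 0 \<and> (\<forall>T\<in>\<T>. \<exists>c. T n = s c n)"
    proof (rule less.hyps[OF dim E])
      show "E \<subseteq> span S" using EW WS by blast
      show "E \<noteq> {0}" using n by (auto simp: E_def)
      show "U w \<in> E" if "U \<in> \<T>" "w \<in> E" for U w
        using that T comm[OF T0(1), of U w] lin[of U] by (auto simp: E_def linear_on_def)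
      show "linear_on s s E U" if "U \<in> \<T>" for U
        using lin[OF that] EW unfolding linear_on_def by blast
      show "T (U w) = U (T w)" if "T \<in> \<T>" "U \<in> \<T>" "w \<in> E" for T U w
        using comm that EW by blast
    qed
    then show ?thesis using EW by blast
  qed
qed

section \<open>Hopf algebras with a Casimir form\<close>

context hopf_algebra begin

abbreviation "V \<equiv> hcarrier H"
abbreviation hs (infixr "*h" 75) where "a *h x \<equiv> hscale H a x"
abbreviation counit ("\<epsilon>") where "\<epsilon> \<equiv> hcounit H"
abbreviation comult ("\<Delta>") where "\<Delta> \<equiv> hcomult H"
abbreviation "hsum \<equiv> free_extend (hscale H)"

lemma comult_keysD: "x \<in> V \<Longrightarrow> (p, q) \<in> supp (\<Delta> x) \<Longrightarrow> p \<in> V \<and> q \<in> V"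
  using comult_closed by blast

lemma carrier_scale: "x \<in> V \<Longrightarrow> a *h x \<in> V"
  using carrier_subspace vector_space_H by (simp add: module.subspace_def module_iff_vector_space)

end

text \<open>For an action on \<open>A\<close> the form is given by \<open>m (\<rho> x \<otimes> \<rho> y) \<kappa> = B x y \<iota>\<close>.\<close>

locale hopf_form = hopf_algebra H
  for H :: "('k::field, 'h::ab_group_add, 'z) hopf_scheme" +
  fixes B :: "'h \<Rightarrow> 'h \<Rightarrow> 'k"
  assumes form_bilinear: "bilinear_on (hscale H) (*) V B"
    and form_commute: "\<lbrakk>x \<in> V; y \<in> V\<rbrakk> \<Longrightarrow> B x y = B y x"
    and form_casimir: "\<lbrakk>x \<in> V; y \<in> V\<rbrakk> \<Longrightarrow>
      hsum (\<lambda>(p, q). B q y *h p) (\<Delta> x) =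
      hsum (\<lambda>(p, q). B x p *h q) (\<Delta> y)"
    and form_counit: "x \<in> V \<Longrightarrow> free_extend (*) (\<lambda>(p, q). B p q) (\<Delta> x) = \<epsilon> x"
    and form_flip: "\<lbrakk>x \<in> V; y \<in> V\<rbrakk> \<Longrightarrow>
      hsum (\<lambda>(p, q). B q y *h p) (\<Delta> x) =
      hsum (\<lambda>(p, q). B p y *h q) (\<Delta> x)"
begin

sublocale hvs: tensor_square "hscale H" V
  unfolding tensor_square_def tensor_square_axioms_def
  using vector_space_H carrier_subspace by blast

lemma field_vector_space: "vector_space ((*) :: 'k \<Rightarrow> 'k \<Rightarrow> 'k)"
  by unfold_locales (simp_all add: algebra_simps)

text \<open>The convolution product of endomorphisms of \<open>A\<close>, transported to \<open>H\<close>.\<close>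

definition prd :: "'h \<Rightarrow> 'h \<Rightarrow> 'h" where
  "prd x y = hsum (\<lambda>(p, q). B q y *h p) (\<Delta> x)"

lemma V_add: "x \<in> V \<Longrightarrow> y \<in> V \<Longrightarrow> x + y \<in> V"
  and V_zero: "0 \<in> V"
  using hvs.V by (auto simp: hvs.subspace_def)

lemma form_lin:
  assumes "y \<in> V"
  shows "linear_on (hscale H) (*) V (\<lambda>x. B x y)" "linear_on (hscale H) (*) V (B y)"
  using form_bilinear assms by (auto simp: bilinear_on_def)

lemma form_simps:
  assumes "x \<in> V" "y \<in> V" "z \<in> V"
  shows "B (x + y) z = B x z + B y z" "B z (x + y) = B z x + B z y"
    "B (a *h x) z = a * B x z" "B z (a *h x) = a * B z x"
  using form_lin[OF assms(3)] assms by (auto simp: linear_on_def)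

lemma form_zero: "x \<in> V \<Longrightarrow> B x 0 = 0" "x \<in> V \<Longrightarrow> B 0 x = 0"
  using form_simps(3,4)[of 0 0 x 0] V_zero by auto

lemma prd_closed: "x \<in> V \<Longrightarrow> prd x y \<in> V"
  unfolding prd_def by (rule hvs.free_extend_in_subspace[OF hvs.V]) (auto dest: comult_keysD intro: carrier_scale)

lemma prd_right: "x \<in> V \<Longrightarrow> y \<in> V \<Longrightarrow> prd x y = hsum (\<lambda>(p, q). B x p *h q) (\<Delta> y)"
  unfolding prd_def by (rule form_casimir)

text \<open>The contracted cocommutativity \<open>form_flip\<close> lets \<open>B\<close> act on the
  other leg of \<open>\<Delta> x\<close>; after using the symmetry of \<open>B\<close> this is the
  second description, \<open>prd_right\<close>, of the opposite product.\<close>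

lemma prd_commute:
  assumes "x \<in> V" "y \<in> V" shows "prd x y = prd y x"
proof -
  have "prd x y = hsum (\<lambda>(p, q). B p y *h q) (\<Delta> x)"
    unfolding prd_def by (rule form_flip[OF assms])
  also have "\<dots> = hsum (\<lambda>(p, q). B y p *h q) (\<Delta> x)"
    by (rule hvs.free_extend_cong) (auto simp: form_commute[OF assms(2)] dest: comult_keysD[OF assms(1)])
  finally show ?thesis using prd_right assms by simp
qed

lemma prd_linear: assumes x: "x \<in> V" shows "linear_on (hscale H) (hscale H) V (prd x)"
proof -
  have "prd x (y + z) = prd x y + prd x z" if "y \<in> V" "z \<in> V" for y z
  proof -
    have "prd x (y + z) = hsum (\<lambda>(p, q). B q y *h p + B q z *h p) (\<Delta> x)"
      unfolding prd_def
      by (rule hvs.free_extend_cong) (use that comult_keysD[OF x] in \<open>auto simp: form_simps hvs.scale_left_distrib\<close>)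
    then show ?thesis by (simp add: prd_def free_extend_def case_prod_beta hvs.scale_right_distrib sum.distrib)
  qed
  moreover have "prd x (a *h y) = a *h prd x y" if "y \<in> V" for y a
  proof -
    have "prd x (a *h y) = hsum (\<lambda>(p, q). a *h (B q y *h p)) (\<Delta> x)"
      unfolding prd_def
      by (rule hvs.free_extend_cong) (use that comult_keysD[OF x] in \<open>auto simp: form_simps\<close>)
    then show ?thesis
      by (simp add: prd_def free_extend_def case_prod_beta hvs.scale_sum_right mult_ac)
  qed
  ultimately show ?thesis by (simp add: linear_on_def)
qed

lemma prd_free_extend:
  assumes "x \<in> V" "\<And>k. k \<in> supp t \<Longrightarrow> F k \<in> V"
  shows "prd x (hsum F t) = hsum (\<lambda>k. prd x (F k)) t"
  by (rule linear_on_free_extend[OF vector_space_H vector_space_H hvs.V prd_linear[OF assms(1)] assms(2)])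

lemma form_free_extend:
  assumes "x \<in> V" "\<And>k. k \<in> supp t \<Longrightarrow> F k \<in> V"
  shows "B x (hsum F t) = free_extend (*) (\<lambda>k. B x (F k)) t"
  by (rule linear_on_free_extend[OF vector_space_H field_vector_space hvs.V form_lin(2)[OF assms(1)] assms(2)])

lemma counit_free_extend:
  assumes "\<And>k. k \<in> supp t \<Longrightarrow> F k \<in> V"
  shows "\<epsilon> (hsum F t) = free_extend (*) (\<lambda>k. \<epsilon> (F k)) t"
  by (rule linear_on_free_extend[OF vector_space_H field_vector_space hvs.V counit_linear assms])

lemma counit_scale: "x \<in> V \<Longrightarrow> \<epsilon> (a *h x) = a * \<epsilon> x"
  using counit_linear by (simp add: linear_on_def)

text \<open>Pulling the counit through the contraction leaves the counit axiom inside
  \<open>B\<close>. The form is thus recovered from the product as a trace form, so an element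
  annihilated by all multiplications lies in its radical.\<close>

lemma counit_prd: assumes x: "x \<in> V" and y: "y \<in> V" shows "\<epsilon> (prd x y) = B x y"
proof -
  have "\<epsilon> (prd x y) = free_extend (*) (\<lambda>k. \<epsilon> ((\<lambda>(p, q). B q y *h p) k)) (\<Delta> x)"
    unfolding prd_def by (rule counit_free_extend) (use comult_keysD[OF x] carrier_scale in auto)
  also have "\<dots> = free_extend (*) (\<lambda>k. B y ((\<lambda>(p, q). \<epsilon> p *h q) k)) (\<Delta> x)"
    by (rule vector_space.free_extend_cong[OF field_vector_space])
      (use y in \<open>auto simp: counit_scale form_simps form_commute[OF y] dest: comult_keysD[OF x]\<close>)
  also have "\<dots> = B y (hsum (\<lambda>(p, q). \<epsilon> p *h q) (\<Delta> x))"
    by (rule form_free_extend[symmetric]) (use comult_keysD[OF x] y carrier_scale in auto)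
  finally show ?thesis using counit_left[OF x] form_commute[OF x y] by simp
qed

text \<open>Associativity and commutativity in one identity. Up to commuting two factors, both sides
  are \<Sum> B(x, a) B(c, y) b over the iterated coproduct a \<otimes> b \<otimes> c of
  \<open>z\<close>, bracketed in the two ways that \<open>coassoc\<close> identifies. It says that
  all multiplications commute.\<close>

lemma prd_left_commute:
  assumes x: "x \<in> V" and y: "y \<in> V" and z: "z \<in> V"
  shows "prd x (prd y z) = prd y (prd x z)"
proof -
  let ?e = "hsum" and ?T = "\<lambda>a b c. (B x a * B c y) *h b"
  let ?l = "free_extend free_scale (\<lambda>(p, q). free_extend free_scale (\<lambda>(p', p''). basis_elt (p', p'', q)) (\<Delta> p)) (\<Delta> z)"
  let ?r = "free_extend free_scale (\<lambda>(p, q). free_extend free_scale (\<lambda>(q', q''). basis_elt (p, q', q'')) (\<Delta> q)) (\<Delta> z)"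
  have "?e (\<lambda>(a, b, c). ?T a b c) ?l = ?e (\<lambda>(a, b, c). ?T a b c) ?r"
  proof (rule trilinear_on_free_extend[OF vector_space_H _ _ _ coassoc[OF z]])
    fix u v assume "u \<in> V" "v \<in> V"
    then show "linear_on (hscale H) (hscale H) V (\<lambda>a. ?T a u v)"
      and "linear_on (hscale H) (hscale H) V (\<lambda>b. ?T u b v)"
      and "linear_on (hscale H) (hscale H) V (\<lambda>c. ?T u v c)"
      using x y by (auto simp: linear_on_def form_simps algebra_simps)
  qed
  moreover have "?e (\<lambda>(a, b, c). ?T a b c) ?l = prd x (prd z y)"
  proof -
    have "?e (\<lambda>(a, b, c). ?T a b c) ?l =
        ?e (\<lambda>(p, q). ?e (\<lambda>(p', p''). ?T p' p'' q) (\<Delta> p)) (\<Delta> z)"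
      by (simp add: hvs.free_extend_nested hvs.free_extend_single case_prod_unfold)
    also have "\<dots> = ?e (\<lambda>k. prd x ((\<lambda>(p, q). B q y *h p) k)) (\<Delta> z)"
    proof (rule hvs.free_extend_cong)
      fix k assume k: "k \<in> supp (\<Delta> z)"
      obtain p q where pq: "k = (p, q)" by (cases k)
      have p: "p \<in> V" "q \<in> V" using k pq comult_keysD[OF z] by auto
      have "prd x (B q y *h p) = B q y *h prd x p" using prd_linear[OF x] p by (simp add: linear_on_def)
      also have "\<dots> = B q y *h ?e (\<lambda>(p', p''). B x p' *h p'') (\<Delta> p)" using prd_right[OF x p(1)] by simp
      also have "\<dots> = ?e (\<lambda>(p', p''). ?T p' p'' q) (\<Delta> p)"
        by (simp add: free_extend_def case_prod_beta hvs.scale_sum_right mult_ac)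
      finally show "(\<lambda>(p, q). ?e (\<lambda>(p', p''). ?T p' p'' q) (\<Delta> p)) k = prd x ((\<lambda>(p, q). B q y *h p) k)"
        by (simp add: pq)
    qed
    also have "\<dots> = prd x (prd z y)"
      unfolding prd_def[of z y] by (rule prd_free_extend[symmetric]) (use x comult_keysD[OF z] carrier_scale in auto)
    finally show ?thesis .
  qed
  moreover have "?e (\<lambda>(a, b, c). ?T a b c) ?r = prd y (prd x z)"
  proof -
    have "?e (\<lambda>(a, b, c). ?T a b c) ?r =
        ?e (\<lambda>(p, q). ?e (\<lambda>(q', q''). ?T p q' q'') (\<Delta> q)) (\<Delta> z)"
      by (simp add: hvs.free_extend_nested hvs.free_extend_single case_prod_unfold)
    also have "\<dots> = ?e (\<lambda>k. prd y ((\<lambda>(p, q). B x p *h q) k)) (\<Delta> z)"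
    proof (rule hvs.free_extend_cong)
      fix k assume k: "k \<in> supp (\<Delta> z)"
      obtain p q where pq: "k = (p, q)" by (cases k)
      have p: "p \<in> V" "q \<in> V" using k pq comult_keysD[OF z] by auto
      have "prd y (B x p *h q) = B x p *h prd q y"
        using prd_linear[OF y] p prd_commute[OF y p(2)] by (simp add: linear_on_def)
      also have "\<dots> = ?e (\<lambda>(q', q''). ?T p q' q'') (\<Delta> q)"
        by (simp add: prd_def free_extend_def case_prod_beta hvs.scale_sum_right mult_ac)
      finally show "(\<lambda>(p, q). ?e (\<lambda>(q', q''). ?T p q' q'') (\<Delta> q)) k = prd y ((\<lambda>(p, q). B x p *h q) k)"
        by (simp add: pq)
    qed
    also have "\<dots> = prd y (prd x z)"
      unfolding prd_right[OF x z] by (rule prd_free_extend[symmetric]) (use y comult_keysD[OF z] carrier_scale in auto)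
    finally show ?thesis .
  qed
  ultimately show ?thesis using prd_commute[OF y z] by simp
qed

lemma bilinear_prd: "y \<in> V \<Longrightarrow> bilinear_on (hscale H) (hscale H) V (\<lambda>p q. B q y *h p)"
  by (auto simp: bilinear_on_def linear_on_def form_simps algebra_simps)

lemma bilinear_counit_left: "bilinear_on (hscale H) (hscale H) V (\<lambda>p q. \<epsilon> p *h q)"
  using counit_linear by (auto simp: bilinear_on_def linear_on_def algebra_simps)

lemma bilinear_counit_right: "bilinear_on (hscale H) (hscale H) V (\<lambda>p q. \<epsilon> q *h p)"
  using counit_linear by (auto simp: bilinear_on_def linear_on_def algebra_simps)

text \<open>If \<open>y\<close> lies in the radical, expanding the first legs of \<open>\<Delta> y\<close> in independent
  vectors puts the second legs into the radical. Hence the counit, which is the form applied to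
  the coproduct, vanishes on the radical, and the counit axiom shows that the radical is zero.\<close>

lemma form_nondegenerate:
  assumes y: "y \<in> V" and rad: "\<And>x. x \<in> V \<Longrightarrow> B x y = 0"
  shows "y = 0"
proof -
  have *: "\<exists>D w. finite D \<and> D \<subseteq> V \<and> (\<forall>v\<in>D. w v \<in> V \<and> (\<forall>x\<in>V. B (w v) x = 0)) \<and>
      hvs.teq (\<Delta> y) (\<Sum>v\<in>D. basis_elt (v, w v))"
    if y: "y \<in> V" and rad: "\<And>x. x \<in> V \<Longrightarrow> B x y = 0" for y
  proof -
    obtain D w where D: "finite D" "hvs.independent D" "{} \<subseteq> D" "D \<subseteq> V" "\<And>v. v \<in> D \<Longrightarrow> w v \<in> V"
      and eq: "hvs.teq (\<Delta> y) (\<Sum>v\<in>D. basis_elt (v, w v))"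
      by (rule hvs.teq_normal_form[OF comult_closed[OF y] finite.emptyI empty_subsetI hvs.independent_empty]) (rule that)
    have "B (w v) x = 0" if v: "v \<in> D" and x: "x \<in> V" for v x
    proof -
      have "prd y x = (\<Sum>v\<in>D. B (w v) x *h v)"
        unfolding prd_def by (rule hvs.teq_cong_bilinear[OF vector_space_H bilinear_prd[OF x] eq])
      moreover have "prd y x = 0"
      proof -
        have "prd x y = hsum (\<lambda>k. 0) (\<Delta> x)"
          unfolding prd_def by (rule hvs.free_extend_cong) (use comult_keysD[OF x] rad in auto)
        then show ?thesis using prd_commute[OF y x] by (simp add: hvs.free_extend_zero_fun)
      qed
      ultimately show ?thesis
        using D(2) v hvs.dependent_finite[OF D(1)] by auto
    qed
    then show ?thesis by (intro exI[of _ D] exI[of _ w] conjI ballI D eq)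
  qed
  have rad_counit: "\<epsilon> y = 0" if y: "y \<in> V" and rad: "\<And>x. x \<in> V \<Longrightarrow> B x y = 0" for y
  proof -
    obtain D w where D: "D \<subseteq> V" "\<And>v. v \<in> D \<Longrightarrow> w v \<in> V" "\<And>v x. v \<in> D \<Longrightarrow> x \<in> V \<Longrightarrow> B (w v) x = 0"
      and eq: "hvs.teq (\<Delta> y) (\<Sum>v\<in>D. basis_elt (v, w v))"
      by (rule exE[OF *[OF y]], rule rad, assumption, elim exE conjE, rule that, auto)
    have "\<epsilon> y = (\<Sum>v\<in>D. B v (w v))"
      unfolding form_counit[OF y, symmetric] by (rule hvs.teq_cong_bilinear[OF field_vector_space form_bilinear eq])
    also have "\<dots> = 0" using D form_commute by (intro sum.neutral) (metis subsetD)
    finally show ?thesis .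
  qed
  obtain D w where D: "D \<subseteq> V" "\<And>v. v \<in> D \<Longrightarrow> w v \<in> V" "\<And>v x. v \<in> D \<Longrightarrow> x \<in> V \<Longrightarrow> B (w v) x = 0"
    and eq: "hvs.teq (\<Delta> y) (\<Sum>v\<in>D. basis_elt (v, w v))"
    by (rule exE[OF *[OF y]], rule rad, assumption, elim exE conjE, rule that, auto)
  have "hsum (\<lambda>(p, q). \<epsilon> q *h p) (\<Delta> y) = (\<Sum>v\<in>D. \<epsilon> (w v) *h v)"
    by (rule hvs.teq_cong_bilinear[OF vector_space_H bilinear_counit_right eq])
  then have "y = (\<Sum>v\<in>D. \<epsilon> (w v) *h v)" unfolding counit_right[OF y] .
  also have "\<dots> = 0"
  proof (intro sum.neutral ballI)
    fix v assume v: "v \<in> D"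
    have "\<epsilon> (w v) = 0"
      by (rule rad_counit[OF D(2)[OF v]]) (use D(2,3) v form_commute in metis)
    then show "\<epsilon> (w v) *h v = 0" by simp
  qed
  finally show ?thesis .
qed

section \<open>Grouplike elements\<close>

definition Gr :: "'h set" where
  "Gr = {g \<in> V. hvs.teq (\<Delta> g) (basis_elt (g, g)) \<and> \<epsilon> g = 1}"

lemma GrD: "g \<in> Gr \<Longrightarrow> g \<in> V" "g \<in> Gr \<Longrightarrow> hvs.teq (\<Delta> g) (basis_elt (g, g))" "g \<in> Gr \<Longrightarrow> \<epsilon> g = 1"
  by (auto simp: Gr_def)

lemma Gr_bilinear:
  assumes "vector_space (s' :: 'k \<Rightarrow> 'w \<Rightarrow> 'w::ab_group_add)" "bilinear_on (hscale H) s' V F" "g \<in> Gr"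
  shows "free_extend s' (\<lambda>(p, q). F p q) (\<Delta> g) = F g g"
  using hvs.teq_cong_bilinear[OF assms(1,2), of "\<Delta> g" "\<lambda>v. v" "{g}"] GrD(2)[OF assms(3)] by simp

lemma prd_Gr: "g \<in> Gr \<Longrightarrow> y \<in> V \<Longrightarrow> prd g y = B g y *h g"
  unfolding prd_def using Gr_bilinear[OF vector_space_H bilinear_prd] by blast

lemma form_Gr_self: "g \<in> Gr \<Longrightarrow> B g g = 1"
  using form_counit[of g] Gr_bilinear[OF field_vector_space form_bilinear] GrD by simp

text \<open>The product of two grouplikes is a multiple of each of them with the same scalar
  \<open>B g h\<close>, which must vanish if they differ.\<close>

lemma form_Gr_neq:
  assumes "g \<in> Gr" "h \<in> Gr" "g \<noteq> h" shows "B g h = 0"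
proof (rule ccontr)
  assume nz: "B g h \<noteq> 0"
  have "B g h *h g = B h g *h h"
    using prd_Gr[OF assms(1) GrD(1)[OF assms(2)]] prd_Gr[OF assms(2) GrD(1)[OF assms(1)]]
      prd_commute GrD(1) assms by metis
  then have "B g h *h g = B g h *h h" using form_commute GrD(1) assms by metis
  then show False using nz assms(3) by simp
qed

lemma form_Gr: "g \<in> Gr \<Longrightarrow> h \<in> Gr \<Longrightarrow> B g h = (if g = h then 1 else 0)"
  using form_Gr_self form_Gr_neq by simp

lemma form_Gr_sum:
  assumes "finite F" "F \<subseteq> Gr" "h \<in> Gr"
  shows "B h (\<Sum>g\<in>F. c g *h g) = (if h \<in> F then c h else 0)"
proof -
  have "B h (\<Sum>g\<in>F. c g *h g) = (\<Sum>g\<in>F. c g * B h g)"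
    by (rule linear_on_sum[OF vector_space_H field_vector_space hvs.V form_lin(2)])
      (use assms GrD(1) in auto)
  also have "\<dots> = (\<Sum>g\<in>F. if h = g then c h else 0)"
    by (rule sum.cong) (use assms form_Gr in auto)
  finally show ?thesis using assms(1) by simp
qed

lemma Gr_independent: "hvs.independent Gr"
  unfolding hvs.independent_explicit_finite_subsets
proof (intro allI impI ballI)
  fix F u g assume "F \<subseteq> Gr" "finite F" "(\<Sum>v\<in>F. u v *h v) = 0" "g \<in> F"
  then show "u g = 0" using form_Gr_sum[of F g u] form_zero[of g] GrD(1)[of g] by auto
qed

text \<open>By nondegeneracy a common eigenvector \<open>n\<close> of all multiplications satisfies
  \<open>\<Delta> n = n \<otimes> b\<close>, and the counit axioms make \<open>b\<close> a multiple of \<open>n\<close>.\<close>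

lemma eigenvector_Gr:
  assumes n: "n \<in> V" "n \<noteq> 0" and eig: "\<And>y. y \<in> V \<Longrightarrow> \<exists>c. prd y n = c *h n"
  shows "\<exists>c g. g \<in> Gr \<and> c \<noteq> 0 \<and> n = c *h g"
proof -
  \<comment> \<open>The eigenvector is made a member of the basis \<open>D\<close>, so that the
    eigenvalue equation can be compared coefficientwise: all second legs except that of
    \<open>n\<close> are orthogonal to \<open>V\<close> and hence zero.\<close>
  have S: "finite {n}" "{n} \<subseteq> V" "hvs.independent {n}" using n by simp_all
  obtain D w where D: "finite D" "hvs.independent D" "{n} \<subseteq> D" "D \<subseteq> V" "\<And>v. v \<in> D \<Longrightarrow> w v \<in> V"
    and eq: "hvs.teq (\<Delta> n) (\<Sum>v\<in>D. basis_elt (v, w v))"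
    by (rule hvs.teq_normal_form[OF comult_closed[OF n(1)] S]) (rule that)
  have w0: "w v = 0" if v: "v \<in> D" "v \<noteq> n" for v
  proof (rule form_nondegenerate[OF D(5)[OF v(1)]])
    fix y assume y: "y \<in> V"
    obtain c where c: "prd y n = c *h n" using eig[OF y] by blast
    have "(\<Sum>v\<in>D. B (w v) y *h v) = c *h n"
      using hvs.teq_cong_bilinear[OF vector_space_H bilinear_prd[OF y] eq] c prd_commute[OF y n(1)]
      by (simp add: prd_def)
    moreover have "(\<Sum>v\<in>D. (if v = n then c else 0) *h v) = (\<Sum>v\<in>D. if v = n then c *h n else 0)"
      by (rule sum.cong) auto
    ultimately have s0: "(\<Sum>v\<in>D. (B (w v) y - (if v = n then c else 0)) *h v) = 0"
      using D(1,3) by (simp add: hvs.scale_left_diff_distrib sum_subtractf)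
    have ind: "u v = 0" if "(\<Sum>v\<in>D. u v *h v) = 0" for u
      using D(2) v(1) that hvs.dependent_finite[OF D(1)] by auto
    from ind[of "\<lambda>v. B (w v) y - (if v = n then c else 0)", OF s0]
    show "B y (w v) = 0" using v form_commute[OF y D(5)[OF v(1)]] by simp
  qed
  let ?b = "w n"
  have b: "?b \<in> V" using D by auto
  have "hvs.teq (\<Sum>v\<in>D. basis_elt (v, w v)) (\<Sum>v\<in>D. if v = n then basis_elt (n, ?b) else 0)"
    using D(4) w0 hvs.teq_zero(2) by (intro tensor2_eq_sum) (auto intro: tensor2_eq_refl)
  then have nb: "hvs.teq (\<Delta> n) (basis_elt (n, ?b))"
    using eq D(1,3) tensor2_eq_trans by (fastforce simp: sum.delta)
  have nb': "hvs.teq (\<Delta> n) (\<Sum>v\<in>{n}. basis_elt (v, w v))" using nb by simp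
  have 1: "\<epsilon> n *h ?b = n"
    using hvs.teq_cong_bilinear[OF vector_space_H bilinear_counit_left nb'] counit_left[OF n(1)] by simp
  have 2: "\<epsilon> ?b *h n = n"
    using hvs.teq_cong_bilinear[OF vector_space_H bilinear_counit_right nb'] counit_right[OF n(1)] by simp
  have en: "\<epsilon> n \<noteq> 0" using 1 n(2) by auto
  \<comment> \<open>With this the tensor n \<otimes> b, divided by \<open>\<epsilon> n\<close>,
    becomes b \<otimes> b; the second counit axiom has the effect that b has counit 1.\<close>
  have b1: "?b = inverse (\<epsilon> n) *h n"
  proof -
    have "inverse (\<epsilon> n) *h n = inverse (\<epsilon> n) *h \<epsilon> n *h ?b" by (simp only: 1)
    then show ?thesis using en by simp
  qed
  have eb: "\<epsilon> ?b = 1" using 2 n(2) hvs.scale_right_imp_eq[of n "\<epsilon> ?b" 1] by simp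
  have "hvs.teq (\<Delta> ?b) (free_scale (inverse (\<epsilon> n)) (\<Delta> n))"
    unfolding b1 by (rule comult_scale[OF n(1)])
  moreover have "hvs.teq (free_scale (inverse (\<epsilon> n)) (\<Delta> n)) (free_scale (inverse (\<epsilon> n)) (basis_elt (n, ?b)))"
    by (rule tensor2_eq_scale[OF nb])
  moreover have "hvs.teq (free_scale (inverse (\<epsilon> n)) (basis_elt (n, ?b))) (basis_elt (?b, ?b))"
    using tensor2_eq_sym[OF hvs.teq_scale_left[OF n(1) b, of "inverse (\<epsilon> n)"]] b1 by simp
  ultimately have "hvs.teq (\<Delta> ?b) (basis_elt (?b, ?b))" using tensor2_eq_trans by blast
  then have "?b \<in> Gr" using b eb by (simp add: Gr_def)
  then show ?thesis using 1 en by metis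
qed

text \<open>The source of all finiteness: by the second description of the product, the principal
  ideal of \<open>x\<close> lies in the span of the finitely many second legs of
  \<open>\<Delta> x\<close>.\<close>

lemma prd_in_span: "x \<in> V \<Longrightarrow> y \<in> V \<Longrightarrow> prd y x \<in> hvs.span (snd ` supp (\<Delta> x))"
  unfolding prd_right by (rule hvs.free_extend_in_subspace[OF hvs.subspace_span])
    (force intro: hvs.span_scale hvs.span_base)

text \<open>A grouplike that is not orthogonal to \<open>x\<close> is a multiple of its product with
  \<open>x\<close>, so it lies in the finite-dimensional space of \<open>prd_in_span\<close>; and
  grouplikes are independent.\<close>

lemma finite_Gr_support:
  assumes x: "x \<in> V" shows "finite {g \<in> Gr. B g x \<noteq> 0}"
proof -
  let ?G = "{g \<in> Gr. B g x \<noteq> 0}" and ?S = "snd ` supp (\<Delta> x)"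
  have "g \<in> hvs.span ?S" if g: "g \<in> ?G" for g
  proof -
    have "inverse (B g x) *h prd g x \<in> hvs.span ?S"
      using prd_in_span[OF x] g GrD(1) by (intro hvs.span_scale) auto
    moreover have "inverse (B g x) *h prd g x = g" using g prd_Gr[of g x] x by simp
    ultimately show ?thesis by simp
  qed
  moreover have "hvs.independent ?G" using Gr_independent by (rule hvs.independent_mono) auto
  ultimately show ?thesis using hvs.independent_span_bound[of ?S ?G] by auto
qed

end

section \<open>Expansion in grouplike elements over an algebraically closed field\<close>

locale split_hopf_form = hopf_form H B
  for H :: "('k::alg_closed_field, 'h::ab_group_add, 'z) hopf_scheme" and B :: "'h \<Rightarrow> 'h \<Rightarrow> 'k"
begin

text \<open>If \<open>x\<close> is nonzero, its principal ideal is a nonzero finite-dimensional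
  space with commuting multiplications, so it contains a common eigenvector, that is, a multiple
  \<open>c *h g\<close> of a grouplike. Writing this as \<open>prd y x\<close>, one gets c =
  \<epsilon>(g (y x)) = \<epsilon>(y (g x)), and g x = \<open>B g x *h g\<close> is zero.\<close>

lemma orthogonal_Gr_zero:
  assumes x: "x \<in> V" and orth: "\<And>g. g \<in> Gr \<Longrightarrow> B g x = 0"
  shows "x = 0"
proof (rule ccontr)
  assume "x \<noteq> 0"
  let ?W = "(\<lambda>y. prd y x) ` V" and ?S = "snd ` supp (\<Delta> x)"
  have px: "prd y x = prd x y" if "y \<in> V" for y using prd_commute x that by blast
  have lin: "prd x (y + z) = prd x y + prd x z" "prd x (a *h y) = a *h prd x y" if "y \<in> V" "z \<in> V" for y z a
    using prd_linear[OF x] that by (auto simp: linear_on_def)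
  have W: "hvs.subspace ?W"
  proof (rule hvs.subspaceI)
    have "prd x 0 = 0" using lin(2)[of 0 0 0] V_zero by simp
    then show "0 \<in> ?W" using px[OF V_zero] V_zero by (metis image_eqI)
  next
    fix u v assume "u \<in> ?W" "v \<in> ?W"
    then obtain y z where yz: "y \<in> V" "z \<in> V" "u = prd y x" "v = prd z x" by blast
    then have "u + v = prd (y + z) x" using lin(1) px V_add by simp
    then show "u + v \<in> ?W" using V_add yz by blast
  next
    fix a u assume "u \<in> ?W"
    then obtain y where y: "y \<in> V" "u = prd y x" by blast
    then have "a *h u = prd (a *h y) x" using lin(2) px carrier_scale by simp
    then show "a *h u \<in> ?W" using carrier_scale y by blast
  qed
  have WV: "?W \<subseteq> V" using prd_closed by blast
  \<comment> \<open>Otherwise \<open>counit_prd\<close> puts \<open>x\<close> into the radical of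
    the form.\<close>
  have "?W \<noteq> {0}"
  proof
    assume 0: "?W = {0}"
    have "B y x = 0" if y: "y \<in> V" for y
    proof -
      have "prd y x = 0" using 0 y by blast
      then have "B y x = \<epsilon> 0" using counit_prd[OF y x] by simp
      then show ?thesis using counit_scale[of 0 0] V_zero by simp
    qed
    then show False using form_nondegenerate[OF x] \<open>x \<noteq> 0\<close> by blast
  qed
  have "\<exists>n\<in>?W. n \<noteq> 0 \<and> (\<forall>T\<in>prd ` V. \<exists>c. T n = c *h n)"
  proof (rule common_eigenvector_exists[OF vector_space_H W _ _ \<open>?W \<noteq> {0}\<close>])
    show "finite ?S" by simp
    show "?W \<subseteq> hvs.span ?S" using prd_in_span[OF x] by blast
    show "T w \<in> ?W" if T: "T \<in> prd ` V" and w: "w \<in> ?W" for T w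
    proof -
      obtain y z where yz: "y \<in> V" "z \<in> V" "T = prd z" "w = prd y x" using T w by blast
      have "prd z (prd y x) = prd z (prd x y)" using yz px by simp
      also have "\<dots> = prd x (prd z y)" using prd_left_commute[OF yz(2) x yz(1)] .
      also have "\<dots> = prd (prd z y) x" using px prd_closed[OF yz(2)] by simp
      finally show ?thesis using yz prd_closed by blast
    qed
    show "linear_on (hscale H) (hscale H) ?W T" if "T \<in> prd ` V" for T
      using that WV prd_linear unfolding linear_on_def by blast
    show "T (U w) = U (T w)" if "T \<in> prd ` V" "U \<in> prd ` V" "w \<in> ?W" for T U w
      using that WV prd_left_commute by blast
  qed
  then obtain n y where n: "n \<noteq> 0" "y \<in> V" "n = prd y x" "\<And>z. z \<in> V \<Longrightarrow> \<exists>c. prd z n = c *h n" by blast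
  have nV: "n \<in> V" using n prd_closed by blast
  obtain c g where g: "g \<in> Gr" "c \<noteq> 0" "n = c *h g" using eigenvector_Gr[OF nV n(1,4)] by blast
  have gV: "g \<in> V" by (rule GrD[OF g(1)])
  have "c = B g n" using form_simps(4)[OF gV gV gV] form_Gr_self[OF g(1)] g(3) by simp
  also have "\<dots> = \<epsilon> (prd g (prd y x))" using counit_prd[OF gV nV] n(3) by simp
  also have "\<dots> = \<epsilon> (prd y (prd g x))" using prd_left_commute[OF gV n(2) x] by simp
  also have "prd g x = 0" using prd_Gr[OF g(1) x] orth[OF g(1)] by simp
  also have "\<epsilon> (prd y 0) = B y 0" using counit_prd[OF n(2) V_zero] .
  also have "\<dots> = 0" using form_zero n(2) by blast
  finally show False using g(2) by simp
qed

text \<open>The difference of the two sides is orthogonal to every grouplike. \<open>F\<close> may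
  exceed the support of \<open>x\<close>, so that one finite set can serve several elements at once,
  as \<open>teq_detect\<close> requires.\<close>

lemma Gr_expansion:
  assumes x: "x \<in> V" and F: "finite F" "{g \<in> Gr. B g x \<noteq> 0} \<subseteq> F" "F \<subseteq> Gr"
  shows "x = (\<Sum>g\<in>F. B g x *h g)"
proof -
  let ?y = "\<Sum>g\<in>F. B g x *h g"
  have y: "?y \<in> V" using F GrD(1) by (intro hvs.subspace_sum[OF hvs.V] carrier_scale) auto
  have d: "x - ?y \<in> V" using hvs.subspace_diff[OF hvs.V x y] .
  have "B g (x - ?y) = 0" if g: "g \<in> Gr" for g
  proof -
    have gV: "g \<in> V" by (rule GrD[OF g])
    have "B g x = B g (x - ?y) + B g ?y" using form_simps(2)[OF d y gV] by simp
    moreover have "B g ?y = (if g \<in> F then B g x else 0)" by (rule form_Gr_sum[OF F(1,3) g])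
    ultimately show ?thesis using F(2) g by (cases "g \<in> F") auto
  qed
  then have "x - ?y = 0" by (rule orthogonal_Gr_zero[OF d])
  then show ?thesis by simp
qed

text \<open>A converse to \<open>bilinear_on_free_extend\<close>: with all first legs expanded over
  one finite set of grouplikes, a tensor is determined by its contractions with grouplikes. This
  turns computations with \<open>B\<close> back into statements about
  \<open>\<Delta>\<close>.\<close>

lemma teq_detect:
  assumes t: "supp t \<subseteq> V \<times> V" and u: "supp u \<subseteq> V \<times> V"
    and eq: "\<And>y. y \<in> Gr \<Longrightarrow> hsum (\<lambda>(p, q). B y p *h q) t = hsum (\<lambda>(p, q). B y p *h q) u"
  shows "hvs.teq t u"
proof -
  let ?X = "fst ` (supp t \<union> supp u)"
  let ?F = "\<Union>x\<in>?X. {g \<in> Gr. B g x \<noteq> 0}"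
  have X: "?X \<subseteq> V" using t u by auto
  have F: "finite ?F" "?F \<subseteq> Gr" using X finite_Gr_support by (auto intro!: finite_UN_I)
  have ex: "x = (\<Sum>g\<in>?F. B g x *h g)" if "x \<in> ?X" for x
    by (rule Gr_expansion) (use that X F in blast)+
  have FV: "?F \<subseteq> V" using F(2) GrD(1) by blast
  have 1: "hvs.teq t (\<Sum>v\<in>?F. basis_elt (v, hsum (\<lambda>(x, y). B v x *h y) t))"
    by (rule hvs.teq_collect[OF t FV]) (rule ex, force)
  have 2: "hvs.teq u (\<Sum>v\<in>?F. basis_elt (v, hsum (\<lambda>(x, y). B v x *h y) u))"
    by (rule hvs.teq_collect[OF u FV]) (rule ex, force)
  have 3: "(\<Sum>v\<in>?F. basis_elt (v, hsum (\<lambda>(x, y). B v x *h y) t)) =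
    (\<Sum>v\<in>?F. basis_elt (v, hsum (\<lambda>(x, y). B v x *h y) u))"
    by (rule sum.cong) (use F(2) eq in auto)
  show ?thesis using 1 tensor2_eq_sym[OF 2] unfolding 3 by (rule tensor2_eq_trans)
qed

lemma mult_lin:
  assumes "x \<in> V"
  shows "linear_on (hscale H) (hscale H) V (hmult H x)" "linear_on (hscale H) (hscale H) V (\<lambda>y. hmult H y x)"
  using mult_linear_left mult_linear_right assms by auto

lemma mult_simps:
  assumes "x \<in> V" "y \<in> V" "z \<in> V"
  shows "hmult H x (y + z) = hmult H x y + hmult H x z" "hmult H (y + z) x = hmult H y x + hmult H z x"
    "hmult H x (a *h y) = a *h hmult H x y" "hmult H (a *h y) x = a *h hmult H y x"
  using mult_lin[OF assms(1)] assms by (auto simp: linear_on_def)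

lemma mult_Gr:
  assumes g: "g \<in> Gr" and h: "h \<in> Gr" shows "hmult H g h \<in> Gr"
proof -
  let ?t = "free_extend free_scale (\<lambda>(p, q). free_extend free_scale (\<lambda>(p', q').
      basis_elt (hmult H p p', hmult H q q')) (\<Delta> h)) (\<Delta> g)"
  note gV = GrD(1)[OF g] and hV = GrD(1)[OF h]
  have gh: "hmult H g h \<in> V" by (rule mult_closed[OF gV hV])
  have detect: "hsum (\<lambda>(p, q). B y p *h q) ?t = B y (hmult H g h) *h hmult H g h" if y: "y \<in> Gr" for y
  proof -
    have yV: "y \<in> V" by (rule GrD(1)[OF y])
    \<comment> \<open>The two coproducts in the representative of
      \<open>\<Delta> (hmult H g h)\<close> are evaluated one after the other: \<open>K\<close> is
      bilinear in the legs of \<open>h\<close>, and after inserting \<open>h\<close> also in those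
      of \<open>g\<close>.\<close>
    define K where "K p q p' q' = B y (hmult H p p') *h hmult H q q'" for p q p' q'
    have K1: "bilinear_on (hscale H) (hscale H) V (\<lambda>p' q'. K p q p' q')" if "p \<in> V" "q \<in> V" for p q
      using that yV by (auto simp: K_def bilinear_on_def linear_on_def mult_simps form_simps mult_closed algebra_simps)
    have K2: "bilinear_on (hscale H) (hscale H) V (\<lambda>p q. K p q h h)"
      using yV hV by (auto simp: K_def bilinear_on_def linear_on_def mult_simps form_simps mult_closed algebra_simps)
    have "hsum (\<lambda>(p, q). B y p *h q) ?t =
        hsum (\<lambda>(p, q). hsum (\<lambda>(p', q'). K p q p' q') (\<Delta> h)) (\<Delta> g)"
      by (simp add: hvs.free_extend_nested hvs.free_extend_single case_prod_unfold K_def)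
    also have "\<dots> = hsum (\<lambda>(p, q). K p q h h) (\<Delta> g)"
      by (rule hvs.free_extend_cong)
        (use comult_keysD[OF gV] Gr_bilinear[OF vector_space_H K1 h] in auto)
    also have "\<dots> = K g g h h" by (rule Gr_bilinear[OF vector_space_H K2 g])
    finally show ?thesis by (simp add: K_def)
  qed
  have 1: "hvs.teq (\<Delta> (hmult H g h)) ?t" by (rule comult_mult[OF gV hV])
  have "hvs.teq (\<Delta> (hmult H g h)) (basis_elt (hmult H g h, hmult H g h))"
  proof (rule teq_detect[OF comult_closed[OF gh]])
    show "supp (basis_elt (hmult H g h, hmult H g h)) \<subseteq> V \<times> V" using gh by simp
    fix y assume y: "y \<in> Gr"
    have yV: "y \<in> V" by (rule GrD(1)[OF y])
    have "bilinear_on (hscale H) (hscale H) V (\<lambda>p q. B y p *h q)"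
      using yV by (auto simp: bilinear_on_def linear_on_def form_simps algebra_simps)
    from bilinear_on_free_extend[OF vector_space_H this 1]
    show "hsum (\<lambda>(p, q). B y p *h q) (\<Delta> (hmult H g h)) =
        hsum (\<lambda>(p, q). B y p *h q) (basis_elt (hmult H g h, hmult H g h))"
      by (simp add: detect[OF y] hvs.free_extend_single)
  qed
  then show ?thesis using gh counit_mult[OF gV hV] GrD(3)[OF g] GrD(3)[OF h] by (simp add: Gr_def)
qed

lemma one_Gr: "hone H \<in> Gr"
  using one_closed comult_one counit_one by (simp add: Gr_def)

text \<open>The antipode axioms, evaluated on a grouplike, give a two-sided inverse. That this
  inverse is grouplike does not go through its coproduct: it is expanded in grouplikes f, and
  pairing the equation S(g) g = 1 with 1 exhibits one f that is inverse to \<open>g\<close>.\<close>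

lemma antipode_Gr:
  assumes g: "g \<in> Gr"
  shows "hmult H (hantipode H g) g = hone H" "hmult H g (hantipode H g) = hone H" "hantipode H g \<in> Gr"
proof -
  let ?S = "hantipode H"
  note gV = GrD(1)[OF g]
  have S: "?S g \<in> V" by (rule antipode_closed[OF gV])
  have S_lin: "?S (x + y) = ?S x + ?S y" "?S (a *h x) = a *h ?S x" if "x \<in> V" "y \<in> V" for x y a
    using antipode_linear that by (auto simp: linear_on_def)
  have "bilinear_on (hscale H) (hscale H) V (\<lambda>p q. hmult H (?S p) q)"
    and "bilinear_on (hscale H) (hscale H) V (\<lambda>p q. hmult H p (?S q))"
    by (auto simp: bilinear_on_def linear_on_def mult_simps S_lin antipode_closed)
  note b = this
  show 1: "hmult H (?S g) g = hone H"
    using antipode_left[OF gV] Gr_bilinear[OF vector_space_H b(1) g] GrD(3)[OF g] by simp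
  show 2: "hmult H g (?S g) = hone H"
    using antipode_right[OF gV] Gr_bilinear[OF vector_space_H b(2) g] GrD(3)[OF g] by simp
  let ?F = "{f \<in> Gr. B f (?S g) \<noteq> 0}"
  have F: "finite ?F" by (rule finite_Gr_support[OF S])
  have "hone H = hmult H (\<Sum>f\<in>?F. B f (?S g) *h f) g"
    using Gr_expansion[OF S F] 1 by simp
  also have "\<dots> = (\<Sum>f\<in>?F. B f (?S g) *h hmult H f g)"
    by (rule linear_on_sum[OF vector_space_H vector_space_H hvs.V mult_lin(2)[OF gV]])
      (use GrD(1) in auto)
  finally have "B (hone H) (hone H) = B (hone H) (\<Sum>f\<in>?F. B f (?S g) *h hmult H f g)" by simp
  also have "\<dots> = (\<Sum>f\<in>?F. B f (?S g) * B (hone H) (hmult H f g))"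
    by (rule linear_on_sum[OF vector_space_H field_vector_space hvs.V form_lin(2)[OF one_closed]])
      (use GrD(1) gV mult_closed in auto)
  finally have "(\<Sum>f\<in>?F. B f (?S g) * B (hone H) (hmult H f g)) \<noteq> 0"
    using form_Gr_self[OF one_Gr] by simp
  then obtain f where f: "f \<in> Gr" "B (hone H) (hmult H f g) \<noteq> 0"
    by (metis (no_types, lifting) mem_Collect_eq mult_zero_right sum.neutral)
  \<comment> \<open>Both \<open>hmult H f g\<close> and the unit are grouplike, and distinct
    grouplikes are orthogonal.\<close>
  then have fg: "hmult H f g = hone H" using form_Gr_neq[OF one_Gr mult_Gr[OF f(1) g]] by force
  have "?S g = hmult H (hmult H f g) (?S g)" using fg mult_one_left[OF S] by simp
  also have "\<dots> = hmult H f (hmult H g (?S g))" by (rule mult_assoc[OF GrD(1)[OF f(1)] gV S])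
  also have "\<dots> = f" using 2 mult_one_right[OF GrD(1)[OF f(1)]] by simp
  finally show "?S g \<in> Gr" using f(1) by simp
qed

end

section \<open>Hopf actions on etale algebras\<close>

locale etale_hopf_action = etale_algebra C A m \<iota> + faithful_hopf_action C A m \<iota> H \<rho>
  for C :: "('k::alg_closed_field, 'o, 'm::ab_group_add, 'z) ribbon_cat_scheme" (structure)
    and A :: 'o and m \<iota> :: 'm
    and H :: "('k, 'h::ab_group_add, 'y) hopf_scheme"
    and \<rho> :: "'h \<Rightarrow> 'm"
begin

lemma act_linear: "x \<in> V \<Longrightarrow> y \<in> V \<Longrightarrow> \<rho> (x + y) = \<rho> x + \<rho> y"
  "x \<in> V \<Longrightarrow> \<rho> (a *h x) = a *\<^sub>s \<rho> x"
  using action_linear by (auto simp: linear_on_def)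

lemma act_free_extend:
  assumes "\<And>k. k \<in> supp t \<Longrightarrow> F k \<in> V"
  shows "\<rho> (hsum F t) = free_extend (scale C) (\<lambda>k. \<rho> (F k)) t"
  by (rule linear_on_free_extend[OF vector_space_H scl.vector_space_axioms carrier_subspace action_linear assms])

lemma tensor_id_linear: "linear_on (scale C) (scale C) (hom C X Y) (\<lambda>f. f \<rhd> Z)"
  by (simp add: linear_on_def tensor_add_left[OF _ _ idt_hom] tensor_scale_left[OF _ idt_hom])

lemma act_mult_hom: "p \<in> V \<Longrightarrow> q \<in> V \<Longrightarrow> m \<bullet> (\<rho> p \<otimes>\<^sub>a \<rho> q) \<in> hom C (A \<odot> A) A"
  by (rule comp_hom m_hom tensor_hom action_hom | assumption)+

lemma linear_act_mult:
  assumes L: "linear_on (scale C) (scale C) (hom C (A \<odot> A) A) L" and x: "x \<in> V"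
  shows "L (\<rho> x \<bullet> m) = free_extend (scale C) (\<lambda>(p, q). L (m \<bullet> (\<rho> p \<otimes>\<^sub>a \<rho> q))) (\<Delta> x)"
proof -
  have "L (\<rho> x \<bullet> m) = free_extend (scale C) (\<lambda>k. L ((\<lambda>(p, q). m \<bullet> (\<rho> p \<otimes>\<^sub>a \<rho> q)) k)) (\<Delta> x)"
    unfolding action_m[OF x]
    by (rule linear_on_free_extend[OF vector_space_scale vector_space_scale hom_subspace L])
      (use comult_keysD[OF x] act_mult_hom in auto)
  then show ?thesis by (simp add: case_prod_unfold)
qed

text \<open>Compatibility of the action with \<open>m\<close> expands
  \<open>\<rho> x \<bullet> m\<close> over the coproduct, and the premise \<open>c\<close> evaluates
  \<open>L\<close> on pure tensors. The outcome is again of the form \<open>\<rho>\<close> of an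
  element of \<open>H\<close>, so faithfulness can turn equations between arrows into equations in
  \<open>H\<close>.\<close>

lemma linear_act_mult_eq:
  assumes L: "linear_on (scale C) (scale C) (hom C (A \<odot> A) A) L" and x: "x \<in> V"
    and c: "\<And>p q. \<lbrakk>p \<in> V; q \<in> V\<rbrakk> \<Longrightarrow> L (m \<bullet> (\<rho> p \<otimes>\<^sub>a \<rho> q)) = c p q *\<^sub>s (\<rho> (F p q) \<rhd> \<I>)"
    and F: "\<And>p q. \<lbrakk>p \<in> V; q \<in> V\<rbrakk> \<Longrightarrow> F p q \<in> V"
  shows "L (\<rho> x \<bullet> m) = \<rho> (hsum (\<lambda>(p, q). c p q *h F p q) (\<Delta> x)) \<rhd> \<I>"
proof -
  let ?G = "\<lambda>(p, q). c p q *h F p q"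
  have G: "?G k \<in> V" if "k \<in> supp (\<Delta> x)" for k
    using that by (cases k) (auto intro!: carrier_scale F dest: comult_keysD[OF x])
  have "\<rho> (hsum ?G (\<Delta> x)) \<rhd> \<I> = free_extend (scale C) (\<lambda>k. \<rho> (?G k)) (\<Delta> x) \<rhd> \<I>"
    by (simp only: act_free_extend[OF G])
  also have "\<dots> = free_extend (scale C) (\<lambda>k. \<rho> (?G k) \<rhd> \<I>) (\<Delta> x)"
    by (rule linear_on_free_extend[OF vector_space_scale vector_space_scale hom_subspace tensor_id_linear[of A A \<I>]])
      (rule action_hom[OF G])
  also have "\<dots> = free_extend (scale C) (\<lambda>(p, q). L (m \<bullet> (\<rho> p \<otimes>\<^sub>a \<rho> q))) (\<Delta> x)"
    by (rule scl.free_extend_cong)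
      (use comult_keysD[OF x] in \<open>auto simp: c F act_linear tensor_scale_left[OF action_hom idt_hom]\<close>)
  finally show ?thesis by (simp add: linear_act_mult[OF L x])
qed

text \<open>Symmetry of \<open>B\<close> is that of \<kappa> and \<open>m\<close>; the other
  identities arise by evaluating an arrow of \<open>C\<close> in two ways.
  \<open>contract_swap\<close> gives \<open>form_casimir\<close>, the braiding gives
  \<open>form_flip\<close>, and composing with \<kappa> gives \<open>form_counit\<close>.\<close>

lemma exists_hopf_form: "\<exists>B. split_hopf_form H B"
proof -
  obtain \<kappa> where cas: "casimir \<kappa>" and bk: "braid C A A \<bullet> \<kappa> = \<kappa>" and mk: "m \<bullet> \<kappa> = \<iota>"
    by (rule exists_casimir)
  have k: "\<kappa> \<in> hom C \<I> (A \<odot> A)" using cas by (simp add: casimir_def)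
  define B where "B x y = form \<kappa> (\<rho> x) (\<rho> y)" for x y
  have sym: "B x y = B y x" if "x \<in> V" "y \<in> V" for x y
    unfolding B_def using that by (intro form_sym[OF k bk] action_hom)
  have lin: "linear_on (hscale H) (*) V (\<lambda>x. B x y)" if "y \<in> V" for y
    using form_linear_left[OF k action_hom[OF that]] action_hom
    by (auto simp: linear_on_def B_def act_linear)
  have lin': "linear_on (hscale H) (*) V (B x)" if x: "x \<in> V" for x
    using lin[OF x] sym[OF x] carrier_subspace vector_space_H
    by (auto simp: linear_on_def module.subspace_def module_iff_vector_space)
  have right: "contract_right \<kappa> (\<rho> y) (\<rho> x \<bullet> m) = \<rho> (hsum (\<lambda>(p, q). B q y *h p) (\<Delta> x)) \<rhd> \<I>"
    if x: "x \<in> V" and y: "y \<in> V" for x y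
    by (rule linear_act_mult_eq[OF contract_right_linear[OF k action_hom[OF y]] x])
      (simp_all add: B_def contract_right_pure[OF k action_hom action_hom action_hom[OF y]])
  have left: "contract_left \<kappa> (\<rho> x) (\<rho> y \<bullet> m) = \<rho> (hsum (\<lambda>(p, q). B x p *h q) (\<Delta> y)) \<rhd> \<I>"
    if x: "x \<in> V" and y: "y \<in> V" for x y
    by (rule linear_act_mult_eq[OF contract_left_linear[OF k action_hom[OF x]] y])
      (simp_all add: B_def contract_left_pure[OF k action_hom action_hom action_hom[OF x]])
  \<comment> \<open>Precomposition with the braiding fixes \<open>\<rho> x \<bullet> m\<close>,
    because \<open>A\<close> is commutative, but swaps the legs of a pure tensor.\<close>
  have flip: "contract_right \<kappa> (\<rho> y) (\<rho> x \<bullet> m) = \<rho> (hsum (\<lambda>(p, q). B p y *h q) (\<Delta> x)) \<rhd> \<I>"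
    if x: "x \<in> V" and y: "y \<in> V" for x y
  proof -
    let ?L = "\<lambda>F. contract_right \<kappa> (\<rho> y) (F \<bullet> braid C A A)"
    have L: "linear_on (scale C) (scale C) (hom C (A \<odot> A) A) ?L"
      using contract_right_linear[OF k action_hom[OF y]] comp_hom[OF _ braid_hom[of A A]]
      by (simp add: linear_on_def comp_add_left[OF _ _ braid_hom] comp_scale_left[OF _ braid_hom])
    have "?L (m \<bullet> (\<rho> p \<otimes>\<^sub>a \<rho> q)) = B p y *\<^sub>s (\<rho> q \<rhd> \<I>)" if pq: "p \<in> V" "q \<in> V" for p q
    proof -
      note h = action_hom[OF pq(1)] action_hom[OF pq(2)]
      have "(m \<bullet> (\<rho> p \<otimes>\<^sub>a \<rho> q)) \<bullet> braid C A A = m \<bullet> (\<rho> p \<otimes>\<^sub>a \<rho> q) \<bullet> braid C A A"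
        by (rule comp_assoc) (rule m_hom tensor_hom h braid_hom)+
      also have "\<dots> = m \<bullet> (\<rho> q \<otimes>\<^sub>a \<rho> p)" by (rule mult_tensor_swap[OF h])
      finally show ?thesis by (simp add: contract_right_pure[OF k h(2,1) action_hom[OF y]] B_def)
    qed
    then have "?L (\<rho> x \<bullet> m) = \<rho> (hsum (\<lambda>(p, q). B p y *h q) (\<Delta> x)) \<rhd> \<I>"
      by (rule linear_act_mult_eq[OF L x])
    moreover have "(\<rho> x \<bullet> m) \<bullet> braid C A A = \<rho> x \<bullet> m"
      using comp_assoc[OF action_hom[OF x] m_hom braid_hom] by (simp add: commutative)
    ultimately show ?thesis by simp
  qed
  have fe_closed: "hsum (\<lambda>(p, q). c p q *h G p q) (\<Delta> x) \<in> V"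
    if "x \<in> V" "\<And>p q. \<lbrakk>p \<in> V; q \<in> V\<rbrakk> \<Longrightarrow> G p q \<in> V" for c G x
    by (rule vector_space.free_extend_in_subspace[OF vector_space_H carrier_subspace])
      (use that comult_keysD[OF that(1)] carrier_scale in auto)
  have cancel: "x = y" if "x \<in> V" "y \<in> V" "\<rho> x \<rhd> \<I> = \<rho> y \<rhd> \<I>" for x y
    using tensor_id_cancel[OF action_hom action_hom that(3)] that faithful by (auto simp: inj_on_def)
  have "hopf_form H B"
  proof
    show "bilinear_on (hscale H) (*) V B" using lin lin' by (simp add: bilinear_on_def)
  next
    fix x y assume x: "x \<in> V" and y: "y \<in> V"
    show "B x y = B y x" by (rule sym[OF x y])
    have "contract_right \<kappa> (\<rho> y) (\<rho> x \<bullet> m) = contract_left \<kappa> (\<rho> x) (\<rho> y \<bullet> m)"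
      by (rule contract_swap[OF cas action_hom[OF x] action_hom[OF y]])
    then show "hsum (\<lambda>(p, q). B q y *h p) (\<Delta> x) =
        hsum (\<lambda>(p, q). B x p *h q) (\<Delta> y)"
      unfolding right[OF x y] left[OF x y] by (intro cancel fe_closed x y)
    show "hsum (\<lambda>(p, q). B q y *h p) (\<Delta> x) =
        hsum (\<lambda>(p, q). B p y *h q) (\<Delta> x)"
      using flip[OF x y] unfolding right[OF x y] by (intro cancel fe_closed x y)
  next
    fix x assume x: "x \<in> V"
    \<comment> \<open>Expanded over the coproduct,
      \<open>(\<rho> x \<bullet> m) \<bullet> \<kappa>\<close> yields the form; by
      \<open>m \<bullet> \<kappa> = \<iota>\<close> and the action on the unit it yields the counit.
      Here the normalisation of \<kappa> enters.\<close>
    have "linear_on (scale C) (scale C) (hom C (A \<odot> A) A) (\<lambda>F. F \<bullet> \<kappa>)"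
      by (simp add: linear_on_def comp_add_left[OF _ _ k] comp_scale_left[OF _ k])
    then have "(\<rho> x \<bullet> m) \<bullet> \<kappa> = free_extend (scale C) (\<lambda>(p, q). (m \<bullet> (\<rho> p \<otimes>\<^sub>a \<rho> q)) \<bullet> \<kappa>) (\<Delta> x)"
      by (rule linear_act_mult) (rule x)
    also have "\<dots> = free_extend (scale C) (\<lambda>(p, q). B p q *\<^sub>s \<iota>) (\<Delta> x)"
      by (rule scl.free_extend_cong)
        (use comult_keysD[OF x] in \<open>auto simp: B_def form[OF k action_hom action_hom, symmetric]
          comp_assoc[OF m_hom tensor_hom[OF action_hom action_hom] k]\<close>)
    also have "\<dots> = free_extend (*) (\<lambda>(p, q). B p q) (\<Delta> x) *\<^sub>s \<iota>"
      by (simp add: free_extend_def case_prod_unfold scl.scale_sum_left)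
    also have "(\<rho> x \<bullet> m) \<bullet> \<kappa> = \<rho> x \<bullet> m \<bullet> \<kappa>"
      by (rule comp_assoc) (rule action_hom[OF x] m_hom k)+
    also have "\<dots> = \<epsilon> x *\<^sub>s \<iota>" by (simp add: mk action_\<iota>[OF x])
    finally show "free_extend (*) (\<lambda>(p, q). B p q) (\<Delta> x) = \<epsilon> x"
      using scale_unit_inj by metis
  qed
  then show ?thesis unfolding split_hopf_form_def by blast
qed

text \<open>The monoid laws make inverses unique; for the automorphisms coming from grouplikes the
  antipode will supply them.\<close>

lemma alg_aut_monoid: "monoid (alg_aut_group C A m \<iota>)"
proof (rule monoidI)
  fix f g assume "f \<in> carrier (alg_aut_group C A m \<iota>)" "g \<in> carrier (alg_aut_group C A m \<iota>)"
  then have i: "is_iso C A A f" "is_iso C A A g" and e: "f \<cdot> m = m \<cdot> (f \<otimes>\<^sub>a f)" "g \<cdot> m = m \<cdot> (g \<otimes>\<^sub>a g)"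
    "f \<cdot> \<iota> = \<iota>" "g \<cdot> \<iota> = \<iota>"
    by (auto simp: alg_aut_group_def)
  note t = is_iso_hom[OF i(1)] is_iso_hom[OF i(2)]
  have "(f \<cdot> g) \<cdot> m = f \<bullet> g \<bullet> m" by (rule comp_assoc[OF t m_hom])
  also have "\<dots> = f \<bullet> m \<bullet> (g \<otimes>\<^sub>a g)" by (simp add: e)
  also have "\<dots> = m \<bullet> (f \<otimes>\<^sub>a f) \<bullet> (g \<otimes>\<^sub>a g)"
    by (rule comp_cong_right[OF e(1)]) (rule t m_hom tensor_hom)+
  also have "\<dots> = m \<cdot> ((f \<cdot> g) \<otimes>\<^sub>a (f \<cdot> g))" by (simp add: tensor_comp[OF t(2,1) t(2,1)])
  finally have "(f \<cdot> g) \<cdot> m = m \<cdot> ((f \<cdot> g) \<otimes>\<^sub>a (f \<cdot> g))" .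
  moreover have "(f \<cdot> g) \<cdot> \<iota> = \<iota>" using comp_assoc[OF t \<iota>_hom] e by simp
  ultimately show "f \<otimes>\<^bsub>alg_aut_group C A m \<iota>\<^esub> g \<in> carrier (alg_aut_group C A m \<iota>)"
    using is_iso_comp[OF i(2,1)] by (simp add: alg_aut_group_def)
next
  show "\<one>\<^bsub>alg_aut_group C A m \<iota>\<^esub> \<in> carrier (alg_aut_group C A m \<iota>)"
    using is_iso_idt[of A] comp_idt_left[OF m_hom] comp_idt_right[OF m_hom] comp_idt_left[OF \<iota>_hom]
    by (simp add: alg_aut_group_def tensor_idt)
qed (auto simp: alg_aut_group_def dest: is_iso_hom intro: comp_assoc comp_idt_left comp_idt_right)

lemma grouplike_group_algebra:
  assumes "split_hopf_form H B"
  shows "\<exists>G. subgroup G (alg_aut_group C A m \<iota>) \<and>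
    (\<exists>\<phi>. hopf_iso (group_algebra ((alg_aut_group C A m \<iota>)\<lparr>carrier := G\<rparr>)) H \<phi> \<and>
      (\<forall>x\<in>hcarrier (group_algebra ((alg_aut_group C A m \<iota>)\<lparr>carrier := G\<rparr>)).
         \<rho> (\<phi> x) = free_extend (scale C) (\<lambda>g. g) x))"
proof -
  interpret sf: split_hopf_form H B by fact
  let ?Aut = "alg_aut_group C A m \<iota>"
  define G where "G = \<rho> ` sf.Gr"
  let ?K = "?Aut\<lparr>carrier := G\<rparr>"
  define \<sigma> where "\<sigma> = inv_into V \<rho>"
  \<comment> \<open>\<open>\<sigma> f\<close> is the grouplike element acting as \<open>f\<close>,
    so \<phi> is the linear extension of the inclusion of the grouplikes into
    \<open>H\<close>.\<close>
  define \<phi> where "\<phi> = hsum \<sigma>"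
  have sg: "\<sigma> (\<rho> g) = g" if "g \<in> V" for g
    unfolding \<sigma>_def using faithful that by (rule inv_into_f_f)
  have sG: "\<sigma> f \<in> sf.Gr" "\<rho> (\<sigma> f) = f" if "f \<in> G" for f
    using that sg sf.GrD(1) by (auto simp: G_def)
  have sV: "\<sigma> f \<in> V" if "f \<in> G" for f using sG(1)[OF that] sf.GrD(1) by blast
  have s_inj: "\<sigma> f = \<sigma> g \<longleftrightarrow> f = g" if "f \<in> G" "g \<in> G" for f g using sG(2) that by metis
  have act_aut: "\<rho> g \<in> carrier ?Aut" if g: "g \<in> sf.Gr" for g
  proof -
    have gV: "g \<in> V" by (rule sf.GrD(1)[OF g])
    have S: "hantipode H g \<in> V" by (rule antipode_closed[OF gV])
    have "is_inverse C A A (\<rho> g) (\<rho> (hantipode H g))"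
      using sf.antipode_Gr(1,2)[OF g] action_mult[OF gV S] action_mult[OF S gV] action_one action_hom[OF gV] action_hom[OF S]
      by (simp add: is_inverse_def)
    \<comment> \<open>The coproduct of \<open>g\<close> is g \<otimes> g only modulo relations; the
      right-hand side of \<open>action_m\<close> is bilinear in the legs and so depends only on the
      class.\<close>
    moreover have "\<rho> g \<cdot> m = m \<cdot> (\<rho> g \<otimes>\<^sub>a \<rho> g)"
    proof -
      have t: "\<rho> p \<otimes>\<^sub>a \<rho> q \<in> hom C (A \<odot> A) (A \<odot> A)" if "p \<in> V" "q \<in> V" for p q
        by (rule tensor_hom action_hom that)+
      have "bilinear_on (hscale H) (scale C) V (\<lambda>p q. m \<cdot> (\<rho> p \<otimes>\<^sub>a \<rho> q))"
        by (auto simp: bilinear_on_def linear_on_def act_linear action_hom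
          tensor_add_left[of _ A A _ _ A A] tensor_add_right[of _ A A _ A A] tensor_scale_left[of _ A A _ A A]
          tensor_scale_right[of _ A A _ A A] comp_add_right[OF m_hom t t] comp_scale_right[OF m_hom t])
      then show ?thesis unfolding action_m[OF gV] by (rule sf.Gr_bilinear[OF scl.vector_space_axioms _ g])
    qed
    moreover have "\<rho> g \<cdot> \<iota> = \<iota>" using action_\<iota>[OF gV] sf.GrD(3)[OF g] by simp
    ultimately show ?thesis by (auto simp: alg_aut_group_def is_iso_def)
  qed
  have mult_act: "\<rho> g \<otimes>\<^bsub>?Aut\<^esub> \<rho> h = \<rho> (hmult H g h)" if "g \<in> sf.Gr" "h \<in> sf.Gr" for g h
    using action_mult sf.GrD(1) that by (simp add: alg_aut_group_def)
  have one_act: "\<one>\<^bsub>?Aut\<^esub> = \<rho> (hone H)" by (simp add: alg_aut_group_def action_one)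
  interpret Aut: monoid ?Aut by (rule alg_aut_monoid)
  have inv_act: "inv\<^bsub>?Aut\<^esub> (\<rho> g) = \<rho> (hantipode H g)" if g: "g \<in> sf.Gr" for g
    by (rule Aut.inv_unique'[symmetric])
      (simp_all add: act_aut g sf.antipode_Gr[OF g] mult_act one_act)
  have sub: "subgroup G ?Aut"
    by (rule subgroup.intro)
      (auto simp: G_def act_aut mult_act one_act inv_act sf.mult_Gr sf.one_Gr sf.antipode_Gr)
  interpret K: monoid ?K
    using sub Aut.monoid_axioms
    by (auto intro!: monoidI simp: subgroup_def Aut.m_assoc subset_iff)
  \<comment> \<open>\<open>inv\<close> refers to the carrier of its monoid: the subgroup property
    uses the inverse among all automorphisms, the antipode of the group algebra the one in
    \<open>?K\<close>.\<close>
  have invK: "inv\<^bsub>?K\<^esub> (\<rho> g) = \<rho> (hantipode H g)" if g: "g \<in> sf.Gr" for g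
    by (rule K.inv_unique'[symmetric])
      (simp_all add: g G_def sf.antipode_Gr[OF g] mult_act one_act)
  let ?L = "group_algebra ?K :: ('k, 'm \<Rightarrow>\<^sub>0 'k) hopf"
  have carrier_L: "hcarrier ?L = {x. supp x \<subseteq> G}" by (simp add: group_algebra_def)
  have phi_V: "\<phi> x \<in> V" if "supp x \<subseteq> G" for x
    unfolding \<phi>_def by (rule sf.hvs.free_extend_in_subspace[OF sf.hvs.V]) (use that sV in auto)
  \<comment> \<open>By orthonormality, pairing with a grouplike reads off a coefficient; injectivity
    of \<phi> follows.\<close>
  have coef: "B h (\<phi> x) = Poly_Mapping.lookup x (\<rho> h)"
    if x: "supp x \<subseteq> G" and h: "h \<in> sf.Gr" for x h
  proof -
    have "B h (\<phi> x) = free_extend (*) (\<lambda>f. B h (\<sigma> f)) x"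
      unfolding \<phi>_def by (rule sf.form_free_extend) (use h sf.GrD(1) x sV in auto)
    also have "\<dots> = (\<Sum>f\<in>supp x. if f = \<rho> h then Poly_Mapping.lookup x (\<rho> h) else 0)"
      unfolding free_extend_def
    proof (rule sum.cong[OF refl])
      fix f assume "f \<in> supp x"
      then have f: "f \<in> G" using x by blast
      have "h = \<sigma> f \<longleftrightarrow> f = \<rho> h" using sG(2)[OF f] sg[OF sf.GrD(1)[OF h]] by metis
      then show "Poly_Mapping.lookup x f * B h (\<sigma> f) = (if f = \<rho> h then Poly_Mapping.lookup x (\<rho> h) else 0)"
        using sf.form_Gr[OF h sG(1)[OF f]] by auto
    qed
    finally show ?thesis by (simp add: in_keys_iff)
  qed
  have bij: "bij_betw \<phi> (hcarrier ?L) V"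
    unfolding bij_betw_def
  proof
    show "inj_on \<phi> (hcarrier ?L)"
    proof (rule inj_onI)
      fix x y assume "x \<in> hcarrier ?L" "y \<in> hcarrier ?L" and eq: "\<phi> x = \<phi> y"
      then have xy: "supp x \<subseteq> G" "supp y \<subseteq> G" by (auto simp: carrier_L)
      show "x = y"
      proof (rule poly_mapping_eqI)
        fix f
        show "Poly_Mapping.lookup x f = Poly_Mapping.lookup y f"
        proof (cases "f \<in> G")
          case True
          then show ?thesis using coef[OF xy(1) sG(1)] coef[OF xy(2) sG(1)] sG(2) eq by metis
        next
          case False
          then show ?thesis using xy by (metis in_keys_iff subsetD)
        qed
      qed
    qed
    show "\<phi> ` hcarrier ?L = V"
    proof
      show "\<phi> ` hcarrier ?L \<subseteq> V" using phi_V carrier_L by auto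
      show "V \<subseteq> \<phi> ` hcarrier ?L"
      proof
        fix v assume v: "v \<in> V"
        let ?F = "{g \<in> sf.Gr. B g v \<noteq> 0}"
        have F: "finite ?F" by (rule sf.finite_Gr_support[OF v])
        let ?x = "\<Sum>g\<in>?F. Poly_Mapping.single (\<rho> g) (B g v)"
        have "supp ?x \<subseteq> (\<Union>g\<in>?F. supp (Poly_Mapping.single (\<rho> g) (B g v)))"
          by (rule keys_sum)
        also have "\<dots> \<subseteq> G" by (auto simp: G_def)
        finally have x: "?x \<in> hcarrier ?L" by (simp add: carrier_L)
        have "\<phi> ?x = (\<Sum>g\<in>?F. B g v *h \<sigma> (\<rho> g))"
          by (simp add: \<phi>_def sf.hvs.free_extend_sum sf.hvs.free_extend_single)
        also have "\<dots> = (\<Sum>g\<in>?F. B g v *h g)"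
          by (rule sum.cong) (auto simp: sg sf.GrD(1))
        also have "\<dots> = v" by (rule sf.Gr_expansion[OF v F, symmetric]) auto
        finally show "v \<in> \<phi> ` hcarrier ?L" using x by force
      qed
    qed
  qed
  have lin: "linear_on (hscale ?L) (hscale H) (hcarrier ?L) \<phi>"
    by (simp add: linear_on_def group_algebra_def \<phi>_def sf.hvs.free_extend_add sf.hvs.free_extend_scale)
  have mult: "\<phi> (hmult ?L x y) = hmult H (\<phi> x) (\<phi> y)" if "x \<in> hcarrier ?L" "y \<in> hcarrier ?L" for x y
  proof -
    have x: "supp x \<subseteq> G" and y: "supp y \<subseteq> G" using that by (auto simp: carrier_L)
    have "\<phi> (hmult ?L x y) = hsum (\<lambda>g. hsum (\<lambda>h. \<sigma> (g \<otimes>\<^bsub>?K\<^esub> h)) y) x"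
      by (simp add: group_algebra_def \<phi>_def sf.hvs.free_extend_nested sf.hvs.free_extend_single)
    also have "\<dots> = hsum (\<lambda>g. hmult H (\<sigma> g) (\<phi> y)) x"
    proof (rule sf.hvs.free_extend_cong)
      fix g assume "g \<in> supp x"
      then have g: "g \<in> G" using x by blast
      have "hsum (\<lambda>h. \<sigma> (g \<otimes>\<^bsub>?K\<^esub> h)) y = hsum (\<lambda>h. hmult H (\<sigma> g) (\<sigma> h)) y"
      proof (rule sf.hvs.free_extend_cong)
        fix h assume "h \<in> supp y"
        then have h: "h \<in> G" using y by blast
        show "\<sigma> (g \<otimes>\<^bsub>?K\<^esub> h) = hmult H (\<sigma> g) (\<sigma> h)"
          using mult_act[OF sG(1)[OF g] sG(1)[OF h]] sG(2)[OF g] sG(2)[OF h] sg[OF mult_closed[OF sV[OF g] sV[OF h]]]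
          by simp
      qed
      also have "\<dots> = hmult H (\<sigma> g) (\<phi> y)"
        unfolding \<phi>_def
        by (rule linear_on_free_extend[OF vector_space_H vector_space_H sf.hvs.V
          sf.mult_lin(1)[OF sV[OF g]], symmetric]) (use y sV in auto)
      finally show "hsum (\<lambda>h. \<sigma> (g \<otimes>\<^bsub>?K\<^esub> h)) y = hmult H (\<sigma> g) (\<phi> y)" .
    qed
    also have "\<dots> = hmult H (\<phi> x) (\<phi> y)"
      unfolding \<phi>_def[THEN fun_cong, of x]
      by (rule linear_on_free_extend[OF vector_space_H vector_space_H sf.hvs.V
        sf.mult_lin(2)[OF phi_V[OF y]], symmetric]) (use x sV in auto)
    finally show ?thesis .
  qed
  have one: "\<phi> (hone ?L) = hone H"
    using sg[OF one_closed] one_act by (simp add: group_algebra_def \<phi>_def sf.hvs.free_extend_single)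
  have comult: "tensor2_eq (hscale H) V (\<Delta> (\<phi> x))
      (free_extend free_scale (\<lambda>(p, q). basis_elt (\<phi> p, \<phi> q)) (hcomult ?L x))" if "x \<in> hcarrier ?L" for x
  proof -
    have x: "supp x \<subseteq> G" using that by (simp add: carrier_L)
    have r: "free_extend free_scale (\<lambda>(p, q). basis_elt (\<phi> p, \<phi> q)) (hcomult ?L x) =
        free_extend free_scale (\<lambda>g. basis_elt (\<sigma> g, \<sigma> g)) x" (is "_ = ?r")
      by (simp add: group_algebra_def \<phi>_def fvs.free_extend_nested fvs.free_extend_single sf.hvs.free_extend_single)
    have "sf.hvs.teq (\<Delta> (\<phi> x)) ?r"
    proof (rule sf.teq_detect[OF comult_closed[OF phi_V[OF x]]])
      have "supp ?r \<subseteq> (\<Union>g\<in>supp x. {(\<sigma> g, \<sigma> g)})"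
        unfolding free_extend_def by (rule subset_trans[OF keys_sum]) (auto simp: in_keys_iff lookup_free_scale lookup_single when_def split: if_splits)
      then show "supp ?r \<subseteq> V \<times> V" using x sV by fastforce
      fix y assume y: "y \<in> sf.Gr"
      have yV: "y \<in> V" by (rule sf.GrD(1)[OF y])
      \<comment> \<open>Contracting the first leg of a coproduct with \<open>y\<close> is
        multiplication by \<open>y\<close>, which is diagonal on grouplikes; the representative
        \<open>\<Delta> (\<phi> x)\<close> need not be expanded.\<close>
      have "hsum (\<lambda>(p, q). B y p *h q) (\<Delta> (\<phi> x)) = sf.prd y (\<phi> x)"
        by (rule sf.prd_right[OF yV phi_V[OF x], symmetric])
      also have "\<dots> = hsum (\<lambda>g. sf.prd y (\<sigma> g)) x"
        unfolding \<phi>_def by (rule sf.prd_free_extend[OF yV]) (use x sV in auto)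
      also have "\<dots> = hsum (\<lambda>g. B y (\<sigma> g) *h \<sigma> g) x"
      proof (rule sf.hvs.free_extend_cong)
        fix g assume "g \<in> supp x"
        then have g: "g \<in> G" using x by blast
        show "sf.prd y (\<sigma> g) = B y (\<sigma> g) *h \<sigma> g"
          using sf.prd_Gr[OF sG(1)[OF g] yV] sf.prd_commute[OF yV sV[OF g]] sf.form_commute[OF yV sV[OF g]] by simp
      qed
      also have "\<dots> = hsum (\<lambda>(p, q). B y p *h q) ?r"
        by (simp add: sf.hvs.free_extend_nested sf.hvs.free_extend_single)
      finally show "hsum (\<lambda>(p, q). B y p *h q) (\<Delta> (\<phi> x)) =
        hsum (\<lambda>(p, q). B y p *h q) ?r" .
    qed
    then show ?thesis by (simp only: r)
  qed
  have counit: "\<epsilon> (\<phi> x) = hcounit ?L x" if "x \<in> hcarrier ?L" for x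
  proof -
    have x: "supp x \<subseteq> G" using that by (simp add: carrier_L)
    have "\<epsilon> (\<phi> x) = free_extend (*) (\<lambda>g. \<epsilon> (\<sigma> g)) x"
      unfolding \<phi>_def by (rule sf.counit_free_extend) (use x sV in auto)
    also have "\<dots> = free_extend (*) (\<lambda>g. 1) x"
      by (rule vector_space.free_extend_cong[OF sf.field_vector_space]) (use x sG(1) sf.GrD(3) in auto)
    finally show ?thesis by (simp add: group_algebra_def)
  qed
  have antipode: "\<phi> (hantipode ?L x) = hantipode H (\<phi> x)" if "x \<in> hcarrier ?L" for x
  proof -
    have x: "supp x \<subseteq> G" using that by (simp add: carrier_L)
    have "\<phi> (hantipode ?L x) = hsum (\<lambda>g. \<sigma> (inv\<^bsub>?K\<^esub> g)) x"
      by (simp add: group_algebra_def \<phi>_def sf.hvs.free_extend_nested sf.hvs.free_extend_single)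
    also have "\<dots> = hsum (\<lambda>g. hantipode H (\<sigma> g)) x"
    proof (rule sf.hvs.free_extend_cong)
      fix g assume "g \<in> supp x"
      then have g: "g \<in> G" using x by blast
      show "\<sigma> (inv\<^bsub>?K\<^esub> g) = hantipode H (\<sigma> g)"
        using invK[OF sG(1)[OF g]] sG(2)[OF g] sg[OF antipode_closed[OF sV[OF g]]] by simp
    qed
    also have "\<dots> = hantipode H (\<phi> x)"
      unfolding \<phi>_def
      by (rule linear_on_free_extend[OF vector_space_H vector_space_H sf.hvs.V
        antipode_linear, symmetric]) (use x sV in auto)
    finally show ?thesis .
  qed
  have act: "\<rho> (\<phi> x) = free_extend (scale C) (\<lambda>g. g) x" if "x \<in> hcarrier ?L" for x
  proof -
    have x: "supp x \<subseteq> G" using that by (simp add: carrier_L)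
    have "\<rho> (\<phi> x) = free_extend (scale C) (\<lambda>g. \<rho> (\<sigma> g)) x"
      unfolding \<phi>_def by (rule act_free_extend) (use x sV in auto)
    also have "\<dots> = free_extend (scale C) (\<lambda>g. g) x"
      by (rule scl.free_extend_cong) (use x sG(2) in auto)
    finally show ?thesis .
  qed
  have "hopf_iso ?L H \<phi>"
    unfolding hopf_iso_def using bij lin mult one comult counit antipode by simp
  then show ?thesis using sub act by blast
qed

end

theorem corollary6:
  fixes C :: "('k::{alg_closed_field, field_char_0}, 'o, 'm::ab_group_add) ribbon_cat"
    and A :: 'o and m \<iota> :: 'm
    and H :: "('k, 'h::ab_group_add) hopf"
    and \<rho> :: "'h \<Rightarrow> 'm"
  assumes "ribbon_tensor_category C"
    and "etale_algebra C A m \<iota>"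
    and "hopf_algebra H"
    and "faithful_hopf_action C A m \<iota> H \<rho>"
  shows "\<exists>G. subgroup G (alg_aut_group C A m \<iota>) \<and>
           (\<exists>\<phi>. hopf_iso (group_algebra ((alg_aut_group C A m \<iota>)\<lparr>carrier := G\<rparr>)) H \<phi> \<and>
                (\<forall>x\<in>hcarrier (group_algebra ((alg_aut_group C A m \<iota>)\<lparr>carrier := G\<rparr>)).
                   \<rho> (\<phi> x) = free_extend (scale C) (\<lambda>g. g) x))"
proof -
  interpret etale_hopf_action C A m \<iota> H \<rho>
    using assms(2,4) by (simp add: etale_hopf_action_def)
  obtain B where "split_hopf_form H B" using exists_hopf_form by blast
  then show ?thesis by (rule grouplike_group_algebra)
qed

end
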